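(* Let $x,y\in\mathbb{C}\setminus\{0\}$ with $x,y\notin q^{\mathbb{Z}}$. For all $m,n\in\mathbb{Z}$, (1) $\displaystyle M_n(y;q)M_m(x;q)-M_m(y;q)M_n(x;q)=x\,\frac{\theta(xy)\theta(y/x)}{\theta(x)^2\theta(y)^2}\bigl(S_m(q)T_{n-1}(q)-S_n(q)T_{m-1}(q)\bigr)$, (2) $$(-1)^nq^{\frac{n(n-1)}{2}}{}_0\phi_1\left(\begin{matrix}-\\0\end{matrix};q;q^{n+1}\right)M_m(x;q)-(-1)^mq^{\frac{m(m-1)}{2}}{}_0\phi_1\left(\begin{matrix}-\\0\end{matrix};q;q^{m+1}\right)M_n(x;q)=S_m(q)T_{n-1}(q)-S_n(q)T_{m-1}(q).$$ In particular, for $m=n+1$, (3) $\displaystyle M_n(y;q)M_{n+1}(x;q)-M_{n+1}(y;q)M_n(x;q)=(-1)^nxq^{\frac{n(n-1)}{2}}\frac{\theta(xy)\theta(y/x)}{\theta(x)^2\theta(y)^2}$, (4) $\displaystyle {}_0\phi_1\left(\begin{matrix}-\\0\end{matrix};q;q^{n+1}\right)M_{n+1}(x;q)+q^n\,{}_0\phi_1\left(\begin{matrix}-\\0\end{matrix};q;q^{n+2}\right)M_n(x;q)=1$. Furthermore, for $n=0$, (5) $\displaystyle M_0(y;q)M_1(x;q)-M_1(y;q)M_0(x;q)=x\,\frac{\theta(xy)\theta(y/x)}{\theta(x)^2\theta(y)^2}$, (6) $$G(q)M_1(x;q)+H(q)M_0(x;q)=G(q)M_1\bigl(q^{1/5}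;q\bigr)+H(q)M_0\bigl(q^{1/5};q\bigr)=\frac{\eta(5\tau)}{\eta(\tau/5)}\left(\frac1{R(q)}-1-R(q)\right)=1.$$
   Context: Let $i=\sqrt{-1}$, $\tau\in\mathbb{C}$ with $\mathrm{Im}(\tau)>0$, $q=e^{2\pi i\tau}$, $q^s=e^{2\pi i\tau s}$, $q^{\mathbb{Z}}=\{q^n:n\in\mathbb{Z}\}$. Set $(x;q)_\infty=(x)_\infty=\prod_{n\ge0}(1-xq^n)$, $(x)_n=(x)_\infty/(xq^n)_\infty$ for $n\in\mathbb{Z}$, $(a_1,\dots,a_r)_\beta=\prod_j(a_j)_\beta$, and $\theta(x)=(x,q/x)_\infty$. Series: ${}_0\phi_1\left(\begin{matrix}-\\0\end{matrix};q;x\right)=\sum_{n\ge0}\frac{q^{n(n-1)}}{(q)_n}x^n$ and ${}_1\psi_2\left(\begin{matrix}x\\0,0\end{matrix};q;z\right)=\sum_{n\in\mathbb{Z}}(x)_n(-1)^nq^{n(n-1)/2}z^n$. The little $\mu$-function is $l\widehat{\mu}(x,y)=\frac{iq^{-1/8}}{(x,q)_\infty\theta(qy)}\,{}_1\psi_2\left(\begin{matrix}x\\0,0\end{matrix};q;\frac1y\right)$ for nonzero $x,y\notin q^{\mathbb{Z}}$, and $$M_n(x;q)=-iq^{1/8}\,l\widehat{\mu}(x,q^{n-1}/x)=\frac{1}{(x,q)_\infty\theta(q^n/x)}\,{}_1\psi_2\left(\begin{matrix}x\\0,0\end{matrix};q;xq^{1-n}\right).$$ Schur's $q$-Fibonacci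 sequences: $(S_n(q))_{n\in\mathbb{Z}}$ and $(T_{n-1}(q))_{n\in\mathbb{Z}}$ are the unique solutions $F_n=S_n(q)$ and $F_n=T_{n-1}(q)$ of $F_n=F_{n-1}+q^{n-2}F_{n-2}$ $(n\in\mathbb{Z})$ with $S_0(q)=0,\ S_1(q)=1$ and $T_{-1}(q)=1,\ T_0(q)=0$ respectively. $G(q)=\sum_{n\ge0}\frac{q^{n^2}}{(q;q)_n}=\frac{1}{(q,q^4;q^5)_\infty}$, $H(q)=\sum_{n\ge0}\frac{q^{n^2+n}}{(q;q)_n}=\frac{1}{(q^2,q^3;q^5)_\infty}$; $R(q)=q^{1/5}\frac{H(q)}{G(q)}$ is the Rogers–Ramanujan continued fraction $\cfrac{q^{1/5}}{1+\cfrac{q}{1+\cfrac{q^2}{1+\cdots}}}$; $\eta(\tau)=q^{1/24}(q;q)_\infty$ with $q=e^{2\pi i\tau}$ is the Dedekind eta function. *)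

theory Defs
  imports "HOL-Analysis.Analysis"
begin

(* q^s depends on the choice of tau and not only on q = q^1. *)
definition qpow :: "complex \<Rightarrow> real \<Rightarrow> complex" where
  "qpow \<tau> s = exp (2 * of_real pi * \<i> * \<tau> * of_real s)"

definition qpoch_inf :: "complex \<Rightarrow> complex \<Rightarrow> complex" where
  "qpoch_inf x q = (\<Prod>k. 1 - x * q ^ k)"

definition qpoch :: "complex \<Rightarrow> complex \<Rightarrow> int \<Rightarrow> complex" where
  "qpoch x q n = qpoch_inf x q / qpoch_inf (x * q powi n) q"

definition theta :: "complex \<Rightarrow> complex \<Rightarrow> complex" where
  "theta q x = qpoch_inf x q * qpoch_inf (q / x) q"

(* 0phi1(-; 0; q; x) *)
definition phi01 :: "complex \<Rightarrow> complex \<Rightarrow> complex" where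
  "phi01 q x = (\<Sum>n. q ^ (n * (n - 1)) / qpoch q q (int n) * x ^ n)"

(* The bilateral series 1psi2(x; 0, 0; q; z) *)
definition psi12 :: "complex \<Rightarrow> complex \<Rightarrow> complex \<Rightarrow> complex" where
  "psi12 q x z =
     (\<Sum>\<^sub>\<infinity>n\<in>(UNIV :: int set). qpoch x q n * (-1) powi n * q powi (n * (n - 1) div 2) * z powi n)"

definition little_mu :: "complex \<Rightarrow> complex \<Rightarrow> complex \<Rightarrow> complex" where
  "little_mu \<tau> x y = (let q = qpow \<tau> 1 in
     \<i> * qpow \<tau> (- 1 / 8) / (qpoch_inf x q * qpoch_inf q q * theta q (q * y)) * psi12 q x (1 / y))"

definition M :: "complex \<Rightarrow> int \<Rightarrow> complex \<Rightarrow> complex" where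
  "M \<tau> n x = - \<i> * qpow \<tau> (1 / 8) * little_mu \<tau> x (qpow \<tau> 1 powi (n - 1) / x)"

lemma M_eq_psi12:
  assumes q: "q = qpow \<tau> 1" and x: "x \<noteq> 0"
  shows "M \<tau> n x =
    psi12 q x (x * q powi (1 - n)) / (qpoch_inf x q * qpoch_inf q q * theta q (q powi n / x))"
proof -
  have q0: "q \<noteq> 0" by (simp add: q qpow_def)
  have 1: "q * (q powi (n - 1) / x) = q powi n / x"
    using power_int_add[of q 1 "n - 1"] q0 by simp
  have "q powi (1 - n) = inverse (q powi (n - 1))"
    using power_int_minus[of q "n - 1"] by simp
  then have 2: "1 / (q powi (n - 1) / x) = x * q powi (1 - n)"
    by (simp add: field_simps)
  have "qpow \<tau> (1 / 8) * qpow \<tau> (- 1 / 8) = 1"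
    by (simp add: qpow_def flip: exp_add)
  then have 3: "- \<i> * qpow \<tau> (1 / 8) * (\<i> * qpow \<tau> (- 1 / 8) / D * P) = P / D" for D P
    by (simp add: algebra_simps)
  show ?thesis
    unfolding M_def little_mu_def Let_def q[symmetric] 1 2 3 ..
qed

definition schur_rec :: "complex \<Rightarrow> (int \<Rightarrow> complex) \<Rightarrow> bool" where
  "schur_rec q F \<longleftrightarrow> (\<forall>n. F n = F (n - 1) + q powi (n - 2) * F (n - 2))"

definition schur_S :: "complex \<Rightarrow> int \<Rightarrow> complex" where
  "schur_S q = (THE F. schur_rec q F \<and> F 0 = 0 \<and> F 1 = 1)"

(* It is n \<mapsto> T (n - 1), not T itself, that solves the recurrence. *)
definition schur_T :: "complex \<Rightarrow> int \<Rightarrow> complex" where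
  "schur_T q = (THE T. schur_rec q (\<lambda>n. T (n - 1)) \<and> T (-1) = 1 \<and> T 0 = 0)"

fun schur_fwd :: "complex \<Rightarrow> complex \<Rightarrow> complex \<Rightarrow> nat \<Rightarrow> complex" where
  "schur_fwd q a b 0 = a"
| "schur_fwd q a b (Suc 0) = b"
| "schur_fwd q a b (Suc (Suc n)) = schur_fwd q a b (Suc n) + q ^ n * schur_fwd q a b n"

(* The recurrence solved backwards: the k-th term is the value at 1 - k. *)
fun schur_bwd :: "complex \<Rightarrow> complex \<Rightarrow> complex \<Rightarrow> nat \<Rightarrow> complex" where
  "schur_bwd q a b 0 = b"
| "schur_bwd q a b (Suc 0) = a"
| "schur_bwd q a b (Suc (Suc k)) = (schur_bwd q a b k - schur_bwd q a b (Suc k)) * q ^ Suc k"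

lemma schur_rec_ex1:
  assumes q: "q \<noteq> 0"
  shows "\<exists>!F. schur_rec q F \<and> F 0 = a \<and> F 1 = b"
proof -
  define F where "F n = (if n \<ge> 0 then schur_fwd q a b (nat n) else schur_bwd q a b (nat (1 - n)))" for n
  have bwd: "F n = schur_bwd q a b (nat (1 - n))" if n: "n \<le> 1" for n
  proof -
    consider "n = 1" | "n = 0" | "n < 0" using n by linarith
    then show ?thesis by cases (simp_all add: F_def)
  qed
  have "F n = F (n - 1) + q powi (n - 2) * F (n - 2)" for n
  proof (cases "n \<ge> 2")
    case True
    define k where "k = nat (n - 2)"
    have "n = int k + 2" using True by (simp add: k_def)
    then have "nat n = Suc (Suc k)" "nat (n - 1) = Suc k" "nat (n - 2) = k" "q powi (n - 2) = q ^ k"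
      by auto
    with True show ?thesis by (simp add: F_def)
  next
    case False
    define k where "k = nat (1 - n)"
    have n: "n = 1 - int k" using False by (simp add: k_def)
    have e: "nat (1 - n) = k" "nat (1 - (n - 1)) = Suc k" "nat (1 - (n - 2)) = Suc (Suc k)"
      using n by auto
    have "n - 2 = - int (Suc k)" using n by simp
    then have "q powi (n - 2) = inverse (q ^ Suc k)"
      by (simp only: power_int_minus power_int_of_nat)
    moreover have "inverse (q ^ Suc k) * (c * q ^ Suc k) = c" for c
      using q by (simp add: field_simps)
    moreover have "F n = schur_bwd q a b k" "F (n - 1) = schur_bwd q a b (Suc k)"
      "F (n - 2) = schur_bwd q a b (Suc (Suc k))"
      using bwd[of n] bwd[of "n - 1"] bwd[of "n - 2"] False unfolding e by auto
    ultimately show ?thesis by (simp only: schur_bwd.simps) simp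
  qed
  then have ex: "schur_rec q F \<and> F 0 = a \<and> F 1 = b"
    by (simp add: schur_rec_def F_def)
  have uniq: "G = H" if "schur_rec q G" "schur_rec q H" "G 0 = H 0" "G 1 = H 1" for G H
  proof
    have rec: "K n = K (n - 1) + q powi (n - 2) * K (n - 2)" if "K \<in> {G, H}" for K n
      using that \<open>schur_rec q G\<close> \<open>schur_rec q H\<close> unfolding schur_rec_def by blast
    fix n :: int
    have "G n = H n \<and> G (n + 1) = H (n + 1)"
    proof (induction n rule: int_induct[where k = 0])
      case base
      show ?case using that by simp
    next
      case (step1 i)
      with rec[of G "i + 2"] rec[of H "i + 2"] show ?case by (simp add: add.commute)
    next
      case (step2 i)
      have "q powi (i - 1) \<noteq> 0" using q by simp
      moreover have "q powi (i - 1) * G (i - 1) = q powi (i - 1) * H (i - 1)"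
        using step2 rec[of G "i + 1"] rec[of H "i + 1"] by auto
      ultimately have "G (i - 1) = H (i - 1)" by (metis mult_left_cancel)
      with step2 show ?case by simp
    qed
    then show "G n = H n" ..
  qed
  show ?thesis
  proof (rule ex1I[of _ F])
    show "schur_rec q F \<and> F 0 = a \<and> F 1 = b" by (fact ex)
    show "G = F" if "schur_rec q G \<and> G 0 = a \<and> G 1 = b" for G
      using that ex by (intro uniq) auto
  qed
qed

lemma schur_S_spec:
  assumes "q \<noteq> 0"
  shows "schur_rec q (schur_S q)" "schur_S q 0 = 0" "schur_S q 1 = 1"
  using theI'[OF schur_rec_ex1[OF assms, of 0 1]] by (simp_all add: schur_S_def)

lemma schur_T_ex1:
  assumes "q \<noteq> 0"
  shows "\<exists>!T. schur_rec q (\<lambda>n. T (n - 1)) \<and> T (-1) = 1 \<and> T 0 = 0"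
proof -
  obtain F where F: "schur_rec q F" "F 0 = 1" "F 1 = 0"
    and uniq: "\<And>G. schur_rec q G \<and> G 0 = 1 \<and> G 1 = 0 \<Longrightarrow> G = F"
    using schur_rec_ex1[OF assms, of 1 0] by blast
  show ?thesis
  proof (rule ex1I[of _ "\<lambda>n. F (n + 1)"])
    show "schur_rec q (\<lambda>n. F (n - 1 + 1)) \<and> F (- 1 + 1) = 1 \<and> F (0 + 1) = 0"
      using F by simp
  next
    fix T assume "schur_rec q (\<lambda>n. T (n - 1)) \<and> T (- 1) = 1 \<and> T 0 = 0"
    then have "(\<lambda>n. T (n - 1)) = F" by (intro uniq) simp
    then show "T = (\<lambda>n. F (n + 1))" by auto
  qed
qed

lemma schur_T_spec:
  assumes "q \<noteq> 0"
  shows "schur_rec q (\<lambda>n. schur_T q (n - 1))" "schur_T q (-1) = 1" "schur_T q 0 = 0"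
  using theI'[OF schur_T_ex1[OF assms]] by (simp_all add: schur_T_def)

definition rr_G :: "complex \<Rightarrow> complex" where
  "rr_G q = (\<Sum>n. q ^ (n\<^sup>2) / qpoch q q (int n))"

definition rr_H :: "complex \<Rightarrow> complex" where
  "rr_H q = (\<Sum>n. q ^ (n\<^sup>2 + n) / qpoch q q (int n))"

definition rr_R :: "complex \<Rightarrow> complex" where
  "rr_R \<tau> = qpow \<tau> (1 / 5) * rr_H (qpow \<tau> 1) / rr_G (qpow \<tau> 1)"

definition dedekind_eta :: "complex \<Rightarrow> complex" where
  "dedekind_eta \<tau> = qpow \<tau> (1 / 24) * qpoch_inf (qpow \<tau> 1) (qpow \<tau> 1)"

end

theory Submission
  imports Defs
begin

text \<open>
  The sequences \<open>schur_S q\<close>, \<open>\<lambda>n. schur_T q (n - 1)\<close>, \<open>\<lambda>n. M \<tau> n x\<close> (for every \<open>x\<close>) and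
  \<open>\<lambda>n. (- 1) powi n * q powi (n * (n - 1) div 2) * phi01 q (q powi (n + 1))\<close> all solve the one recurrence
  \<open>F n = F (n - 1) + q powi (n - 2) * F (n - 2)\<close>. Its solution space is two-dimensional, so the Casoratian
  \<open>F n * K m - F m * K n\<close> of two solutions is the constant \<open>F 0 * K 1 - F 1 * K 0\<close> times the Casoratian of
  the Schur sequences, and for \<open>m = n + 1\<close> the latter is a sign times a power of \<open>q\<close>
  (\<open>schur_casoratian\<close>, \<open>schur_casoratian_consecutive\<close>). The first five formulas and the equation
  \<open>G M\<^sub>1 + H M\<^sub>0 = 1\<close> thus reduce to two constants: the one for the pair \<open>M(y), M(x)\<close>
  and the one for the pair \<open>\<phi>, M(x)\<close>.

  Both constants are read off at the ends of \<open>\<int>\<close>. Up to a factor independent of \<open>n\<close>, \<open>M\<^sub>n(x)\<close> is the bilateral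
  series \<open>appell x n = (\<Sum>j. (- 1)^j q^(j(j+1)/2) x^j / (x q^(j+n); q)\<^sub>\<infinity>)\<close>.

  \<^item> As \<open>n \<rightarrow> \<infinity>\<close> the reciprocals tend to \<open>1\<close>, the series becomes the Jacobi triple product, and
    \<open>M\<^sub>n(x) \<rightarrow> 1\<close>. The \<open>\<phi>\<close>-solution is the one that decays, so its Casoratian with a
    convergent solution is the limit of that solution (\<open>phi01_pairing_eq_limit\<close>); for \<open>M(x)\<close> this gives \<open>1\<close>.

  \<^item> As \<open>n \<rightarrow> - \<infinity>\<close> through even or through odd values, the summand, recentred at \<open>j = - n / 2\<close>,
    becomes a pure theta term: \<open>appell x n\<close>, divided by a power of \<open>q\<close>, tends to a multiple of
    \<open>\<Sum>i. q^(i\<^sup>2) x^(2i)\<close> or of \<open>\<Sum>i. q^(i\<^sup>2-i) x^(2i)\<close>. The Casoratian of two such limits is the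
    splitting of the double series for \<open>\<theta>(xy) \<theta>(y/x)\<close> by the parity of the exponent sum
    (\<open>theta_product_parity_split\<close>, \<open>appell_casoratian\<close>).

  For the eta quotient put \<open>p = q^(1/5)\<close>. The claim is
  \<open>(p; p)\<^sub>\<infinity> = (q^5; q^5)\<^sub>\<infinity> (G/H - p - p\<^sup>2 H/G)\<close>. Splitting Euler's pentagonal series for \<open>(p; p)\<^sub>\<infinity>\<close> by residues
  modulo 5 yields another pentagonal series and two quintuple product series
  (\<open>euler_function_5_dissection\<close>). The quintuple product identity evaluates the latter as theta quotients, which are
  \<open>G/H\<close> and \<open>H/G\<close> by the Rogers-Ramanujan identities. Those come from applying Bailey's lemma twice to
  the finite form of the Jacobi triple product.
\<close>

section \<open>Series indexed by the integers\<close>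

lemma has_sum_int_shift:
  fixes f :: "int \<Rightarrow> 'a::{topological_comm_monoid_add, t2_space}"
  shows "((\<lambda>n. f (n + k)) has_sum S) UNIV \<longleftrightarrow> (f has_sum S) UNIV"
  by (rule has_sum_reindex_bij_betw) (rule bij_betwI[of _ _ _ "\<lambda>n. n - k"], auto)

lemma infsum_int_shift:
  fixes f :: "int \<Rightarrow> 'a::{topological_comm_monoid_add, t2_space}"
  shows "(\<Sum>\<^sub>\<infinity>n. f (n + k)) = (\<Sum>\<^sub>\<infinity>n. f n)"
  by (rule infsum_reindex_bij_betw) (rule bij_betwI[of _ _ _ "\<lambda>n. n - k"], auto)

lemma infsum_int_eq_suminf:
  fixes f :: "int \<Rightarrow> complex"
  assumes "f summable_on UNIV" "\<And>n. n < 0 \<Longrightarrow> f n = 0"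
  shows "(\<Sum>\<^sub>\<infinity>n. f n) = (\<Sum>n. f (int n))"
proof -
  have "(\<Sum>\<^sub>\<infinity>n. f n) = (\<Sum>\<^sub>\<infinity>n\<in>range int. f n)"
  proof (rule infsum_cong_neutral)
    show "f n = 0" if "n \<in> UNIV - range int" for n
      by (rule assms(2)) (metis DiffD2 nonneg_int_cases not_le rangeI that)
  qed auto
  also have "\<dots> = (\<Sum>\<^sub>\<infinity>n. f (int n))"
    by (subst infsum_reindex) (auto simp: o_def)
  also have "\<dots> = (\<Sum>n. f (int n))"
  proof (rule sums_unique, rule has_sum_imp_sums, rule has_sum_infsum)
    have "f summable_on range int"
      using assms(1) by (rule summable_on_subset_banach) simp
    then show "(\<lambda>n. f (int n)) summable_on UNIV"
      by (subst (asm) summable_on_reindex) (auto simp: o_def)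
  qed
  finally show ?thesis .
qed

text \<open>
  The classes are listed as \<open>1 - j - 5 m\<close>, with \<open>m\<close> entering negatively, because the quadratic exponents
  of the pentagonal series then come out in the shape of theta series directly.
\<close>

lemma infsum_int_mod_5:
  fixes f :: "int \<Rightarrow> complex"
  assumes "f summable_on UNIV"
  shows "(\<Sum>\<^sub>\<infinity>n. f n) = (\<Sum>j<5. \<Sum>\<^sub>\<infinity>m. f (1 - int j - 5 * m))"
proof -
  define b where "b = (\<lambda>(j, m). 1 - int j - 5 * m)"
  have bij: "bij_betw b ({..<5} \<times> UNIV) UNIV"
    unfolding b_def
    by (rule bij_betwI[of _ _ _ "\<lambda>n. (nat ((1 - n) mod 5), (1 - n) div 5)"]) (auto, presburger)
  have "(\<lambda>p. f (b p)) summable_on {..<5} \<times> UNIV"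
    using assms summable_on_reindex_bij_betw[OF bij, of f] by simp
  then have "(\<lambda>(j, m). f (b (j, m))) summable_on {..<5} \<times> UNIV"
    by (simp add: case_prod_unfold)
  from infsum_Sigma'_banach[OF this]
  have "(\<Sum>\<^sub>\<infinity>j\<in>{..<5}. \<Sum>\<^sub>\<infinity>m. f (b (j, m))) = (\<Sum>\<^sub>\<infinity>p\<in>{..<5} \<times> UNIV. f (b p))"
    by (simp add: case_prod_unfold)
  also have "\<dots> = (\<Sum>\<^sub>\<infinity>n. f n)"
    by (rule infsum_reindex_bij_betw[OF bij])
  finally show ?thesis by (simp add: b_def)
qed

lemma infsum_split_bij:
  fixes F :: "'a \<Rightarrow> complex"
  assumes "F summable_on UNIV" "bij_betw g UNIV S" "bij_betw h UNIV (- S)"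
  shows "(\<Sum>\<^sub>\<infinity>p. F p) = (\<Sum>\<^sub>\<infinity>p. F (g p)) + (\<Sum>\<^sub>\<infinity>p. F (h p))"
proof -
  have "(\<Sum>\<^sub>\<infinity>p\<in>S \<union> - S. F p) = (\<Sum>\<^sub>\<infinity>p\<in>S. F p) + (\<Sum>\<^sub>\<infinity>p\<in>- S. F p)"
    by (rule infsum_Un_disjoint) (use summable_on_subset_banach[OF assms(1)] in auto)
  then show ?thesis
    using infsum_reindex_bij_betw[OF assms(2), of F] infsum_reindex_bij_betw[OF assms(3), of F]
    by (simp add: Compl_partition)
qed

lemma summable_on_nat_ratio:
  fixes f :: "nat \<Rightarrow> real"
  assumes "\<And>n. 0 \<le> f n" "\<And>n. f (Suc n) \<le> r n * f n" "r \<longlonglongrightarrow> 0"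
  shows "f summable_on UNIV"
proof -
  have "eventually (\<lambda>n. r n < 1/2) sequentially"
    using assms(3) by (rule order_tendstoD) simp
  then obtain N where N: "\<And>n. n \<ge> N \<Longrightarrow> r n < 1/2"
    by (auto simp: eventually_sequentially)
  have "summable f"
  proof (rule summable_ratio_test[of "1/2" N])
    fix n assume "N \<le> n"
    have "f (Suc n) \<le> r n * f n" by (rule assms)
    also have "\<dots> \<le> 1/2 * f n"
      using N[OF \<open>N \<le> n\<close>] assms(1) by (intro mult_right_mono) auto
    finally show "norm (f (Suc n)) \<le> 1/2 * norm (f n)"
      using assms(1) by simp
  qed simp
  then show ?thesis
    using assms(1) by (simp add: summable_on_UNIV_nonneg_real_iff)
qed

text \<open>
  All bilateral series below have quadratic exponents, so the ratio of neighbouring terms tends to zero in both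
  directions; this makes the ratio test applicable to each of them.
\<close>

lemma summable_on_int_ratio:
  fixes f :: "int \<Rightarrow> real"
  assumes nn: "\<And>n. 0 \<le> f n"
    and up: "\<And>n. f (int n + 1) \<le> r n * f (int n)" "r \<longlonglongrightarrow> 0"
    and down: "\<And>n. f (- int n - 1) \<le> s n * f (- int n)" "s \<longlonglongrightarrow> 0"
  shows "f summable_on UNIV"
proof -
  have 1: "(\<lambda>n. f (int n)) summable_on UNIV"
    by (rule summable_on_nat_ratio[where r = r]) (use nn up in \<open>auto simp: add.commute\<close>)
  have 2: "(\<lambda>n. f (- int n)) summable_on UNIV"
  proof (rule summable_on_nat_ratio[where r = s])
    show "f (- int (Suc n)) \<le> s n * f (- int n)" for n
      using down(1)[of n] by (simp add: minus_diff_commute)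
  qed (use nn down in auto)
  have "f summable_on range int"
    using 1 by (subst summable_on_reindex) (auto simp: o_def)
  moreover have "f summable_on range (\<lambda>n. - int n)"
    using 2 by (subst summable_on_reindex) (auto simp: o_def inj_on_def)
  ultimately have "f summable_on (range int \<union> range (\<lambda>n. - int n))"
    by (rule summable_on_union)
  also have "range int \<union> range (\<lambda>n. - int n) = UNIV"
  proof -
    have "x \<in> range int \<union> range (\<lambda>n. - int n)" for x
      by (cases x rule: int_cases2) auto
    then show ?thesis by blast
  qed
  finally show ?thesis .
qed

lemma summable_on_mult_bounded:
  fixes f k :: "'a \<Rightarrow> complex"
  assumes f: "f summable_on UNIV" and k: "\<And>n. norm (k n) \<le> C"
  shows "(\<lambda>n. f n * k n) summable_on UNIV"
proof -
  have "(\<lambda>n. norm (f n)) summable_on UNIV"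
    using f by (subst (asm) summable_on_iff_abs_summable_on_complex)
  then have "(\<lambda>n. norm (f n) * C) summable_on UNIV"
    by (rule summable_on_cmult_left)
  then have "(\<lambda>n. norm (f n * k n)) summable_on UNIV"
    by (rule Infinite_Sum.abs_summable_on_comparison_test')
       (auto simp: norm_mult intro!: mult_left_mono k)
  then show ?thesis by (rule abs_summable_summable)
qed

text \<open>
  Dominated convergence for unordered sums: the domination makes the finite partial sums converge uniformly in \<open>N\<close>,
  so that the two limits can be interchanged.
\<close>

lemma tannery_infsum:
  fixes f :: "nat \<Rightarrow> 'a \<Rightarrow> complex"
  assumes bound: "\<And>N n. norm (f N n) \<le> b n"
    and summable: "b summable_on UNIV"
    and lim: "\<And>n. (\<lambda>N. f N n) \<longlonglongrightarrow> g n"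
  shows "(\<lambda>N. \<Sum>\<^sub>\<infinity>n. f N n) \<longlonglongrightarrow> (\<Sum>\<^sub>\<infinity>n. g n)" and "g summable_on UNIV"
proof -
  have nrm: "norm (g n) \<le> b n" for n
    by (rule tendsto_upperbound[OF tendsto_norm[OF lim]]) (use bound in auto)
  have "(\<lambda>n. norm (g n)) summable_on UNIV"
    by (rule Infinite_Sum.abs_summable_on_comparison_test'[OF summable]) (use nrm in auto)
  then show gs: "g summable_on UNIV"
    by (rule abs_summable_summable)
  have ul: "uniform_limit UNIV (\<lambda>X N. \<Sum>n\<in>X. f N n) (\<lambda>N. \<Sum>\<^sub>\<infinity>n. f N n)
              (finite_subsets_at_top UNIV)"
    by (rule Weierstrass_m_test_general[OF _ summable]) (use bound in auto)
  show "(\<lambda>N. \<Sum>\<^sub>\<infinity>n. f N n) \<longlonglongrightarrow> (\<Sum>\<^sub>\<infinity>n. g n)"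
  proof (rule swap_uniform_limit'[OF _ _ ul])
    show "\<forall>\<^sub>F X in finite_subsets_at_top UNIV. (\<lambda>N. \<Sum>n\<in>X. f N n) \<longlonglongrightarrow> (\<Sum>n\<in>X. g n)"
      by (intro always_eventually allI tendsto_sum lim)
    show "((\<lambda>X. \<Sum>n\<in>X. g n) \<longlongrightarrow> (\<Sum>\<^sub>\<infinity>n. g n)) (finite_subsets_at_top UNIV)"
      using gs by (rule infsum_tendsto)
  qed auto
qed

lemma has_sum_times:
  fixes f :: "'a \<Rightarrow> complex" and g :: "'b \<Rightarrow> complex"
  assumes f: "(f has_sum a) A" and g: "(g has_sum b) B"
  shows "((\<lambda>(x, y). f x * g y) has_sum (a * b)) (A \<times> B)"
proof (rule has_sum_SigmaI)
  show "((\<lambda>y. case (x, y) of (x, y) \<Rightarrow> f x * g y) has_sum f x * b) B" for x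
    using has_sum_cmult_right[OF g] by simp
  show "((\<lambda>x. f x * b) has_sum a * b) A"
    by (rule has_sum_cmult_left[OF f])
  have fa: "(\<lambda>x. norm (f x)) summable_on A" and ga: "(\<lambda>x. norm (g x)) summable_on B"
    using f g by (auto simp: summable_on_iff_abs_summable_on_complex[symmetric] summable_on_def)
  have "(\<lambda>(x, y). norm (f x) * norm (g y)) summable_on A \<times> B"
  proof (rule summable_on_SigmaI)
    show "((\<lambda>y. case (x, y) of (x, y) \<Rightarrow> norm (f x) * norm (g y)) has_sum
            (norm (f x) * (\<Sum>\<^sub>\<infinity>y\<in>B. norm (g y)))) B" for x
      using has_sum_cmult_right[OF has_sum_infsum[OF ga]] by simp
    show "(\<lambda>x. norm (f x) * (\<Sum>\<^sub>\<infinity>y\<in>B. norm (g y))) summable_on A"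
      by (rule summable_on_cmult_left[OF fa])
  qed auto
  then have "(\<lambda>p. norm ((\<lambda>(x, y). f x * g y) p)) summable_on A \<times> B"
    by (simp add: case_prod_unfold norm_mult)
  then show "(\<lambda>(x, y). f x * g y) summable_on A \<times> B"
    by (rule abs_summable_summable)
qed

lemma infsum_swap_bounded:
  fixes u :: "'a \<Rightarrow> complex" and v :: "'b \<Rightarrow> complex" and k :: "'a \<Rightarrow> 'b \<Rightarrow> complex"
  assumes u: "u summable_on UNIV" and v: "v summable_on UNIV"
    and k: "\<And>x y. norm (k x y) \<le> C"
  shows "(\<Sum>\<^sub>\<infinity>x. \<Sum>\<^sub>\<infinity>y. u x * v y * k x y) = (\<Sum>\<^sub>\<infinity>y. \<Sum>\<^sub>\<infinity>x. u x * v y * k x y)"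
proof (rule infsum_swap_banach)
  have "(\<lambda>(x, y). u x * v y) summable_on UNIV \<times> UNIV"
    using has_sum_times[OF has_sum_infsum[OF u] has_sum_infsum[OF v]] by (rule has_sum_imp_summable)
  then have "(\<lambda>p. norm ((\<lambda>(x, y). u x * v y) p)) summable_on UNIV \<times> UNIV"
    by (subst (asm) summable_on_iff_abs_summable_on_complex)
  then have "(\<lambda>p. norm ((\<lambda>(x, y). u x * v y) p) * C) summable_on UNIV \<times> UNIV"
    by (rule summable_on_cmult_left)
  then have "(\<lambda>p. norm ((\<lambda>(x, y). u x * v y * k x y) p)) summable_on UNIV \<times> UNIV"
    by (rule Infinite_Sum.abs_summable_on_comparison_test')
       (auto simp: norm_mult intro!: mult_left_mono k)
  then show "(\<lambda>(x, y). u x * v y * k x y) summable_on UNIV \<times> UNIV"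
    by (rule abs_summable_summable)
qed

section \<open>Triangular exponents and integer powers\<close>

definition tri :: "int \<Rightarrow> int" where "tri n = n * (n - 1) div 2"

text \<open>
  Exponent identities are proved from this relation by linear arithmetic, with the division by 2 out of the way.
\<close>

lemma two_tri: "2 * tri n = n * (n - 1)"
  unfolding tri_def by (cases "even n") auto

lemma tri_add_one: "tri (n + 1) = tri n + n"
  using two_tri[of n] two_tri[of "n + 1"] by (simp add: algebra_simps)

lemma powi_power: "(z ^ k) powi n = z powi (int k * n)" for z :: complex
  by (simp add: power_int_mult)

lemma powi_scaled: "(c * z ^ k) powi n = c powi n * z powi (int k * n)" for z c :: complex
  by (simp add: power_int_mult_distrib powi_power)

text \<open>
  Passing from \<open>(i, j)\<close> to \<open>(i + j, j - i)\<close> turns a product of two powers into a product of powers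
  of the quotient and of the product of the bases.
\<close>

lemma powi_pair:
  fixes a b :: complex
  assumes "a \<noteq> 0" "b \<noteq> 0"
  shows "a powi (i + j) * b powi (j - i) = (a / b) powi i * (a * b) powi j"
  using assms by (simp add: power_int_add power_int_diff power_int_mult_distrib power_int_divide_distrib)

lemma minus_one_powi_cong: "even (a - b) \<Longrightarrow> (- 1 :: complex) powi a = (- 1) powi b"
  by (cases "even a"; cases "even b") auto

section \<open>Infinite q-Pochhammer products\<close>

locale nome =
  fixes q :: complex
  assumes nome_nz: "q \<noteq> 0" and nome_lt1: "norm q < 1"
begin

lemma powi_add: "q powi (a + b) = q powi a * q powi b"
  using nome_nz by (simp add: power_int_add)

lemma powi_nz: "q powi k \<noteq> 0"
  using nome_nz by simp

lemma power_tendsto_0: "(\<lambda>n. q ^ n) \<longlonglongrightarrow> 0"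
  using nome_lt1 by (rule LIMSEQ_power_zero)

lemma norm_power_tendsto_0: "(\<lambda>n. norm q ^ n) \<longlonglongrightarrow> 0"
  using nome_lt1 by (intro LIMSEQ_power_zero) auto

lemma summable_norm_geometric: "summable (\<lambda>k. r * norm q ^ k)" for r :: real
  using nome_lt1 by (intro summable_mult summable_geometric) auto

lemma power_neq_1: "q ^ k \<noteq> 1" if "k > 0" for k
proof
  assume "q ^ k = 1"
  then have "norm q ^ k = 1" by (metis norm_one norm_power)
  moreover have "norm q ^ k < 1"
    using nome_lt1 that by (simp add: power_less_one_iff)
  ultimately show False by simp
qed

lemma nome_power: "nome (q ^ k)" if "k > 0"
  by standard (use nome_nz nome_lt1 that in \<open>auto simp: norm_power power_less_one_iff\<close>)

lemma qpoch_inf_convergent: "convergent_prod (\<lambda>k. 1 - x * q ^ k)"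
proof (rule abs_convergent_prod_imp_convergent_prod, rule summable_imp_abs_convergent_prod)
  show "summable (\<lambda>k. norm (1 - x * q ^ k - 1))"
    using summable_norm_geometric[of "norm x"] by (simp add: norm_mult norm_power)
qed

lemma qpoch_inf_limit: "(\<lambda>n. \<Prod>k<n. 1 - x * q ^ k) \<longlonglongrightarrow> qpoch_inf x q"
  unfolding qpoch_inf_def
  using convergent_prod_LIMSEQ[OF qpoch_inf_convergent] by (simp add: LIMSEQ_lessThan_iff_atMost)

lemma qpoch_inf_step: "qpoch_inf x q = (1 - x) * qpoch_inf (x * q) q"
proof (rule LIMSEQ_unique)
  show "(\<lambda>n. \<Prod>k<Suc n. 1 - x * q ^ k) \<longlonglongrightarrow> qpoch_inf x q"
    by (rule LIMSEQ_Suc[OF qpoch_inf_limit])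
  have "(\<lambda>n. (1 - x) * (\<Prod>k<n. 1 - (x * q) * q ^ k)) \<longlonglongrightarrow> (1 - x) * qpoch_inf (x * q) q"
    by (intro tendsto_mult tendsto_const qpoch_inf_limit)
  then show "(\<lambda>n. \<Prod>k<Suc n. 1 - x * q ^ k) \<longlonglongrightarrow> (1 - x) * qpoch_inf (x * q) q"
    by (simp add: prod.lessThan_Suc_shift algebra_simps del: prod.lessThan_Suc)
qed

lemma qpoch_inf_step_powi:
  "qpoch_inf (x * q powi m) q = (1 - x * q powi m) * qpoch_inf (x * q powi (m + 1)) q"
  using qpoch_inf_step[of "x * q powi m"] by (simp add: powi_add mult.assoc)

lemma qpoch_inf_eq_0_iff: "qpoch_inf x q = 0 \<longleftrightarrow> (\<exists>k. x * q ^ k = 1)"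
proof -
  have "qpoch_inf x q = 0 \<longleftrightarrow> 0 \<in> range (\<lambda>k. 1 - x * q ^ k)"
    unfolding qpoch_inf_def
    by (rule has_prod_eq_0_iff[OF convergent_prod_has_prod[OF qpoch_inf_convergent]])
  also have "\<dots> \<longleftrightarrow> (\<exists>k. x * q ^ k = 1)"
    by auto
  finally show ?thesis .
qed

lemma qpoch_inf_nome_nz: "qpoch_inf q q \<noteq> 0"
  unfolding qpoch_inf_eq_0_iff using power_neq_1[of "Suc _"] by auto

text \<open>
  This is \<open>(- r; norm q)\<^sub>\<infinity>\<close>. A bound by an exponential would grow too fast: along \<open>r * norm q powi (- i)\<close>
  the product grows only like \<open>norm q powi (- (i\<^sup>2) / 2)\<close>, which the factors \<open>q powi (i * i)\<close> of the
  series below still dominate.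
\<close>

definition majorant :: "real \<Rightarrow> real" where
  "majorant r = (\<Prod>k. 1 + r * norm q ^ k)"

lemma majorant_convergent: "convergent_prod (\<lambda>k. 1 + r * norm q ^ k)"
proof (rule abs_convergent_prod_imp_convergent_prod, rule summable_imp_abs_convergent_prod)
  show "summable (\<lambda>k. norm (1 + r * norm q ^ k - 1))"
    using summable_norm_geometric[of "norm r"] by (simp add: norm_mult norm_power abs_mult)
qed

lemma majorant_limit: "(\<lambda>n. \<Prod>k<n. 1 + r * norm q ^ k) \<longlonglongrightarrow> majorant r"
  unfolding majorant_def
  using convergent_prod_LIMSEQ[OF majorant_convergent] by (simp add: LIMSEQ_lessThan_iff_atMost)

lemma majorant_step: "majorant r = (1 + r) * majorant (r * norm q)"
proof (rule LIMSEQ_unique)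
  show "(\<lambda>n. \<Prod>k<Suc n. 1 + r * norm q ^ k) \<longlonglongrightarrow> majorant r"
    by (rule LIMSEQ_Suc[OF majorant_limit])
  have "(\<lambda>n. (1 + r) * (\<Prod>k<n. 1 + (r * norm q) * norm q ^ k)) \<longlonglongrightarrow> (1 + r) * majorant (r * norm q)"
    by (intro tendsto_mult tendsto_const majorant_limit)
  then show "(\<lambda>n. \<Prod>k<Suc n. 1 + r * norm q ^ k) \<longlonglongrightarrow> (1 + r) * majorant (r * norm q)"
    by (simp add: prod.lessThan_Suc_shift algebra_simps del: prod.lessThan_Suc)
qed

lemma majorant_mono: "majorant r \<le> majorant s" if "0 \<le> r" "r \<le> s"
  by (rule tendsto_le[OF _ majorant_limit majorant_limit])
     (use that in \<open>auto intro!: prod_mono mult_right_mono always_eventually\<close>)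

lemma majorant_nonneg: "0 \<le> majorant r" if "0 \<le> r"
  by (rule tendsto_lowerbound[OF majorant_limit]) (use that in \<open>auto intro!: prod_nonneg always_eventually\<close>)

lemma norm_qpoch_inf_le: "norm (qpoch_inf x q) \<le> majorant (norm x)"
proof (rule tendsto_le[OF _ majorant_limit tendsto_norm[OF qpoch_inf_limit]])
  have "norm (\<Prod>k<n. 1 - x * q ^ k) \<le> (\<Prod>k<n. 1 + norm x * norm q ^ k)" for n
    unfolding prod_norm[symmetric]
    by (intro prod_mono conjI norm_ge_zero order_trans[OF norm_triangle_ineq4])
       (auto simp: norm_mult norm_power)
  then show "\<forall>\<^sub>F n in sequentially. norm (\<Prod>k<n. 1 - x * q ^ k) \<le> (\<Prod>k<n. 1 + norm x * norm q ^ k)"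
    by simp
qed simp

lemma norm_qpoch_inf_minus_1_le: "norm (qpoch_inf x q - 1) \<le> exp (norm x / (1 - norm q)) - 1"
proof (rule tendsto_upperbound)
  show "(\<lambda>n. norm ((\<Prod>k<n. 1 - x * q ^ k) - 1)) \<longlonglongrightarrow> norm (qpoch_inf x q - 1)"
    by (intro tendsto_intros qpoch_inf_limit)
  have "norm ((\<Prod>k<n. 1 - x * q ^ k) - 1) \<le> exp (norm x / (1 - norm q)) - 1" for n
  proof -
    have "norm ((\<Prod>k<n. 1 + - (x * q ^ k)) - 1) \<le> (\<Prod>k<n. 1 + norm (- (x * q ^ k))) - 1"
      by (rule norm_prod_minus1_le_prod_minus1)
    also have "(\<Prod>k<n. 1 + norm (- (x * q ^ k))) \<le> exp (\<Sum>k<n. norm (- (x * q ^ k)))"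
      by (rule prod_le_exp_sum) auto
    also have "(\<Sum>k<n. norm (- (x * q ^ k))) = norm x * (\<Sum>k<n. norm q ^ k)"
      by (simp add: norm_mult norm_power sum_distrib_left)
    also have "(\<Sum>k<n. norm q ^ k) \<le> (\<Sum>k. norm q ^ k)"
      using nome_lt1 by (intro sum_le_suminf summable_geometric) auto
    also have "(\<Sum>k. norm q ^ k) = 1 / (1 - norm q)"
      using nome_lt1 by (intro suminf_geometric) auto
    finally show ?thesis
      by (simp add: mult_left_mono)
  qed
  then show "\<forall>\<^sub>F n in sequentially. norm ((\<Prod>k<n. 1 - x * q ^ k) - 1) \<le> exp (norm x / (1 - norm q)) - 1"
    by simp
qed simp

lemma qpoch_inf_tendsto_1:
  assumes "(f \<longlongrightarrow> 0) F"
  shows "((\<lambda>n. qpoch_inf (f n) q) \<longlongrightarrow> 1) F"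
proof -
  have "((\<lambda>n. exp (norm (f n) / (1 - norm q)) - 1) \<longlongrightarrow> exp (norm (0::complex) / (1 - norm q)) - 1) F"
    by (intro tendsto_intros assms) (use nome_lt1 in auto)
  then have "((\<lambda>n. exp (norm (f n) / (1 - norm q)) - 1) \<longlongrightarrow> 0) F"
    by simp
  then have "((\<lambda>n. qpoch_inf (f n) q - 1) \<longlongrightarrow> 0) F"
    by (rule Lim_null_comparison[rotated]) (intro always_eventually allI norm_qpoch_inf_minus_1_le)
  then show ?thesis
    using LIM_zero_iff by blast
qed

text \<open>
  \<open>tail k\<close> stands for \<open>(q; q)\<^sub>\<infinity> / (q; q)\<^sub>k\<close>. Written as \<open>(q^(k+1); q)\<^sub>\<infinity>\<close> it makes sense for every
  integer \<open>k\<close> and vanishes for negative ones, so that finite sums with \<open>q\<close>-binomial coefficients become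
  bilateral sums whose index can be shifted without boundary terms.
\<close>

definition tail :: "int \<Rightarrow> complex" where
  "tail k = qpoch_inf (q powi (k + 1)) q"

lemma tail_minus_one: "tail (k - 1) = (1 - q powi k) * tail k"
  unfolding tail_def using qpoch_inf_step_powi[of 1 k] by simp

lemma tail_0: "tail 0 = qpoch_inf q q"
  by (simp add: tail_def)

lemma tail_neg: "tail k = 0" if "k < 0"
proof -
  have "q powi (k + 1) * q ^ nat (- k - 1) = 1"
    using that powi_add[of "k + 1" "- k - 1"] by (simp add: power_int_def)
  then show ?thesis
    unfolding tail_def qpoch_inf_eq_0_iff by blast
qed

lemma norm_powi_nonneg_le_1: "norm (q powi k) \<le> 1" if "0 \<le> k"
  using that nome_lt1 by (auto simp: power_int_def norm_power power_le_one)

lemma norm_tail_le: "norm (tail k) \<le> majorant 1"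
proof (cases "k < 0")
  case True
  then show ?thesis by (simp add: tail_neg majorant_nonneg)
next
  case False
  have "norm (tail k) \<le> majorant (norm (q powi (k + 1)))"
    unfolding tail_def by (rule norm_qpoch_inf_le)
  also have "\<dots> \<le> majorant 1"
    using False by (intro majorant_mono norm_powi_nonneg_le_1) auto
  finally show ?thesis .
qed

lemma norm_tail_pair_le: "norm (tail a * tail b) \<le> majorant 1 * majorant 1"
  unfolding norm_mult by (intro mult_mono norm_tail_le majorant_nonneg) auto

lemma powi_tendsto_0: "(\<lambda>N. q powi (int N + n)) \<longlonglongrightarrow> 0"
proof -
  have "(\<lambda>N. q ^ N * q powi n) \<longlonglongrightarrow> 0 * q powi n"
    by (intro tendsto_intros power_tendsto_0)
  then show ?thesis by (simp add: powi_add)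
qed

lemma tail_tendsto_1: "(\<lambda>N. tail (int N + n)) \<longlonglongrightarrow> 1"
  unfolding tail_def add.assoc by (intro qpoch_inf_tendsto_1 powi_tendsto_0)

lemma tail_nz: "tail (int n) \<noteq> 0"
proof -
  have "q powi (int n + 1) * q ^ k \<noteq> 1" for k
    using power_neq_1[of "n + 1 + k"] by (simp add: power_int_add nome_nz power_add ac_simps)
  then show ?thesis unfolding tail_def qpoch_inf_eq_0_iff by blast
qed

lemma qpoch_eq_tail: "qpoch q q (int n) = qpoch_inf q q / tail (int n)"
  unfolding qpoch_def tail_def using powi_add[of 1 "int n"] by (simp add: add.commute)

end

section \<open>Theta functions and the Jacobi triple product\<close>

definition theta_series :: "complex \<Rightarrow> complex \<Rightarrow> complex" where
  "theta_series Q z = (\<Sum>\<^sub>\<infinity>n. Q powi tri n * z powi n)"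

context nome
begin

lemma theta_term_add_one:
  assumes "z \<noteq> 0"
  shows "q powi tri (n + 1) * z powi (n + 1) = q powi n * z * (q powi tri n * z powi n)"
  using assms by (simp add: tri_add_one powi_add power_int_add)

lemma theta_term_minus_one:
  assumes "z \<noteq> 0"
  shows "q powi tri (n - 1) * z powi (n - 1) = q powi (1 - n) / z * (q powi tri n * z powi n)"
  using theta_term_add_one[OF assms, of "n - 1"] powi_add[of "1 - n" "n - 1"] assms
  by (simp add: field_simps)

lemma theta_terms_summable:
  assumes "z \<noteq> 0"
  shows "(\<lambda>n. q powi tri n * z powi n) summable_on UNIV"
proof (rule abs_summable_summable, rule summable_on_int_ratio)
  show "norm (q powi tri (int n + 1) * z powi (int n + 1))
          \<le> norm q ^ n * norm z * norm (q powi tri (int n) * z powi int n)" for n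
    unfolding theta_term_add_one[OF assms] by (simp add: norm_mult norm_power)
  show "norm (q powi tri (- int n - 1) * z powi (- int n - 1))
          \<le> norm q ^ Suc n / norm z * norm (q powi tri (- int n) * z powi (- int n))" for n
  proof -
    have "1 - - int n = int (Suc n)" by simp
    then show ?thesis
      unfolding theta_term_minus_one[OF assms]
      by (simp only: power_int_of_nat norm_mult norm_divide norm_power order.refl)
  qed
  show "(\<lambda>n. norm q ^ n * norm z) \<longlonglongrightarrow> 0"
    using tendsto_mult[OF norm_power_tendsto_0 tendsto_const[of "norm z"]] by simp
  show "(\<lambda>n. norm q ^ Suc n / norm z) \<longlonglongrightarrow> 0"
    using tendsto_divide[OF LIMSEQ_Suc[OF norm_power_tendsto_0] tendsto_const[of "norm z"]] assms
    by simp
qed auto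

lemma square_terms_summable:
  assumes "z \<noteq> 0"
  shows "(\<lambda>n. q powi (n * n) * z powi n) summable_on UNIV"
proof -
  \<comment> \<open>Since \<open>n\<^sup>2 = 2 tri n + n\<close>, these are theta terms with nome \<open>q\<^sup>2\<close>.\<close>
  interpret sq: nome "q ^ 2" by (rule nome_power) simp
  have "(\<lambda>n. (q ^ 2) powi tri n * (z * q ^ 1) powi n) summable_on UNIV"
    using assms nome_nz by (intro sq.theta_terms_summable) auto
  moreover have "(q ^ 2) powi tri n * (z * q ^ 1) powi n = q powi (n * n) * z powi n" for n
  proof -
    have "n * n = 2 * tri n + n" using two_tri[of n] by (simp add: algebra_simps)
    then show ?thesis
      unfolding powi_power powi_scaled by (simp add: powi_add)
  qed
  ultimately show ?thesis by simp
qed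

lemma theta_square_terms_summable:
  assumes "z \<noteq> 0"
  shows "(\<lambda>m. q powi (m * m) * (q powi tri m * z powi m)) summable_on UNIV"
  using summable_on_mult_bounded[OF theta_terms_summable[OF assms], of "\<lambda>m. q powi (m * m)" 1]
  by (simp add: norm_powi_nonneg_le_1 mult.commute)

lemma theta_step: "theta q (x * q) = - theta q x / x" if "x \<noteq> 0"
proof -
  have "qpoch_inf (1 / x) q = (1 - 1 / x) * qpoch_inf (q / x) q"
    using qpoch_inf_step[of "1 / x"] by simp
  moreover have "q / (x * q) = 1 / x"
    using nome_nz by simp
  ultimately have "theta q (x * q) = qpoch_inf (x * q) q * ((1 - 1 / x) * qpoch_inf (q / x) q)"
    by (simp only: theta_def)
  also have "\<dots> = - ((1 - x) * qpoch_inf (x * q) q * qpoch_inf (q / x) q) / x"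
    using that by (simp add: divide_simps) algebra
  also have "\<dots> = - theta q x / x"
    by (simp only: theta_def flip: qpoch_inf_step)
  finally show ?thesis .
qed

lemma theta_reflect: "theta q (q / x) = theta q x" if "x \<noteq> 0"
  using that nome_nz by (simp add: theta_def mult.commute)

lemma theta_inverse: "theta q (1 / x) = - theta q x / x" if "x \<noteq> 0"
  using theta_reflect[of "x * q"] theta_step[OF that] that nome_nz by simp

lemma theta_quasi_period:
  assumes "x \<noteq> 0"
  shows "theta q (x * q powi n) * ((- x) powi n * q powi tri n) = theta q x"
proof (induction n rule: int_induct[where k = 0])
  case base
  show ?case by (simp add: tri_def)
next
  case (step1 i)
  have "theta q (x * q powi (i + 1)) = - theta q (x * q powi i) / (x * q powi i)"
    using theta_step[of "x * q powi i"] assms powi_nz by (simp add: powi_add mult.assoc)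
  moreover have "(- x) powi (i + 1) = (- x) powi i * (- x)"
    using power_int_add[of "- x" i 1] assms by simp
  moreover have "q powi tri (i + 1) = q powi tri i * q powi i"
    by (simp add: tri_add_one powi_add)
  ultimately show ?case
    using step1.IH assms powi_nz[of i] by (simp only:) (simp add: field_simps)
next
  case (step2 i)
  have "theta q (x * q powi i) = - theta q (x * q powi (i - 1)) / (x * q powi (i - 1))"
    using theta_step[of "x * q powi (i - 1)"] assms powi_nz nome_nz powi_add[of "i - 1" 1]
    by (simp add: mult.assoc)
  moreover have "(- x) powi i = - x * (- x) powi (i - 1)"
    using power_int_add[of "- x" 1 "i - 1"] assms by simp
  moreover have "q powi tri i = q powi (i - 1) * q powi tri (i - 1)"
    using tri_add_one[of "i - 1"] by (simp add: powi_add[symmetric] add.commute)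
  ultimately show ?case
    using step2.IH assms powi_nz[of "i - 1"] by (simp only:) (simp add: field_simps nome_nz)
qed

lemma theta_eq_0_iff:
  assumes "x \<noteq> 0"
  shows "theta q x = 0 \<longleftrightarrow> x \<in> range (\<lambda>k. q powi k)"
proof
  assume "theta q x = 0"
  then consider k where "x * q ^ k = 1" | k where "q / x * q ^ k = 1"
    unfolding theta_def qpoch_inf_eq_0_iff mult_eq_0_iff by blast
  then show "x \<in> range (\<lambda>k. q powi k)"
  proof cases
    case 1
    then have "x = q powi (- int k)"
      using nome_nz by (simp add: power_int_minus field_simps)
    then show ?thesis by blast
  next
    case 2
    then have "x = q powi (int k + 1)"
      using assms by (simp add: powi_add field_simps)
    then show ?thesis by blast
  qed
next
  assume "x \<in> range (\<lambda>k. q powi k)"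
  then obtain k where k: "x = q powi k" by blast
  have "theta q 1 = 0"
    unfolding theta_def using qpoch_inf_step[of 1] by simp
  then show "theta q x = 0"
    using theta_quasi_period[of 1 k] k powi_nz[of "tri k"] nome_nz by simp
qed

text \<open>
  The Laurent coefficients of \<open>(x; q)\<^sub>N (q/x; q)\<^sub>N\<close> are theta terms times the \<open>q\<close>-binomial coefficients
  \<open>(q; q)\<^sub>2\<^sub>N / ((q; q)\<^bsub>N-n\<^esub> (q; q)\<^bsub>N+n\<^esub>)\<close>; the latter appear here, without the
  factor that is independent of \<open>n\<close>, as products of two tails.
\<close>

definition jacobi_partial :: "complex \<Rightarrow> nat \<Rightarrow> complex" where
  "jacobi_partial x N =
     (\<Sum>\<^sub>\<infinity>n. q powi tri n * (- x) powi n * (tail (int N - n) * tail (int N + n)))"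

lemma jacobi_partial_has_sum:
  assumes "x \<noteq> 0"
  shows "((\<lambda>n. q powi tri n * (- x) powi n * (tail (int N - n) * tail (int N + n)))
            has_sum jacobi_partial x N) UNIV"
  unfolding jacobi_partial_def
  by (intro has_sum_infsum summable_on_mult_bounded[OF theta_terms_summable norm_tail_pair_le])
     (use assms in auto)

text \<open>
  Multiplying by \<open>(1 - x q^N) (1 - q^(N+1) / x)\<close> combines each coefficient with its two neighbours. In terms of
  \<open>a = q^(N-n)\<close> and \<open>b = q^(N+n)\<close> the comparison of coefficients is the polynomial identity
  \<open>(1 + abq)(1 - aq)(1 - bq) + aq(1 - b)(1 - bq) + bq(1 - a)(1 - aq) = (1 - abq)(1 - abq\<^sup>2)\<close>.
\<close>

lemma jacobi_partial_Suc:
  assumes "x \<noteq> 0"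
  shows "(1 - q ^ (2 * N + 1)) * (1 - q ^ (2 * N + 2)) * jacobi_partial x (Suc N) =
         (1 - x * q ^ N) * (1 - q / x * q ^ N) * jacobi_partial x N"
proof -
  define t where "t n = q powi tri n * (- x) powi n" for n
  define u where "u N n = tail (int N - n) * tail (int N + n)" for N n
  note hs = jacobi_partial_has_sum[OF assms, folded t_def u_def]
  have "((\<lambda>n. (1 + q ^ (2 * N + 1)) * (t n * u N n) + (- x * q ^ N) * (t (n + - 1) * u N (n + - 1))
            + (- q / x * q ^ N) * (t (n + 1) * u N (n + 1)))
        has_sum ((1 + q ^ (2 * N + 1)) * jacobi_partial x N + (- x * q ^ N) * jacobi_partial x N
            + (- q / x * q ^ N) * jacobi_partial x N)) UNIV"
    by (intro has_sum_add has_sum_cmult_right hs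
          hs[of N, THEN has_sum_int_shift[where f = "\<lambda>n. t n * u N n", THEN iffD2]])
  moreover have "(1 + q ^ (2 * N + 1)) * (t n * u N n) + (- x * q ^ N) * (t (n + - 1) * u N (n + - 1))
            + (- q / x * q ^ N) * (t (n + 1) * u N (n + 1))
      = (1 - q ^ (2 * N + 1)) * (1 - q ^ (2 * N + 2)) * (t n * u (Suc N) n)" for n
  proof -
    define a where "a = q powi (int N - n)"
    define b where "b = q powi (int N + n)"
    define E where "E = tail (int N + 1 - n)"
    define F where "F = tail (int N + 1 + n)"
    have ab: "a * b = q ^ N * q ^ N"
      unfolding a_def b_def powi_add[symmetric] by (simp add: powi_add[of "int N" "int N", simplified] mult_2[symmetric])
    have qa: "q powi (int N + 1 - n) = q * a" and qb: "q powi (int N + 1 + n) = q * b"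
      unfolding a_def b_def by (simp_all add: powi_add[of 1, simplified, symmetric] algebra_simps)
    have u1: "u (Suc N) n = E * F"
      by (simp add: u_def E_def F_def algebra_simps)
    have e1: "tail (int N - n) = (1 - q * a) * E"
      using tail_minus_one[of "int N + 1 - n"] by (simp add: E_def qa)
    have e2: "tail (int N - n - 1) = (1 - a) * ((1 - q * a) * E)"
      using tail_minus_one[of "int N - n"] by (simp add: e1 a_def)
    have f1: "tail (int N + n) = (1 - q * b) * F"
      using tail_minus_one[of "int N + 1 + n"] by (simp add: F_def qb)
    have f2: "tail (int N + n - 1) = (1 - b) * ((1 - q * b) * F)"
      using tail_minus_one[of "int N + n"] by (simp add: f1 b_def)
    have u0: "u N n = (1 - q * a) * E * ((1 - q * b) * F)"
      by (simp add: u_def e1 f1)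
    have um: "u N (n + - 1) = E * ((1 - b) * ((1 - q * b) * F))"
    proof -
      have "int N - (n + - 1) = int N + 1 - n" "int N + (n + - 1) = int N + n - 1"
        by auto
      then show ?thesis by (simp only: u_def E_def f2)
    qed
    have up: "u N (n + 1) = (1 - a) * ((1 - q * a) * E) * F"
    proof -
      have "int N - (n + 1) = int N - n - 1" "int N + (n + 1) = int N + 1 + n"
        by auto
      then show ?thesis by (simp only: u_def F_def e2)
    qed
    have tp: "t (n + 1) = q powi n * (- x) * t n"
      unfolding t_def using theta_term_add_one[of "- x" n] assms by simp
    have tm: "t (n + - 1) = q powi (1 - n) / (- x) * t n"
      unfolding t_def using theta_term_minus_one[of "- x" n] assms by simp
    have c1: "(- x * q ^ N) * t (n + - 1) = q * a * t n"
      unfolding tm a_def using assms nome_nz by (simp add: powi_add power_int_diff)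
    have c2: "(- q / x * q ^ N) * t (n + 1) = q * b * t n"
      unfolding tp b_def using assms nome_nz by (simp add: powi_add)
    have d1: "q ^ (2 * N + 1) = q * (a * b)" and d2: "q ^ (2 * N + 2) = q * q * (a * b)"
      unfolding ab by (simp_all add: mult_2 power_add power2_eq_square)
    have shifted: "(- x * q ^ N) * (t (n + - 1) * u N (n + - 1)) = q * a * t n * u N (n + - 1)"
      "(- q / x * q ^ N) * (t (n + 1) * u N (n + 1)) = q * b * t n * u N (n + 1)"
      unfolding mult.assoc[symmetric] c1[unfolded mult.assoc[symmetric]] c2[unfolded mult.assoc[symmetric]]
      by simp_all
    show ?thesis
      unfolding shifted unfolding u0 u1 um up d1 d2 by algebra
  qed
  ultimately have "((\<lambda>n. (1 - q ^ (2 * N + 1)) * (1 - q ^ (2 * N + 2)) * (t n * u (Suc N) n))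
        has_sum ((1 + q ^ (2 * N + 1)) * jacobi_partial x N + (- x * q ^ N) * jacobi_partial x N
            + (- q / x * q ^ N) * jacobi_partial x N)) UNIV"
    by (simp only:)
  moreover have "((\<lambda>n. (1 - q ^ (2 * N + 1)) * (1 - q ^ (2 * N + 2)) * (t n * u (Suc N) n))
        has_sum ((1 - q ^ (2 * N + 1)) * (1 - q ^ (2 * N + 2)) * jacobi_partial x (Suc N))) UNIV"
    by (intro has_sum_cmult_right hs)
  ultimately have "(1 - q ^ (2 * N + 1)) * (1 - q ^ (2 * N + 2)) * jacobi_partial x (Suc N) =
      (1 + q ^ (2 * N + 1)) * jacobi_partial x N + (- x * q ^ N) * jacobi_partial x N
            + (- q / x * q ^ N) * jacobi_partial x N"
    using has_sum_unique by blast
  also have "\<dots> = (1 - x * q ^ N) * (1 - q / x * q ^ N) * jacobi_partial x N"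
  proof -
    have "q ^ (2 * N + 1) = q * (q ^ N * q ^ N)"
      by (simp add: mult_2 power_add)
    then show ?thesis
      using assms by (simp only:) (simp add: field_simps)
  qed
  finally show ?thesis .
qed

lemma jacobi_partial_0: "jacobi_partial x 0 = (qpoch_inf q q)\<^sup>2"
proof -
  have "jacobi_partial x 0 = (\<Sum>\<^sub>\<infinity>n\<in>{0}. q powi tri n * (- x) powi n * (tail (- n) * tail n))"
    unfolding jacobi_partial_def by (rule infsum_cong_neutral) (auto simp: tail_neg linorder_neq_iff)
  then show ?thesis
    by (simp add: tail_0 tri_def power2_eq_square)
qed

lemma finite_jacobi_triple_product:
  assumes "x \<noteq> 0"
  shows "(\<Prod>k<2 * N. 1 - q * q ^ k) * jacobi_partial x N =
         (\<Prod>k<N. 1 - x * q ^ k) * (\<Prod>k<N. 1 - q / x * q ^ k) * (qpoch_inf q q)\<^sup>2"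
proof (induction N)
  case 0
  show ?case by (simp add: jacobi_partial_0)
next
  case (Suc N)
  have "(\<Prod>k<2 * Suc N. 1 - q * q ^ k) * jacobi_partial x (Suc N) =
    (\<Prod>k<2 * N. 1 - q * q ^ k) *
     ((1 - q ^ (2 * N + 1)) * (1 - q ^ (2 * N + 2)) * jacobi_partial x (Suc N))"
    by simp
  also have "\<dots> = (\<Prod>k<2 * N. 1 - q * q ^ k) * jacobi_partial x N * ((1 - x * q ^ N) * (1 - q / x * q ^ N))"
    unfolding jacobi_partial_Suc[OF assms] by (simp only: ac_simps)
  also have "\<dots> = (\<Prod>k<Suc N. 1 - x * q ^ k) * (\<Prod>k<Suc N. 1 - q / x * q ^ k) * (qpoch_inf q q)\<^sup>2"
    unfolding Suc.IH by (simp only: prod.lessThan_Suc ac_simps)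
  finally show ?case .
qed

text \<open>
  Both sides of the finite identity converge as \<open>N \<rightarrow> \<infinity>\<close>, the series by dominated convergence since
  the tails are bounded and tend to \<open>1\<close>.
\<close>

theorem jacobi_triple_product:
  assumes "x \<noteq> 0"
  shows "theta q x * qpoch_inf q q = theta_series q (- x)"
proof -
  have lim: "(\<lambda>N. jacobi_partial x N) \<longlonglongrightarrow> (\<Sum>\<^sub>\<infinity>n. q powi tri n * (- x) powi n)"
    unfolding jacobi_partial_def
  proof (rule tannery_infsum)
    show "norm (q powi tri n * (- x) powi n * (tail (int N - n) * tail (int N + n)))
            \<le> norm (q powi tri n * (- x) powi n) * (majorant 1 * majorant 1)" for n N
      unfolding norm_mult[of "_ * _" "_ * _"] by (intro mult_left_mono norm_tail_pair_le) auto
    show "(\<lambda>n. norm (q powi tri n * (- x) powi n) * (majorant 1 * majorant 1)) summable_on UNIV"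
      using theta_terms_summable[of "- x"] assms
      by (intro summable_on_cmult_left) (simp flip: summable_on_iff_abs_summable_on_complex)
    have "(\<lambda>N. q powi tri n * (- x) powi n * (tail (int N + - n) * tail (int N + n)))
            \<longlonglongrightarrow> q powi tri n * (- x) powi n * (1 * 1)" for n
      by (intro tendsto_intros tail_tendsto_1)
    then show "(\<lambda>N. q powi tri n * (- x) powi n * (tail (int N - n) * tail (int N + n)))
            \<longlonglongrightarrow> q powi tri n * (- x) powi n" for n
      by simp
  qed
  have "filterlim (\<lambda>N::nat. 2 * N) at_top sequentially"
    by (rule filterlim_subseq) (auto simp: strict_mono_def)
  from filterlim_compose[OF qpoch_inf_limit this]
  have "(\<lambda>N. (\<Prod>k<2 * N. 1 - q * q ^ k) * jacobi_partial x N)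
          \<longlonglongrightarrow> qpoch_inf q q * theta_series q (- x)"
    unfolding theta_series_def by (intro tendsto_mult lim)
  moreover have "(\<lambda>N. (\<Prod>k<2 * N. 1 - q * q ^ k) * jacobi_partial x N)
          \<longlonglongrightarrow> qpoch_inf x q * qpoch_inf (q / x) q * (qpoch_inf q q)\<^sup>2"
    unfolding finite_jacobi_triple_product[OF assms]
    by (intro tendsto_mult qpoch_inf_limit tendsto_const)
  ultimately have "qpoch_inf q q * theta_series q (- x) =
      qpoch_inf x q * qpoch_inf (q / x) q * (qpoch_inf q q)\<^sup>2"
    by (rule LIMSEQ_unique)
  then show ?thesis
    using qpoch_inf_nome_nz by (simp add: theta_def power2_eq_square)
qed

end

section \<open>The Rogers-Ramanujan identities\<close>

context nome
begin

text \<open>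
  This is a case of the \<open>q\<close>-Vandermonde sum. Let \<open>f n b\<close> be the left-hand side. A combination of four shifts
  of the summand vanishes termwise, which says that the defect \<open>d n b = f (n - 1) (b - 1) - (1 - q^n) f n b\<close>
  satisfies \<open>d n (b + 1) = - q^(- b) d n b\<close>. For \<open>b > n\<close> every summand is zero, hence \<open>d = 0\<close>
  throughout, and \<open>f n b\<close> reduces step by step to \<open>f 0 (b - n)\<close>, which has a single term.
\<close>

lemma q_vandermonde_tail:
  assumes "0 \<le> n"
  shows "((\<lambda>s. q powi (s * (s - b)) * (tail (n - s) * tail s * tail (s - b)))
           has_sum qpoch_inf q q * tail n * tail (n - b)) UNIV"
proof -
  define g where "g n b s = q powi (s * (s - b)) * (tail (n - s) * tail s * tail (s - b))" for n b s
  define f where "f n b = (\<Sum>\<^sub>\<infinity>s. g n b s)" for n b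
  have hs: "(g n b has_sum f n b) UNIV" for n b
    unfolding f_def
  proof (rule has_sum_infsum, rule finite_nonzero_values_imp_summable_on)
    have "{s \<in> UNIV. g n b s \<noteq> 0} \<subseteq> {0..n}"
    proof
      fix s assume "s \<in> {s \<in> UNIV. g n b s \<noteq> 0}"
      then have "tail (n - s) \<noteq> 0" "tail s \<noteq> 0" by (auto simp: g_def)
      then show "s \<in> {0..n}" using tail_neg[of "n - s"] tail_neg[of s] by force
    qed
    then show "finite {s \<in> UNIV. g n b s \<noteq> 0}"
      by (rule finite_subset) simp
  qed
  define d where "d n b = f (n - 1) (b - 1) - (1 - q powi n) * f n b" for n b
  have d_step: "d n (b + 1) = - (q powi (- b) * d n b)" for n b
  proof -
    have "((\<lambda>s. g (n - 1) b s + - (1 - q powi n) * g n (b + 1) s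
              + q powi (- b) * g (n - 1) (b - 1) (s + - 1) + - (q powi (- b) * (1 - q powi n)) * g n b s)
         has_sum (f (n - 1) b + - (1 - q powi n) * f n (b + 1)
              + q powi (- b) * f (n - 1) (b - 1) + - (q powi (- b) * (1 - q powi n)) * f n b)) UNIV"
      by (intro has_sum_add has_sum_cmult_right hs hs[THEN has_sum_int_shift[THEN iffD2]])
    moreover have "g (n - 1) b s + - (1 - q powi n) * g n (b + 1) s
              + q powi (- b) * g (n - 1) (b - 1) (s + - 1) + - (q powi (- b) * (1 - q powi n)) * g n b s = 0" for s
    proof -
      define P where "P = q powi (s * (s - b))"
      define A where "A = tail (n - s)"
      define B where "B = tail s"
      define C where "C = tail (s - b)"
      define u where "u = q powi s"
      define v where "v = q powi b"
      define w where "w = q powi n"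
      have nz: "u \<noteq> 0" "v \<noteq> 0" "w \<noteq> 0"
        using powi_nz by (simp_all add: u_def v_def w_def)
      have "tail (n - 1 - s) = (1 - w / u) * A"
        using tail_minus_one[of "n - s"] nome_nz
        by (simp add: A_def w_def u_def power_int_diff algebra_simps)
      then have g1: "g (n - 1) b s = P * ((1 - w / u) * A * B * C)"
        by (simp add: g_def P_def B_def C_def)
      have "tail (s - (b + 1)) = (1 - u / v) * C"
        using tail_minus_one[of "s - b"] nome_nz
        by (simp add: C_def v_def u_def power_int_diff algebra_simps)
      moreover have "s * (s - (b + 1)) = s * (s - b) - s"
        by (simp add: algebra_simps)
      ultimately have g2: "g n (b + 1) s = P / u * (A * B * ((1 - u / v) * C))"
        using nome_nz by (simp add: g_def P_def A_def B_def u_def power_int_diff)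
      have "(s + - 1) * (s + - 1 - (b - 1)) = s * (s - b) - s + b"
        "n - 1 - (s + - 1) = n - s" "s + - 1 - (b - 1) = s - b" "s + - 1 = s - 1"
        by (simp_all add: algebra_simps)
      then have g3: "g (n - 1) (b - 1) (s + - 1) = P / u * v * (A * ((1 - u) * B) * C)"
        using nome_nz by (simp only: g_def tail_minus_one)
          (simp add: P_def A_def B_def C_def u_def v_def power_int_diff powi_add)
      have g4: "g n b s = P * (A * B * C)"
        by (simp add: g_def P_def A_def B_def C_def)
      have vi: "q powi (- b) = 1 / v"
        by (simp add: v_def power_int_minus divide_inverse)
      show ?thesis
        unfolding g1 g2 g3 g4 vi w_def[symmetric] using nz by (simp add: field_simps)
    qed
    ultimately have "((\<lambda>s. 0) has_sum (f (n - 1) b + - (1 - q powi n) * f n (b + 1)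
              + q powi (- b) * f (n - 1) (b - 1) + - (q powi (- b) * (1 - q powi n)) * f n b)) (UNIV :: int set)"
      by (simp only:)
    then have "f (n - 1) b + - (1 - q powi n) * f n (b + 1)
              + q powi (- b) * f (n - 1) (b - 1) + - (q powi (- b) * (1 - q powi n)) * f n b = 0"
      by (rule has_sum_unique[OF _ has_sum_0_simp])
    then show ?thesis
      unfolding d_def by (simp add: algebra_simps)
  qed
  have f_large: "f n b = 0" if "n < b" for n b
  proof -
    have "g n b s = 0" for s
      using that by (cases "s \<le> n") (auto simp: g_def tail_neg)
    then show ?thesis by (simp add: f_def)
  qed
  \<comment> \<open>The step relation has invertible factors, so the zeros at \<open>b > n\<close> propagate down to all \<open>b\<close>.\<close>
  have d_0: "d n b = 0" for n b
  proof (cases "b > n")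
    case True
    then show ?thesis by (simp add: d_def f_large)
  next
    case False
    then have "b \<le> n + 1" by simp
    then show ?thesis
    proof (induction b rule: int_le_induct)
      case base
      show ?case by (simp add: d_def f_large)
    next
      case (step i)
      then show ?case
        using d_step[of n "i - 1"] powi_nz nome_nz by simp
    qed
  qed
  have main: "f (int k) b = qpoch_inf q q * tail (int k) * tail (int k - b)" for k b
  proof (induction k arbitrary: b)
    case 0
    have "f 0 b = (\<Sum>\<^sub>\<infinity>s\<in>{0}. g 0 b s)"
      unfolding f_def by (rule infsum_cong_neutral) (auto simp: g_def tail_neg linorder_neq_iff)
    then show ?case
      by (simp add: g_def tail_0)
  next
    case (Suc k)
    have nz: "1 - q powi (int (Suc k)) \<noteq> 0"
      using power_neq_1[of "Suc k"] by (metis power_int_of_nat right_minus_eq zero_less_Suc)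
    have "(1 - q powi (int (Suc k))) * f (int (Suc k)) b = f (int k) (b - 1)"
      using d_0[of "int (Suc k)" b] by (simp add: d_def)
    also have "\<dots> = qpoch_inf q q * tail (int (Suc k) - 1) * tail (int (Suc k) - b)"
      unfolding Suc.IH by (simp add: algebra_simps)
    also have "\<dots> = (1 - q powi (int (Suc k))) * (qpoch_inf q q * tail (int (Suc k)) * tail (int (Suc k) - b))"
      unfolding tail_minus_one by (simp only: ac_simps)
    finally show ?case using nz by (metis mult_left_cancel)
  qed
  have "int (nat n) = n" using assms by simp
  then show ?thesis
    using hs[of n b] main[of "nat n" b] unfolding g_def by simp
qed

lemma tail_convolution:
  "((\<lambda>s. q powi (s * s) * (tail (N - s) * tail (s - m) * tail (s + m)))
      has_sum q powi (m * m) * qpoch_inf q q * (tail (N - m) * tail (N + m))) UNIV"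
proof (cases "N < m")
  case True
  then have vanish: "tail (N - s) * tail (s - m) * tail (s + m) = 0" for s
    by (cases "s \<le> N") (auto simp: tail_neg)
  show ?thesis unfolding vanish using True by (simp add: tail_neg)
next
  case False
  \<comment> \<open>The index is shifted by \<open>m\<close>, and \<open>(s + m)\<^sup>2 = m\<^sup>2 + s (s + 2 m)\<close>: this is the case \<open>b = - 2 m\<close>.\<close>
  have "((\<lambda>s. q powi (m * m) * (q powi (s * (s - (- 2 * m))) *
            (tail (N - m - s) * tail s * tail (s - (- 2 * m)))))
      has_sum q powi (m * m) * (qpoch_inf q q * tail (N - m) * tail (N - m - (- 2 * m)))) UNIV"
    by (intro has_sum_cmult_right q_vandermonde_tail) (use False in auto)
  from this[THEN has_sum_int_shift[where k = "- m", THEN iffD2]]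
  have *: "((\<lambda>s. q powi (m * m) * (q powi ((s + - m) * (s + - m - (- 2 * m))) *
             (tail (N - m - (s + - m)) * tail (s + - m) * tail (s + - m - (- 2 * m)))))
      has_sum q powi (m * m) * (qpoch_inf q q * tail (N - m) * tail (N - m - (- 2 * m)))) UNIV" .
  have "q powi (m * m) * (q powi ((s + - m) * (s + - m - (- 2 * m))) *
             (tail (N - m - (s + - m)) * tail (s + - m) * tail (s + - m - (- 2 * m)))) =
         q powi (s * s) * (tail (N - s) * tail (s - m) * tail (s + m))" for s
  proof -
    have "s * s = m * m + (s + - m) * (s + - m - (- 2 * m))"
      by (simp add: algebra_simps)
    moreover have "N - m - (s + - m) = N - s" "s + - m = s - m" "s + - m - (- 2 * m) = s + m"
      by simp_all
    ultimately show ?thesis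
      by (simp only: powi_add mult.assoc)
  qed
  moreover have "N - m - (- 2 * m) = N + m"
    by simp
  ultimately show ?thesis
    using * by (simp only: mult.assoc)
qed

lemma tail_convolution_limit:
  "(\<Sum>\<^sub>\<infinity>s. q powi (s * s) * (tail (s - m) * tail (s + m))) = q powi (m * m) * qpoch_inf q q"
proof (rule LIMSEQ_unique)
  have sq: "(\<lambda>s. q powi (s * s)) summable_on UNIV"
    using square_terms_summable[of 1] by simp
  show "(\<lambda>N. \<Sum>\<^sub>\<infinity>s. q powi (s * s) * (tail (int N - s) * tail (s - m) * tail (s + m)))
          \<longlonglongrightarrow> (\<Sum>\<^sub>\<infinity>s. q powi (s * s) * (tail (s - m) * tail (s + m)))"
  proof (rule tannery_infsum)
    show "norm (q powi (s * s) * (tail (int N - s) * tail (s - m) * tail (s + m)))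
            \<le> norm (q powi (s * s)) * (majorant 1 * majorant 1 * majorant 1)" for N s
      unfolding norm_mult
      by (intro mult_left_mono mult_mono norm_tail_le majorant_nonneg mult_nonneg_nonneg) auto
    show "(\<lambda>s. norm (q powi (s * s)) * (majorant 1 * majorant 1 * majorant 1)) summable_on UNIV"
      using sq by (intro summable_on_cmult_left) (simp flip: summable_on_iff_abs_summable_on_complex)
    have "(\<lambda>N. q powi (s * s) * (tail (int N + - s) * tail (s - m) * tail (s + m)))
            \<longlonglongrightarrow> q powi (s * s) * (1 * tail (s - m) * tail (s + m))" for s
      by (intro tendsto_intros tail_tendsto_1)
    then show "(\<lambda>N. q powi (s * s) * (tail (int N - s) * tail (s - m) * tail (s + m)))
            \<longlonglongrightarrow> q powi (s * s) * (tail (s - m) * tail (s + m))" for s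
      by simp
  qed
  have "(\<lambda>N. q powi (m * m) * qpoch_inf q q * (tail (int N + - m) * tail (int N + m)))
          \<longlonglongrightarrow> q powi (m * m) * qpoch_inf q q * (1 * 1)"
    by (intro tendsto_intros tail_tendsto_1)
  then show "(\<lambda>N. \<Sum>\<^sub>\<infinity>s. q powi (s * s) * (tail (int N - s) * tail (s - m) * tail (s + m)))
          \<longlonglongrightarrow> q powi (m * m) * qpoch_inf q q"
    unfolding infsumI[OF tail_convolution] by simp
qed

text \<open>
  In Bailey's terminology, \<open>d\<close> and its transform form, up to the factor \<open>(q; q)\<^sub>\<infinity>\<^sup>2\<close>, a bilateral Bailey
  pair relative to \<open>1\<close>.
\<close>

definition bailey_transform :: "(int \<Rightarrow> complex) \<Rightarrow> int \<Rightarrow> complex" where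
  "bailey_transform d s = (\<Sum>\<^sub>\<infinity>m. d m * (tail (s - m) * tail (s + m)))"

text \<open>
  Multiplying \<open>d m\<close> by \<open>q powi (m * m)\<close> corresponds to a summation of the transform: interchange the sums and
  evaluate the inner one by \<open>tail_convolution\<close>.
\<close>

lemma bailey_lemma:
  assumes d: "d summable_on UNIV"
  shows "qpoch_inf q q * bailey_transform (\<lambda>m. q powi (m * m) * d m) s =
         (\<Sum>\<^sub>\<infinity>r. q powi (r * r) * tail (s - r) * bailey_transform d r)"
proof -
  have sq: "(\<lambda>s. q powi (s * s)) summable_on UNIV"
    using square_terms_summable[of 1] by simp
  have "(\<Sum>\<^sub>\<infinity>r. q powi (r * r) * tail (s - r) * bailey_transform d r) =
        (\<Sum>\<^sub>\<infinity>r. \<Sum>\<^sub>\<infinity>m. q powi (r * r) * d m * (tail (s - r) * tail (r - m) * tail (r + m)))"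
    unfolding bailey_transform_def infsum_cmult_right'[symmetric] by (simp only: ac_simps)
  also have "\<dots> = (\<Sum>\<^sub>\<infinity>m. \<Sum>\<^sub>\<infinity>r. q powi (r * r) * d m * (tail (s - r) * tail (r - m) * tail (r + m)))"
    by (rule infsum_swap_bounded[where C = "majorant 1 * majorant 1 * majorant 1", OF sq d])
       (unfold norm_mult, intro mult_mono norm_tail_le majorant_nonneg mult_nonneg_nonneg, auto)
  also have "\<dots> = (\<Sum>\<^sub>\<infinity>m. d m * (\<Sum>\<^sub>\<infinity>r. q powi (r * r) * (tail (s - r) * tail (r - m) * tail (r + m))))"
    unfolding infsum_cmult_right'[symmetric] by (simp only: ac_simps)
  also have "\<dots> = (\<Sum>\<^sub>\<infinity>m. qpoch_inf q q * (q powi (m * m) * d m * (tail (s - m) * tail (s + m))))"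
    unfolding infsumI[OF tail_convolution] by (simp only: ac_simps)
  finally show ?thesis
    unfolding bailey_transform_def infsum_cmult_right' by simp
qed

lemma bailey_lemma_limit:
  assumes d: "d summable_on UNIV"
  shows "qpoch_inf q q * (\<Sum>\<^sub>\<infinity>m. q powi (m * m) * d m) =
         (\<Sum>\<^sub>\<infinity>r. q powi (r * r) * bailey_transform d r)"
proof -
  have sq: "(\<lambda>s. q powi (s * s)) summable_on UNIV"
    using square_terms_summable[of 1] by simp
  have "(\<Sum>\<^sub>\<infinity>r. q powi (r * r) * bailey_transform d r) =
        (\<Sum>\<^sub>\<infinity>r. \<Sum>\<^sub>\<infinity>m. q powi (r * r) * d m * (tail (r - m) * tail (r + m)))"
    unfolding bailey_transform_def infsum_cmult_right'[symmetric] by (simp only: ac_simps)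
  also have "\<dots> = (\<Sum>\<^sub>\<infinity>m. \<Sum>\<^sub>\<infinity>r. q powi (r * r) * d m * (tail (r - m) * tail (r + m)))"
    by (rule infsum_swap_bounded[OF sq d norm_tail_pair_le])
  also have "\<dots> = (\<Sum>\<^sub>\<infinity>m. d m * (\<Sum>\<^sub>\<infinity>r. q powi (r * r) * (tail (r - m) * tail (r + m))))"
    unfolding infsum_cmult_right'[symmetric] by (simp only: ac_simps)
  also have "\<dots> = (\<Sum>\<^sub>\<infinity>m. qpoch_inf q q * (q powi (m * m) * d m))"
    unfolding tail_convolution_limit by (simp only: ac_simps)
  finally show ?thesis
    unfolding infsum_cmult_right' by simp
qed

lemma bailey_transform_theta:
  "bailey_transform (\<lambda>m. q powi tri m * (- x) powi m) (int N) = jacobi_partial x N"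
  by (simp add: bailey_transform_def jacobi_partial_def)

lemma bailey_transform_neg: "bailey_transform d s = 0" if "s < 0"
proof -
  have vanish: "tail (s - m) * tail (s + m) = 0" for m
    using that by (cases "m \<ge> 0") (auto simp: tail_neg)
  show ?thesis unfolding bailey_transform_def vanish by simp
qed

text \<open>
  At a positive power of \<open>q\<close> the product \<open>(q/x; q)\<^sub>N\<close> contains a zero factor once \<open>N\<close> is large enough,
  so the transform of a theta sequence at such a point has finite support.
\<close>

lemma jacobi_partial_vanish:
  assumes "x \<noteq> 0" "x = q ^ k" "0 < k" "k \<le> N"
  shows "jacobi_partial x N = 0"
  using assms(4)
proof (induction N rule: dec_induct)
  case base
  obtain j where j: "k = Suc j" using assms(3) by (cases k) auto
  have "1 - q / x * q ^ j = 0"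
    unfolding assms(2) j using nome_nz by simp
  then have "(1 - q ^ (2 * j + 1)) * (1 - q ^ (2 * j + 2)) * jacobi_partial x (Suc j) = 0"
    unfolding jacobi_partial_Suc[OF assms(1)] by simp
  then show ?case
    using power_neq_1[of "2 * j + 1"] power_neq_1[of "2 * j + 2"] unfolding j by auto
next
  case (step n)
  then have "(1 - q ^ (2 * n + 1)) * (1 - q ^ (2 * n + 2)) * jacobi_partial x (Suc n) = 0"
    unfolding jacobi_partial_Suc[OF assms(1)] by simp
  then show ?case
    using power_neq_1[of "2 * n + 1"] power_neq_1[of "2 * n + 2"] by auto
qed

lemma tail_series_summable: "(\<lambda>s. q powi (s * s) * (z powi s * tail s)) summable_on UNIV" if "z \<noteq> 0"
  using summable_on_mult_bounded[OF square_terms_summable[OF that] norm_tail_le] by (simp add: mult.assoc)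

lemma tail_series_eq:
  assumes "z \<noteq> 0"
  shows "(\<Sum>\<^sub>\<infinity>s. q powi (s * s) * (z powi s * tail s)) =
         qpoch_inf q q * (\<Sum>n. q ^ (n\<^sup>2) * z ^ n / qpoch q q (int n))"
proof -
  have "(\<Sum>\<^sub>\<infinity>s. q powi (s * s) * (z powi s * tail s)) =
        (\<Sum>n. q powi (int n * int n) * (z powi int n * tail (int n)))"
    by (rule infsum_int_eq_suminf[OF tail_series_summable[OF assms]]) (simp add: tail_neg)
  also have "\<dots> = (\<Sum>n. qpoch_inf q q * (q ^ (n\<^sup>2) * z ^ n / qpoch q q (int n)))"
  proof (rule suminf_cong)
    fix n
    have "q powi (int n * int n) = q ^ (n\<^sup>2)"
      by (simp add: power2_eq_square flip: of_nat_mult)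
    then show "q powi (int n * int n) * (z powi int n * tail (int n)) =
        qpoch_inf q q * (q ^ (n\<^sup>2) * z ^ n / qpoch q q (int n))"
      using tail_nz[of n] qpoch_inf_nome_nz by (simp add: qpoch_eq_tail)
  qed
  also have "\<dots> = qpoch_inf q q * (\<Sum>n. q ^ (n\<^sup>2) * z ^ n / qpoch q q (int n))"
  proof (rule suminf_mult)
    have "(\<lambda>s. q powi (s * s) * (z powi s * tail s)) summable_on range int"
      using tail_series_summable[OF assms] by (rule summable_on_subset_banach) simp
    then have "(\<lambda>n. q powi (int n * int n) * (z powi int n * tail (int n))) summable_on UNIV"
      by (subst (asm) summable_on_reindex) (auto simp: o_def)
    then have "summable (\<lambda>n. q powi (int n * int n) * (z powi int n * tail (int n)) / qpoch_inf q q)"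
      by (intro summable_divide summable_on_imp_summable)
    moreover have "q powi (int n * int n) * (z powi int n * tail (int n)) / qpoch_inf q q =
        q ^ (n\<^sup>2) * z ^ n / qpoch q q (int n)" for n
    proof -
      have "q powi (int n * int n) = q ^ (n\<^sup>2)"
        by (simp add: power2_eq_square flip: of_nat_mult)
      then show ?thesis
        using tail_nz[of n] qpoch_inf_nome_nz by (simp add: qpoch_eq_tail)
    qed
    ultimately show "summable (\<lambda>n. q ^ (n\<^sup>2) * z ^ n / qpoch q q (int n))"
      by (simp only:)
  qed
  finally show ?thesis .
qed

text \<open>
  At \<open>x = q\<close> the transform is supported at \<open>0\<close>. One application of Bailey's lemma then yields a multiple of
  \<open>tail s\<close>, and the second one, with the upper limit at infinity, the sum side of the identity.
\<close>

theorem rogers_ramanujan_G: "qpoch_inf q q * rr_G q = theta_series (q ^ 5) (- (q ^ 3))"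
proof -
  define d where "d m = q powi tri m * (- q) powi m" for m
  have d: "d summable_on UNIV"
    unfolding d_def using nome_nz by (intro theta_terms_summable) auto
  have dq: "(\<lambda>m. q powi (m * m) * d m) summable_on UNIV"
    using theta_square_terms_summable[of "- q"] nome_nz by (simp add: d_def)
  have d0: "bailey_transform d r = 0" if "r \<noteq> 0" for r
  proof (cases "r < 0")
    case True
    then show ?thesis by (rule bailey_transform_neg)
  next
    case False
    then have "jacobi_partial q (nat r) = 0"
      using that nome_nz by (intro jacobi_partial_vanish[where k = 1]) auto
    then show ?thesis
      using bailey_transform_theta[of q "nat r"] False by (simp add: d_def[abs_def])
  qed
  have d1: "bailey_transform d 0 = (qpoch_inf q q)\<^sup>2"
    using bailey_transform_theta[of q 0] jacobi_partial_0 by (simp add: d_def[abs_def])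
  have t1: "bailey_transform (\<lambda>m. q powi (m * m) * d m) s = qpoch_inf q q * tail s" for s
  proof -
    have "qpoch_inf q q * bailey_transform (\<lambda>m. q powi (m * m) * d m) s =
        (\<Sum>\<^sub>\<infinity>r\<in>{0}. q powi (r * r) * tail (s - r) * bailey_transform d r)"
      unfolding bailey_lemma[OF d] by (rule infsum_cong_neutral) (auto simp: d0)
    then show ?thesis
      using qpoch_inf_nome_nz by (simp add: d1 power2_eq_square)
  qed
  have "qpoch_inf q q * (\<Sum>\<^sub>\<infinity>m. q powi (m * m) * (q powi (m * m) * d m)) =
        (\<Sum>\<^sub>\<infinity>r. qpoch_inf q q * (q powi (r * r) * (1 powi r * tail r)))"
    unfolding bailey_lemma_limit[OF dq] t1 by (simp add: ac_simps)
  also have "\<dots> = qpoch_inf q q * (\<Sum>\<^sub>\<infinity>r. q powi (r * r) * (1 powi r * tail r))"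
    by (rule infsum_cmult_right')
  also have "\<dots> = qpoch_inf q q * (qpoch_inf q q * rr_G q)"
    unfolding tail_series_eq[OF one_neq_zero] rr_G_def by simp
  finally have "qpoch_inf q q * rr_G q = (\<Sum>\<^sub>\<infinity>m. q powi (m * m) * (q powi (m * m) * d m))"
    using qpoch_inf_nome_nz by simp
  moreover have "q powi (m * m) * (q powi (m * m) * d m) = (q ^ 5) powi tri m * (- (q ^ 3)) powi m" for m
  proof -
    have "5 * tri m + 3 * m = m * m + (m * m + (tri m + m))"
      using two_tri[of m] by (simp add: algebra_simps)
    from arg_cong[OF this, of "\<lambda>k. q powi k * (- 1) powi m"] show ?thesis
      using powi_scaled[of "- 1" q 3 m] powi_scaled[of "- 1" q 1 m] powi_add[of "m * m" "m * m"]
      by (simp add: d_def powi_power powi_add)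
  qed
  ultimately show ?thesis by (simp add: theta_series_def)
qed

text \<open>
  At \<open>x = q\<^sup>2\<close> the transform is supported at \<open>0\<close> and \<open>1\<close>. The two contributions to the first application of
  Bailey's lemma are, up to a constant, \<open>tail s\<close> and \<open>- tail (s - 1) = - (1 - q^s) tail s\<close>; their sum supplies the additional
  factor \<open>q^s\<close> of the series \<open>H\<close>.
\<close>

theorem rogers_ramanujan_H: "qpoch_inf q q * rr_H q = theta_series (q ^ 5) (- (q ^ 4))"
proof -
  define d where "d m = q powi tri m * (- (q\<^sup>2)) powi m" for m
  have d: "d summable_on UNIV"
    unfolding d_def using nome_nz by (intro theta_terms_summable) auto
  have dq: "(\<lambda>m. q powi (m * m) * d m) summable_on UNIV"
    using theta_square_terms_summable[of "- (q\<^sup>2)"] nome_nz by (simp add: d_def)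
  have d0: "bailey_transform d r = 0" if "r \<noteq> 0" "r \<noteq> 1" for r
  proof (cases "r < 0")
    case True
    then show ?thesis by (rule bailey_transform_neg)
  next
    case False
    then have "jacobi_partial (q\<^sup>2) (nat r) = 0"
      using that nome_nz by (intro jacobi_partial_vanish[where k = 2]) auto
    then show ?thesis
      using bailey_transform_theta[of "q\<^sup>2" "nat r"] False by (simp add: d_def[abs_def])
  qed
  have d1: "bailey_transform d 0 = (qpoch_inf q q)\<^sup>2"
    using bailey_transform_theta[of "q\<^sup>2" 0] jacobi_partial_0 by (simp add: d_def[abs_def])
  have d2: "q * bailey_transform d 1 = - ((qpoch_inf q q)\<^sup>2)"
  proof -
    have "(1 - q) * (1 - q\<^sup>2) * jacobi_partial (q\<^sup>2) 1 = (1 - q\<^sup>2) * (1 - q / q\<^sup>2) * (qpoch_inf q q)\<^sup>2"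
      using jacobi_partial_Suc[of "q\<^sup>2" 0] nome_nz by (simp add: jacobi_partial_0 power2_eq_square)
    then have "(1 - q) * (1 - q\<^sup>2) * (q * jacobi_partial (q\<^sup>2) 1) =
               (1 - q) * (1 - q\<^sup>2) * (- ((qpoch_inf q q)\<^sup>2))"
      using nome_nz by (simp add: field_simps power2_eq_square)
    then have "q * jacobi_partial (q\<^sup>2) 1 = - ((qpoch_inf q q)\<^sup>2)"
      using power_neq_1[of 1] power_neq_1[of 2]
        mult_left_cancel[of "(1 - q) * (1 - q\<^sup>2)" "q * jacobi_partial (q\<^sup>2) 1" "- ((qpoch_inf q q)\<^sup>2)"]
      by simp
    then show ?thesis
      using bailey_transform_theta[of "q\<^sup>2" 1] by (simp add: d_def[abs_def])
  qed
  have t1: "bailey_transform (\<lambda>m. q powi (m * m) * d m) s = qpoch_inf q q * (q powi s * tail s)" for s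
  proof -
    have "qpoch_inf q q * bailey_transform (\<lambda>m. q powi (m * m) * d m) s =
        (\<Sum>\<^sub>\<infinity>r\<in>{0, 1}. q powi (r * r) * tail (s - r) * bailey_transform d r)"
      unfolding bailey_lemma[OF d] by (rule infsum_cong_neutral) (auto simp: d0)
    also have "\<dots> = tail s * bailey_transform d 0 + tail (s - 1) * (q * bailey_transform d 1)"
      by simp
    also have "\<dots> = qpoch_inf q q * (qpoch_inf q q * (q powi s * tail s))"
      unfolding d1 d2 tail_minus_one by (simp add: power2_eq_square algebra_simps)
    finally show ?thesis
      using qpoch_inf_nome_nz by simp
  qed
  have "qpoch_inf q q * (\<Sum>\<^sub>\<infinity>m. q powi (m * m) * (q powi (m * m) * d m)) =
        (\<Sum>\<^sub>\<infinity>r. qpoch_inf q q * (q powi (r * r) * (q powi r * tail r)))"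
    unfolding bailey_lemma_limit[OF dq] t1 by (simp add: ac_simps)
  also have "\<dots> = qpoch_inf q q * (\<Sum>\<^sub>\<infinity>r. q powi (r * r) * (q powi r * tail r))"
    by (rule infsum_cmult_right')
  also have "\<dots> = qpoch_inf q q * (qpoch_inf q q * rr_H q)"
    unfolding tail_series_eq[OF nome_nz] rr_H_def by (simp add: power_add)
  finally have "qpoch_inf q q * rr_H q = (\<Sum>\<^sub>\<infinity>m. q powi (m * m) * (q powi (m * m) * d m))"
    using qpoch_inf_nome_nz by simp
  moreover have "q powi (m * m) * (q powi (m * m) * d m) = (q ^ 5) powi tri m * (- (q ^ 4)) powi m" for m
  proof -
    have "5 * tri m + 4 * m = m * m + (m * m + (tri m + 2 * m))"
      using two_tri[of m] by (simp add: algebra_simps)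
    from arg_cong[OF this, of "\<lambda>k. q powi k * (- 1) powi m"] show ?thesis
      using powi_scaled[of "- 1" q 4 m] powi_scaled[of "- 1" q 2 m] powi_add[of "m * m" "m * m"]
      by (simp add: d_def powi_power powi_add)
  qed
  ultimately show ?thesis by (simp add: theta_series_def)
qed

end

section \<open>The Schur recurrence\<close>

lemma schur_rec_eq_fundamental:
  assumes "q \<noteq> 0" "schur_rec q F"
  shows "F n = F 0 * schur_T q (n - 1) + F 1 * schur_S q n"
proof -
  define G where "G n = F 0 * schur_T q (n - 1) + F 1 * schur_S q n" for n
  note S = schur_S_spec[OF assms(1)] and T = schur_T_spec[OF assms(1)]
  have "schur_rec q G"
    unfolding schur_rec_def
  proof
    fix n
    have "schur_S q n = schur_S q (n - 1) + q powi (n - 2) * schur_S q (n - 2)"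
      using S(1) unfolding schur_rec_def by blast
    moreover have "schur_T q (n - 1) = schur_T q (n - 1 - 1) + q powi (n - 2) * schur_T q (n - 2 - 1)"
      using T(1) unfolding schur_rec_def by blast
    ultimately show "G n = G (n - 1) + q powi (n - 2) * G (n - 2)"
      unfolding G_def by (simp only:) (simp add: algebra_simps)
  qed
  moreover have "G 0 = F 0" "G 1 = F 1"
    using S T by (simp_all add: G_def)
  ultimately have "G = F"
    using schur_rec_ex1[OF assms(1), of "F 0" "F 1"] assms(2) by blast
  then show ?thesis by (metis G_def)
qed

lemma schur_casoratian:
  assumes "q \<noteq> 0" "schur_rec q F" "schur_rec q K"
  shows "F n * K m - F m * K n =
    (F 0 * K 1 - F 1 * K 0) * (schur_S q m * schur_T q (n - 1) - schur_S q n * schur_T q (m - 1))"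
  unfolding schur_rec_eq_fundamental[OF assms(1,2), of n] schur_rec_eq_fundamental[OF assms(1,2), of m]
    schur_rec_eq_fundamental[OF assms(1,3), of n] schur_rec_eq_fundamental[OF assms(1,3), of m]
  by (simp add: algebra_simps)

lemma schur_casoratian_consecutive:
  assumes q: "q \<noteq> 0" and F: "schur_rec q F" and K: "schur_rec q K"
  shows "F n * K (n + 1) - F (n + 1) * K n = (- 1) powi n * q powi tri n * (F 0 * K 1 - F 1 * K 0)"
proof -
  define W where "W n = F n * K (n + 1) - F (n + 1) * K n" for n
  have step: "W (i + 1) = - (q powi i) * W i" for i
  proof -
    have "i + 1 + 1 - 1 = i + 1" "i + 1 + 1 - 2 = i" by auto
    then have "F (i + 1 + 1) = F (i + 1) + q powi i * F i" "K (i + 1 + 1) = K (i + 1) + q powi i * K i"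
      using F K unfolding schur_rec_def by metis+
    then show ?thesis
      unfolding W_def by (simp only:) (simp add: algebra_simps)
  qed
  have "W n = (- 1) powi n * q powi tri n * W 0"
  proof (induction n rule: int_induct[where k = 0])
    case base
    show ?case by (simp add: tri_def)
  next
    case (step1 i)
    then show ?case
      unfolding step using q by (simp add: tri_add_one power_int_add)
  next
    case (step2 i)
    have "(- 1 :: complex) powi i = - ((- 1) powi (i - 1))"
      using power_int_add[of "- 1 :: complex" "i - 1" 1] by simp
    moreover have "q powi tri i = q powi (i - 1) * q powi tri (i - 1)"
      using tri_add_one[of "i - 1"] q by (simp add: power_int_add[symmetric] add.commute)
    moreover have "W i = - (q powi (i - 1)) * W (i - 1)"
      using step[of "i - 1"] by simp
    ultimately have "q powi (i - 1) * W (i - 1) = q powi (i - 1) * ((- 1) powi (i - 1) * q powi tri (i - 1) * W 0)"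
      using step2.IH q by (auto simp: mult_ac)
    then show ?case using q by simp
  qed
  then show ?thesis by (simp add: W_def)
qed

context nome
begin

text \<open>
  In the bilateral form the factor \<open>tail s\<close> absorbs the denominators, and the contiguity relation becomes a shift
  of the summation index.
\<close>

lemma phi01_tail_series:
  assumes "w \<noteq> 0"
  shows "qpoch_inf q q * phi01 q w = (\<Sum>\<^sub>\<infinity>s. q powi (s * s) * ((w / q) powi s * tail s))"
proof -
  have "q ^ (n * (n - 1)) * w ^ n = q ^ (n\<^sup>2) * (w / q) ^ n" for n
  proof -
    have "n\<^sup>2 = n * (n - 1) + n" by (cases n) (simp_all add: power2_eq_square)
    then show ?thesis using nome_nz by (simp add: power_add power_divide)
  qed
  then have "phi01 q w = (\<Sum>n. q ^ (n\<^sup>2) * (w / q) ^ n / qpoch q q (int n))"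
    unfolding phi01_def by (metis (no_types) times_divide_eq_left)
  then show ?thesis
    using tail_series_eq[of "w / q"] assms nome_nz by simp
qed

lemma phi01_contiguous:
  assumes "w \<noteq> 0"
  shows "phi01 q w = phi01 q (w * q) + w * phi01 q (w * q\<^sup>2)"
proof -
  define P where "P w = (\<Sum>\<^sub>\<infinity>s. q powi (s * s) * ((w / q) powi s * tail s))" for w
  have hs: "((\<lambda>s. q powi (s * s) * ((w / q) powi s * tail s)) has_sum P w) UNIV" if "w \<noteq> 0" for w
    unfolding P_def using that nome_nz by (intro has_sum_infsum tail_series_summable) auto
  have nz: "w * q \<noteq> 0" "w * q\<^sup>2 \<noteq> 0" using assms nome_nz by auto
  have "((\<lambda>s. q powi (s * s) * ((w * q / q) powi s * tail s) +
          w * (q powi ((s + - 1) * (s + - 1)) * ((w * q\<^sup>2 / q) powi (s + - 1) * tail (s + - 1))))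
        has_sum (P (w * q) + w * P (w * q\<^sup>2))) UNIV"
    by (intro has_sum_add has_sum_cmult_right hs nz
          hs[OF nz(2), THEN has_sum_int_shift[where k = "- 1", THEN iffD2]])
  moreover have "q powi (s * s) * ((w * q / q) powi s * tail s) +
          w * (q powi ((s + - 1) * (s + - 1)) * ((w * q\<^sup>2 / q) powi (s + - 1) * tail (s + - 1)))
      = q powi (s * s) * ((w / q) powi s * tail s)" for s
  proof -
    have w1: "w * q / q = w" "w * q\<^sup>2 / q = w * q"
      using nome_nz by (simp_all add: power2_eq_square)
    have "(s - 1) * (s - 1) + (s - 1) = s * s - s"
      by (simp add: algebra_simps)
    from arg_cong[OF this, of "\<lambda>k. q powi k"]
    have Q: "q powi ((s - 1) * (s - 1)) * q powi (s - 1) = q powi (s * s) / q powi s"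
      using nome_nz by (simp add: powi_add power_int_diff)
    have "w * (q powi ((s - 1) * (s - 1)) * ((w * q) powi (s - 1) * tail (s - 1)))
        = q powi (s * s) / q powi s * (w * w powi (s - 1)) * ((1 - q powi s) * tail s)"
      by (simp only: power_int_mult_distrib tail_minus_one Q[symmetric] mult_ac)
    also have "w * w powi (s - 1) = w powi s"
      using power_int_add[of w 1 "s - 1"] assms by simp
    finally show ?thesis
      unfolding w1 using powi_nz[of s] by (simp add: power_int_divide_distrib field_simps)
  qed
  ultimately have "P w = P (w * q) + w * P (w * q\<^sup>2)"
    using has_sum_unique[OF hs[OF assms]] by (simp only:)
  then have "qpoch_inf q q * phi01 q w = qpoch_inf q q * (phi01 q (w * q) + w * phi01 q (w * q\<^sup>2))"
    using phi01_tail_series[OF assms] phi01_tail_series[OF nz(1)] phi01_tail_series[OF nz(2)]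
    unfolding P_def by (simp add: algebra_simps)
  then show ?thesis using qpoch_inf_nome_nz by simp
qed

lemma phi01_powi_contiguous:
  "phi01 q (q powi n) = phi01 q (q powi (n + 1)) + q powi n * phi01 q (q powi (n + 2))"
proof -
  have "q powi n * q = q powi (n + 1)" "q powi n * q\<^sup>2 = q powi (n + 2)"
    by (simp_all add: powi_add)
  then show ?thesis using phi01_contiguous[OF powi_nz, of n] by simp
qed

lemma phi01_tendsto_1: "(\<lambda>N. phi01 q (q powi (int N + 1))) \<longlonglongrightarrow> 1"
proof -
  have eq: "qpoch_inf q q * phi01 q (q powi (int N + 1)) = (\<Sum>\<^sub>\<infinity>s. q powi (s * s) * (q powi (int N * s) * tail s))" for N
    using phi01_tail_series[OF powi_nz, of "int N + 1"] nome_nz by (simp add: powi_add power_int_mult)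
  \<comment> \<open>Only \<open>s = 0\<close> survives: terms with negative \<open>s\<close> vanish identically, the others carry \<open>q ^ (N s)\<close>.\<close>
  have "(\<lambda>N. \<Sum>\<^sub>\<infinity>s. q powi (s * s) * (q powi (int N * s) * tail s))
      \<longlonglongrightarrow> (\<Sum>\<^sub>\<infinity>s :: int. if s = 0 then qpoch_inf q q else 0)"
  proof (rule tannery_infsum)
    show "norm (q powi (s * s) * (q powi (int N * s) * tail s)) \<le> norm (q powi (s * s)) * majorant 1" for N s
    proof (cases "s < 0")
      case True
      then show ?thesis by (simp add: tail_neg majorant_nonneg)
    next
      case False
      have "norm (q powi (int N * s)) * norm (tail s) \<le> 1 * majorant 1"
        using False by (intro mult_mono norm_tail_le norm_powi_nonneg_le_1) auto
      then show ?thesis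
        unfolding norm_mult by (intro mult_left_mono) auto
    qed
    show "(\<lambda>s. norm (q powi (s * s)) * majorant 1) summable_on UNIV"
      using square_terms_summable[of 1]
      by (intro summable_on_cmult_left) (simp flip: summable_on_iff_abs_summable_on_complex)
    show "(\<lambda>N. q powi (s * s) * (q powi (int N * s) * tail s)) \<longlonglongrightarrow> (if s = 0 then qpoch_inf q q else 0)" for s
    proof (cases s "0 :: int" rule: linorder_cases)
      case less
      then show ?thesis by (simp add: tail_neg)
    next
      case equal
      then show ?thesis by (simp add: tail_0)
    next
      case greater
      then obtain k where k: "s = int (Suc k)"
        by (metis gr0_implies_Suc zero_less_imp_eq_int)
      have "q powi (int N * s) = (q ^ N) ^ Suc k" for N
        unfolding k by (simp only: power_int_mult power_int_of_nat)
      then have "(\<lambda>N. q powi (s * s) * (q powi (int N * s) * tail s)) \<longlonglongrightarrow> q powi (s * s) * (0 ^ Suc k * tail s)"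
        by (simp only:) (intro tendsto_intros power_tendsto_0)
      then show ?thesis using greater by simp
    qed
  qed
  also have "(\<Sum>\<^sub>\<infinity>s :: int. if s = 0 then qpoch_inf q q else 0) = (\<Sum>\<^sub>\<infinity>s\<in>{0 :: int}. qpoch_inf q q)"
    by (rule infsum_cong_neutral) auto
  finally have "(\<lambda>N. qpoch_inf q q * phi01 q (q powi (int N + 1)) / qpoch_inf q q) \<longlonglongrightarrow> qpoch_inf q q / qpoch_inf q q"
    unfolding eq[symmetric] by (intro tendsto_divide tendsto_const) (use qpoch_inf_nome_nz in auto)
  then show ?thesis
    using qpoch_inf_nome_nz by simp
qed

lemma phi01_schur_rec: "schur_rec q (\<lambda>n. (- 1) powi n * q powi tri n * phi01 q (q powi (n + 1)))"
  unfolding schur_rec_def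
proof
  fix n :: int
  have sgn: "(- 1) powi (n - 1) = - ((- 1) powi n :: complex)" "(- 1) powi (n - 2) = ((- 1) powi n :: complex)"
    by (simp_all add: power_int_diff)
  have "tri n = tri (n - 2) + (n - 2) + (n - 1)" "tri (n - 1) = tri (n - 2) + (n - 2)"
    using tri_add_one[of "n - 1"] tri_add_one[of "n - 2"] by simp_all
  then have t: "q powi tri n = q powi tri (n - 2) * q powi (n - 2) * q powi (n - 1)"
    "q powi tri (n - 1) = q powi tri (n - 2) * q powi (n - 2)"
    by (simp_all only: powi_add)
  have "n - 1 + 1 = n" "n - 2 + 1 = n - 1" by auto
  moreover have "phi01 q (q powi (n - 1)) = phi01 q (q powi n) + q powi (n - 1) * phi01 q (q powi (n + 1))"
    using phi01_powi_contiguous[of "n - 1"] by (simp add: algebra_simps)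
  ultimately show "(- 1) powi n * q powi tri n * phi01 q (q powi (n + 1)) =
         (- 1) powi (n - 1) * q powi tri (n - 1) * phi01 q (q powi (n - 1 + 1)) +
         q powi (n - 2) * ((- 1) powi (n - 2) * q powi tri (n - 2) * phi01 q (q powi (n - 2 + 1)))"
    unfolding sgn t by (simp only:) (simp add: algebra_simps)
qed

text \<open>
  The left-hand side is the Casoratian of \<open>F\<close> with the solution of \<open>phi01_schur_rec\<close>, divided by the factor
  \<open>(- 1)^n q^(n(n-1)/2)\<close> with which Casoratians vary; hence it does not depend on \<open>n\<close>. As \<open>n \<rightarrow> \<infinity>\<close>
  its second term vanishes and its first term tends to \<open>L\<close>.
\<close>

lemma phi01_pairing_eq_limit:
  assumes F: "schur_rec q F" and lim: "(\<lambda>N. F (int N)) \<longlonglongrightarrow> L"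
  shows "phi01 q (q powi (n + 1)) * F (n + 1) + q powi n * phi01 q (q powi (n + 2)) * F n = L"
proof -
  define c where "c n = phi01 q (q powi (n + 1)) * F (n + 1) + q powi n * phi01 q (q powi (n + 2)) * F n" for n
  have c_step: "c (i + 1) = c i" for i
  proof -
    have "F (i + 2) = F (i + 1) + q powi i * F i"
      using F unfolding schur_rec_def by (metis add_diff_cancel_right' diff_add_eq_diff_diff_swap diff_diff_eq2 one_add_one)
    moreover have "i + 1 + 1 = i + 2" "i + 1 + 2 = i + 3" by auto
    moreover have "phi01 q (q powi (i + 1)) = phi01 q (q powi (i + 2)) + q powi (i + 1) * phi01 q (q powi (i + 3))"
      using phi01_powi_contiguous[of "i + 1"] by (simp add: algebra_simps)
    ultimately show ?thesis
      unfolding c_def by (simp only:) (simp add: algebra_simps)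
  qed
  have c_const: "c n = c 0" for n
  proof (induction n rule: int_induct[where k = 0])
    case (step2 i)
    then show ?case using c_step[of "i - 1"] by simp
  qed (use c_step in auto)
  have "(\<lambda>N. phi01 q (q powi (int N + 1)) * F (int (Suc N)) + q ^ N * phi01 q (q powi (int (Suc N) + 1)) * F (int N))
      \<longlonglongrightarrow> 1 * L + 0 * 1 * L"
    by (intro tendsto_intros phi01_tendsto_1 lim power_tendsto_0 LIMSEQ_Suc[OF lim] LIMSEQ_Suc[OF phi01_tendsto_1])
  moreover have "phi01 q (q powi (int N + 1)) * F (int (Suc N)) + q ^ N * phi01 q (q powi (int (Suc N) + 1)) * F (int N) = c (int N)" for N
    unfolding c_def by (simp add: add.commute)
  ultimately have "(\<lambda>N::nat. c 0) \<longlonglongrightarrow> L" by (simp add: c_const[of "int _"])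
  then have "c 0 = L" by (simp add: LIMSEQ_const_iff)
  then show ?thesis using c_const[of n] by (simp add: c_def)
qed

lemma rr_G_eq_phi01: "rr_G q = phi01 q q"
proof -
  have "n\<^sup>2 = n * (n - 1) + n" for n :: nat by (cases n) (simp_all add: power2_eq_square)
  then show ?thesis
    unfolding rr_G_def phi01_def by (simp add: power_add)
qed

lemma rr_H_eq_phi01: "rr_H q = phi01 q (q\<^sup>2)"
proof -
  have "n\<^sup>2 + n = n * (n - 1) + 2 * n" for n :: nat by (cases n) (simp_all add: power2_eq_square)
  then have "q ^ (n\<^sup>2 + n) = q ^ (n * (n - 1)) * (q\<^sup>2) ^ n" for n
    by (metis power_add power_mult)
  then show ?thesis
    unfolding rr_H_def phi01_def by simp
qed

end

section \<open>The bilateral series at both ends of the recurrence\<close>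

context nome
begin

definition recip :: "complex \<Rightarrow> int \<Rightarrow> complex" where
  "recip x m = 1 / qpoch_inf (x * q powi m) q"

text \<open>
  The coefficient \<open>q^(j(j-1)/2) (- q x)^j\<close> is \<open>(- 1)^j q^(j(j+1)/2) x^j\<close> in the form of a theta term.
  The index \<open>n\<close> occurs only in the reciprocal product, in contrast to the defining series of \<open>M\<close>; this is what
  makes both limits accessible.
\<close>

definition appell :: "complex \<Rightarrow> int \<Rightarrow> complex" where
  "appell x n = (\<Sum>\<^sub>\<infinity>j. q powi tri j * (- q * x) powi j * recip x (j + n))"

text \<open>
  Expand both theta functions by the triple product and split the lattice of exponents \<open>(m, n)\<close> by the parity of
  \<open>m + n\<close>. On the even part \<open>m = i + j\<close>, \<open>n = j - i\<close>, on the odd part \<open>m = i + j\<close>,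
  \<open>n = j - i + 1\<close>; in these coordinates the quadratic form is diagonal and the double series factors.
\<close>

lemma theta_product_parity_split:
  assumes "x \<noteq> 0" "y \<noteq> 0"
  shows "theta q (x * y) * theta q (y / x) * (qpoch_inf q q)\<^sup>2 =
    (\<Sum>\<^sub>\<infinity>i. q powi (i * i) * (x\<^sup>2) powi i) * (\<Sum>\<^sub>\<infinity>j. q powi (j * j) * (y\<^sup>2 / q) powi j) -
    y / x * ((\<Sum>\<^sub>\<infinity>i. q powi (i * i) * (x\<^sup>2 / q) powi i) * (\<Sum>\<^sub>\<infinity>j. q powi (j * j) * (y\<^sup>2) powi j))"
proof -
  define a where "a = - (x * y)"
  define b where "b = - (y / x)"
  have ab: "a \<noteq> 0" "b \<noteq> 0" "a * b = y\<^sup>2" "a / b = x\<^sup>2"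
    using assms by (auto simp: a_def b_def power2_eq_square)
  define F where "F = (\<lambda>(m, n). q powi tri m * a powi m * (q powi tri n * b powi n))"
  define f where "f z i = q powi (i * i) * z powi i" for z i
  have f_sum: "(f z has_sum (\<Sum>\<^sub>\<infinity>i. f z i)) UNIV" if "z \<noteq> 0" for z
    unfolding f_def by (rule has_sum_infsum[OF square_terms_summable[OF that]])
  have prod: "(\<Sum>\<^sub>\<infinity>(i, j). f z i * f w j) = (\<Sum>\<^sub>\<infinity>i. f z i) * (\<Sum>\<^sub>\<infinity>j. f w j)"
    if "z \<noteq> 0" "w \<noteq> 0" for z w
    using infsumI[OF has_sum_times[OF f_sum[OF that(1)] f_sum[OF that(2)]]] by simp
  have F: "(F has_sum theta_series q a * theta_series q b) UNIV"
    unfolding F_def theta_series_def UNIV_Times_UNIV[symmetric]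
    by (intro has_sum_times has_sum_infsum theta_terms_summable ab)
  have "(\<Sum>\<^sub>\<infinity>p. F p) = (\<Sum>\<^sub>\<infinity>p. F (case p of (i, j) \<Rightarrow> (i + j, j - i)))
      + (\<Sum>\<^sub>\<infinity>p. F (case p of (i, j) \<Rightarrow> (i + j, j - i + 1)))"
  proof (rule infsum_split_bij[where S = "{(m, n). even (m + n)}"])
    show "F summable_on UNIV" using F by (rule has_sum_imp_summable)
    show "bij_betw (\<lambda>p :: int \<times> int. case p of (i, j) \<Rightarrow> (i + j, j - i)) UNIV {(m, n). even (m + n)}"
      by (rule bij_betwI[of _ _ _ "\<lambda>(m, n). ((m - n) div 2, (m + n) div 2)"])
         (auto, presburger+)
    show "bij_betw (\<lambda>p :: int \<times> int. case p of (i, j) \<Rightarrow> (i + j, j - i + 1)) UNIV (- {(m, n). even (m + n)})"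
      by (rule bij_betwI[of _ _ _ "\<lambda>(m, n). ((m - n + 1) div 2, (m + n - 1) div 2)"])
         (auto, presburger+)
  qed
  moreover have "F (i + j, j - i) = f (x\<^sup>2) i * f (y\<^sup>2 / q) j" for i j
  proof -
    have "tri (i + j) + tri (j - i) = i * i + (j * j - j)"
      using two_tri[of "i + j"] two_tri[of "j - i"] by (simp add: algebra_simps)
    then have "q powi tri (i + j) * q powi tri (j - i) = q powi (i * i) * (q powi (j * j) / q powi j)"
      unfolding powi_add[symmetric] using nome_nz by (simp add: powi_add power_int_diff)
    then show ?thesis
      using powi_pair[OF ab(1,2), of i j] ab(3,4)
      by (simp add: F_def f_def power_int_divide_distrib field_simps)
  qed
  moreover have "F (i + j, j - i + 1) = - (y / x) * (f (x\<^sup>2 / q) i * f (y\<^sup>2) j)" for i j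
  proof -
    have "tri (i + j) + tri (j - i + 1) = (i * i - i) + j * j"
      using two_tri[of "i + j"] two_tri[of "j - i + 1"] by (simp add: algebra_simps)
    then have *: "q powi tri (i + j) * q powi tri (j - i + 1) = q powi (i * i) / q powi i * q powi (j * j)"
      unfolding powi_add[symmetric] using nome_nz by (simp add: powi_add power_int_diff)
    have "b powi (j - i + 1) = b * b powi (j - i)"
      using ab power_int_add[of b "j - i" 1] by simp
    then have **: "a powi (i + j) * b powi (j - i + 1) = - (y / x) * ((x\<^sup>2) powi i * (y\<^sup>2) powi j)"
      using powi_pair[OF ab(1,2), of i j] ab(3,4) unfolding b_def by (simp add: mult_ac)
    have "F (i + j, j - i + 1) = (q powi tri (i + j) * q powi tri (j - i + 1)) *
        (a powi (i + j) * b powi (j - i + 1))"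
      unfolding F_def by (simp only: prod.case mult_ac)
    also have "\<dots> = (q powi (i * i) / q powi i * q powi (j * j)) *
        (- (y / x) * ((x\<^sup>2) powi i * (y\<^sup>2) powi j))"
      unfolding * ** ..
    finally show ?thesis
      by (simp add: f_def power_int_divide_distrib mult_ac)
  qed
  ultimately have "theta_series q a * theta_series q b =
      (\<Sum>\<^sub>\<infinity>(i, j). f (x\<^sup>2) i * f (y\<^sup>2 / q) j) + (\<Sum>\<^sub>\<infinity>(i, j). - (y / x) * (f (x\<^sup>2 / q) i * f (y\<^sup>2) j))"
    unfolding infsumI[OF F] by (simp add: case_prod_unfold)
  also have "(\<Sum>\<^sub>\<infinity>(i, j). - (y / x) * (f (x\<^sup>2 / q) i * f (y\<^sup>2) j)) =
      - (y / x) * (\<Sum>\<^sub>\<infinity>(i, j). f (x\<^sup>2 / q) i * f (y\<^sup>2) j)"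
    unfolding infsum_cmult_right'[symmetric] by (simp only: case_prod_unfold)
  finally have "theta_series q a * theta_series q b = (\<Sum>\<^sub>\<infinity>i. f (x\<^sup>2) i) * (\<Sum>\<^sub>\<infinity>j. f (y\<^sup>2 / q) j)
      - y / x * ((\<Sum>\<^sub>\<infinity>i. f (x\<^sup>2 / q) i) * (\<Sum>\<^sub>\<infinity>j. f (y\<^sup>2) j))"
    using assms nome_nz by (simp add: prod)
  moreover have "theta_series q a * theta_series q b =
      theta q (x * y) * theta q (y / x) * (qpoch_inf q q)\<^sup>2"
    using assms
    by (simp add: a_def b_def power2_eq_square jacobi_triple_product[symmetric] mult_ac)
  ultimately show ?thesis by (simp add: f_def)
qed

end

locale nome_arg = nome +
  fixes x :: complex
  assumes arg_nz: "x \<noteq> 0" and arg_notin: "x \<notin> range (\<lambda>k. q powi k)"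
begin

lemma theta_nz: "theta q x \<noteq> 0"
  using theta_eq_0_iff[OF arg_nz] arg_notin by blast

lemma qpoch_inf_arg_nz: "qpoch_inf (x * q powi m) q \<noteq> 0"
proof -
  have "x * q powi m * q ^ k \<noteq> 1" for k
  proof
    assume "x * q powi m * q ^ k = 1"
    then have "x * q powi (m + int k) = 1"
      by (simp add: powi_add mult.assoc)
    then have "inverse (q powi (m + int k)) = x"
      by (intro inverse_unique) (simp add: mult.commute)
    then have "x = q powi (- (m + int k))"
      by (simp only: power_int_minus)
    then show False using arg_notin by blast
  qed
  then show ?thesis unfolding qpoch_inf_eq_0_iff by blast
qed

lemma recip_add_one: "recip x (m + 1) = (1 - x * q powi m) * recip x m"
proof -
  note step = qpoch_inf_step_powi[of x m]
  have "1 - x * q powi m \<noteq> 0"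
    using qpoch_inf_arg_nz[of m] step by auto
  then show ?thesis
    unfolding recip_def step by simp
qed

lemma recip_tendsto_1: "(\<lambda>N. recip x (j + int N)) \<longlonglongrightarrow> 1"
proof -
  have "(\<lambda>N. x * q powi (int N + j)) \<longlonglongrightarrow> x * 0"
    by (intro tendsto_intros powi_tendsto_0)
  then have "(\<lambda>N. qpoch_inf (x * q powi (int N + j)) q) \<longlonglongrightarrow> 1"
    by (intro qpoch_inf_tendsto_1) simp
  then have "(\<lambda>N. 1 / qpoch_inf (x * q powi (int N + j)) q) \<longlonglongrightarrow> 1 / 1"
    by (intro tendsto_intros) auto
  then show ?thesis
    by (simp add: recip_def add.commute)
qed

text \<open>
  To the right the values tend to \<open>1\<close>; to the left they decay superexponentially, because each step divides by a
  factor \<open>1 - x q^m\<close> of growing modulus.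
\<close>

lemma recip_bounded:
  obtains C where "\<And>m. norm (recip x m) \<le> C"
proof -
  have "Bseq (\<lambda>N. recip x (0 + int N))"
    using recip_tendsto_1 by (intro convergent_imp_Bseq convergentI)
  then obtain A where A: "\<And>n. norm (recip x (int n)) \<le> A"
    unfolding Bseq_def by auto
  have "(\<lambda>n. norm (recip x (- int n))) summable_on UNIV"
  proof (rule summable_on_nat_ratio)
    show "norm (recip x (- int (Suc n))) \<le> norm (q ^ Suc n / (q ^ Suc n - x)) * norm (recip x (- int n))" for n
    proof -
      have nz: "q ^ Suc n - x \<noteq> 0"
      proof
        assume "q ^ Suc n - x = 0"
        then have "x = q powi int (Suc n)"
          by (metis power_int_of_nat right_minus_eq)
        then show False using arg_notin by blast
      qed
      have "recip x (- int n) = (1 - x / q ^ Suc n) * recip x (- int (Suc n))"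
      proof -
        have "q powi (- int (Suc n)) = 1 / q ^ Suc n" "- int (Suc n) + 1 = - int n"
          by (simp_all add: power_int_minus divide_inverse del: of_nat_Suc flip: power_int_of_nat)
        then show ?thesis
          using recip_add_one[of "- int (Suc n)"] by (simp only: times_divide_eq_right mult_1_right)
      qed
      also have "1 - x / q ^ Suc n = (q ^ Suc n - x) / q ^ Suc n"
        using nome_nz by (simp add: field_simps)
      finally have "recip x (- int (Suc n)) = q ^ Suc n / (q ^ Suc n - x) * recip x (- int n)"
        using nz nome_nz by (simp add: field_simps)
      then show ?thesis by (simp only: norm_mult order.refl)
    qed
    have "(\<lambda>n. norm (q ^ Suc n / (q ^ Suc n - x))) \<longlonglongrightarrow> norm (0 / (0 - x))"
      by (intro tendsto_intros LIMSEQ_Suc[OF power_tendsto_0]) (use arg_nz in auto)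
    then show "(\<lambda>n. norm (q ^ Suc n / (q ^ Suc n - x))) \<longlonglongrightarrow> 0" by simp
  qed auto
  then have "Bseq (\<lambda>n. norm (recip x (- int n)))"
    by (intro summable_imp_Bseq summable_on_imp_summable)
  then obtain B where B: "\<And>n. norm (recip x (- int n)) \<le> B"
    unfolding Bseq_def by auto
  have "norm (recip x m) \<le> max A B" for m
    by (cases m rule: int_cases2) (use A B in \<open>auto intro: max.coboundedI1 max.coboundedI2\<close>)
  then show ?thesis by (rule that)
qed

lemma appell_has_sum:
  "((\<lambda>j. q powi tri j * (- q * x) powi j * recip x (j + n)) has_sum appell x n) UNIV"
  unfolding appell_def
proof (rule has_sum_infsum)
  obtain C where "\<And>m. norm (recip x m) \<le> C" using recip_bounded by blast
  then show "(\<lambda>j. q powi tri j * (- q * x) powi j * recip x (j + n)) summable_on UNIV"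
    using nome_nz arg_nz by (intro summable_on_mult_bounded theta_terms_summable) auto
qed

text \<open>
  The difference of two neighbouring reciprocals is \<open>- x q^(j+n-1)\<close> times one of them, and multiplication by
  \<open>- x q^(j+1)\<close> is exactly what shifts the theta coefficient from \<open>j\<close> to \<open>j + 1\<close>.
\<close>

lemma appell_rec: "schur_rec q (appell x)"
  unfolding schur_rec_def
proof
  fix n
  define a where "a j = q powi tri j * (- q * x) powi j" for j
  have qx: "- q * x \<noteq> 0" using nome_nz arg_nz by simp
  have "((\<lambda>j. a j * recip x (j + (n - 1)) + q powi (n - 2) * (a (j + 1) * recip x (j + 1 + (n - 2))))
     has_sum (appell x (n - 1) + q powi (n - 2) * appell x (n - 2))) UNIV"
    unfolding a_def
    by (intro has_sum_add has_sum_cmult_right appell_has_sum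
          appell_has_sum[of "n - 2", THEN has_sum_int_shift[where k = 1, THEN iffD2]])
  moreover have "a j * recip x (j + (n - 1)) + q powi (n - 2) * (a (j + 1) * recip x (j + 1 + (n - 2)))
      = a j * recip x (j + n)" for j
  proof -
    have 1: "recip x (j + n) = (1 - x * q powi (j + (n - 1))) * recip x (j + (n - 1))"
      using recip_add_one[of "j + (n - 1)"] by (simp add: algebra_simps)
    have 2: "j + 1 + (n - 2) = j + (n - 1)" by simp
    have 3: "a (j + 1) = q powi j * (- q * x) * a j"
      unfolding a_def by (rule theta_term_add_one[OF qx])
    have 4: "q powi (j + (n - 1)) = q powi (n - 2) * q powi j * q"
      using powi_add[of "n - 2" "j + 1"] powi_add[of j 1] by (simp add: algebra_simps)
    show ?thesis unfolding 1 2 3 4 by algebra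
  qed
  ultimately have "((\<lambda>j. a j * recip x (j + n))
     has_sum (appell x (n - 1) + q powi (n - 2) * appell x (n - 2))) UNIV"
    by (simp only:)
  then show "appell x n = appell x (n - 1) + q powi (n - 2) * appell x (n - 2)"
    unfolding a_def using appell_has_sum[of n] has_sum_unique by blast
qed

lemma appell_tendsto: "(\<lambda>N. appell x (int N)) \<longlonglongrightarrow> qpoch_inf q q * theta q (1 / x)"
proof -
  obtain C where C: "\<And>m. norm (recip x m) \<le> C" using recip_bounded by blast
  have qx: "- q * x \<noteq> 0" using nome_nz arg_nz by simp
  have "(\<lambda>N. appell x (int N)) \<longlonglongrightarrow> (\<Sum>\<^sub>\<infinity>j. q powi tri j * (- q * x) powi j)"
    unfolding appell_def
  proof (rule tannery_infsum)
    show "norm (q powi tri j * (- q * x) powi j * recip x (j + int N))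
            \<le> norm (q powi tri j * (- q * x) powi j) * C" for N j
      unfolding norm_mult[of "_ * _" "recip _ _"] by (intro mult_left_mono C) auto
    show "(\<lambda>j. norm (q powi tri j * (- q * x) powi j) * C) summable_on UNIV"
      using theta_terms_summable[OF qx]
      by (intro summable_on_cmult_left) (simp flip: summable_on_iff_abs_summable_on_complex)
    have "(\<lambda>N. q powi tri j * (- q * x) powi j * recip x (j + int N))
            \<longlonglongrightarrow> q powi tri j * (- q * x) powi j * 1" for j
      by (intro tendsto_intros recip_tendsto_1)
    then show "(\<lambda>N. q powi tri j * (- q * x) powi j * recip x (j + int N))
            \<longlonglongrightarrow> q powi tri j * (- q * x) powi j" for j
      by simp
  qed
  also have "(\<Sum>\<^sub>\<infinity>j. q powi tri j * (- q * x) powi j) = theta_series q (- (q * x))"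
    by (simp add: theta_series_def)
  also have "\<dots> = theta q (q * x) * qpoch_inf q q"
    using nome_nz arg_nz by (intro jacobi_triple_product[symmetric]) auto
  also have "theta q (q * x) = theta q (1 / x)"
    using theta_step[OF arg_nz] theta_inverse[OF arg_nz] by (simp add: mult.commute)
  finally show ?thesis by (simp add: mult.commute)
qed

text \<open>
  Towards \<open>m \<rightarrow> - \<infinity>\<close> this displays the decay of the reciprocal: the theta function is quasi-periodic, and
  the remaining product tends to \<open>1\<close>.
\<close>

lemma recip_eq_theta:
  "recip x m = (- x) powi m * q powi tri m * qpoch_inf (q powi (1 - m) / x) q / theta q x"
proof -
  have xq: "x * q powi m \<noteq> 0" using arg_nz powi_nz by simp
  have "q / (x * q powi m) = q powi (1 - m) / x"
    using nome_nz by (simp add: power_int_diff)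
  then have "theta q (x * q powi m) = qpoch_inf (x * q powi m) q * qpoch_inf (q powi (1 - m) / x) q"
    by (simp add: theta_def)
  moreover have "theta q (x * q powi m) * ((- x) powi m * q powi tri m) = theta q x"
    by (rule theta_quasi_period[OF arg_nz])
  ultimately have "qpoch_inf (x * q powi m) q *
      ((- x) powi m * q powi tri m * qpoch_inf (q powi (1 - m) / x) q) = theta q x"
    by (simp add: mult_ac)
  then show ?thesis
    using qpoch_inf_arg_nz[of m] theta_nz by (simp add: recip_def field_simps)
qed

lemma damped_square_terms_summable:
  assumes z: "z \<noteq> 0"
  shows "(\<lambda>i. norm (q powi (i * i) * z powi i) * majorant (norm (q powi (c - i) / x))) summable_on UNIV"
proof (rule summable_on_int_ratio)
  have step: "q powi ((i + 1) * (i + 1)) * z powi (i + 1) = q powi (2 * i + 1) * z * (q powi (i * i) * z powi i)" for i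
  proof -
    have "(i + 1) * (i + 1) = (2 * i + 1) + i * i" by (simp add: algebra_simps)
    then show ?thesis using z by (simp only: powi_add) (simp add: power_int_add)
  qed
  show "norm (q powi ((int n + 1) * (int n + 1)) * z powi (int n + 1)) *
          majorant (norm (q powi (c - (int n + 1)) / x))
     \<le> (norm z * norm q ^ (2 * n + 1) + norm (z * q powi (int n + c) / x)) *
        (norm (q powi (int n * int n) * z powi int n) * majorant (norm (q powi (c - int n) / x)))" for n
  proof -
    have 1: "norm (q powi (c - (int n + 1)) / x) * norm q = norm (q powi (c - int n) / x)"
      unfolding norm_mult[symmetric] using powi_add[of "c - (int n + 1)" 1] by simp
    have 2: "q powi (2 * int n + 1) = q ^ (2 * n + 1)"
      by (metis int_ops(2) int_plus of_nat_mult of_nat_numeral power_int_of_nat)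
    have 3: "q powi (2 * int n + 1) * q powi (c - (int n + 1)) = q powi (int n + c)"
      unfolding powi_add[symmetric] by (simp add: algebra_simps)
    have ratio: "norm (q powi (2 * int n + 1) * z) * (1 + norm (q powi (c - (int n + 1)) / x))
        = norm z * norm q ^ (2 * n + 1) + norm (z * q powi (int n + c) / x)"
      unfolding 3[symmetric] distrib_left norm_mult[symmetric] mult_1_right
      by (simp add: 2 norm_mult norm_power norm_divide)
    show ?thesis
      unfolding step majorant_step[of "norm (q powi (c - (int n + 1)) / x)"] 1 ratio[symmetric]
        norm_mult[of "q powi (2 * int n + 1) * z"]
      by (simp only: mult_ac order.refl)
  qed
  have "(\<lambda>n. norm q ^ (2 * n + 1)) \<longlonglongrightarrow> 0"
  proof (rule filterlim_compose[OF norm_power_tendsto_0])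
    show "filterlim (\<lambda>n::nat. 2 * n + 1) at_top sequentially"
      by (rule filterlim_subseq) (auto simp: strict_mono_def)
  qed
  then have "(\<lambda>n. norm z * norm q ^ (2 * n + 1) + norm (z * q powi (int n + c) / x)) \<longlonglongrightarrow> norm z * 0 + norm (z * 0 / x)"
    by (intro tendsto_intros powi_tendsto_0) (use arg_nz in auto)
  then show "(\<lambda>n. norm z * norm q ^ (2 * n + 1) + norm (z * q powi (int n + c) / x)) \<longlonglongrightarrow> 0"
    by simp
  show "norm (q powi ((- int n - 1) * (- int n - 1)) * z powi (- int n - 1)) *
          majorant (norm (q powi (c - (- int n - 1)) / x))
     \<le> norm q ^ (2 * n + 1) / norm z *
        (norm (q powi (- int n * - int n) * z powi (- int n)) * majorant (norm (q powi (c - - int n) / x)))" for n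
  proof -
    have "q powi (- int n * - int n) * z powi (- int n) = q powi (2 * (- int n - 1) + 1) * z *
        (q powi ((- int n - 1) * (- int n - 1)) * z powi (- int n - 1))"
      using step[of "- int n - 1"] by simp
    moreover have "q powi (2 * (- int n - 1) + 1) = 1 / q ^ (2 * n + 1)"
    proof -
      have "2 * (- int n - 1) + 1 = - int (2 * n + 1)" by simp
      then show ?thesis by (simp only: power_int_minus power_int_of_nat divide_inverse mult_1)
    qed
    ultimately have 1: "q powi ((- int n - 1) * (- int n - 1)) * z powi (- int n - 1) =
       q ^ (2 * n + 1) / z * (q powi (- int n * - int n) * z powi (- int n))"
      using z nome_nz by (simp add: field_simps)
    have norm_ratio: "norm (q ^ (2 * n + 1) / z) = norm q ^ (2 * n + 1) / norm z"
      by (simp only: norm_divide norm_power)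
    have "norm (q powi (c - (- int n - 1)) / x) = norm (q powi (c - - int n) / x) * norm q"
      using powi_add[of "c + int n" 1] by (simp add: norm_mult norm_divide algebra_simps)
    also have "\<dots> \<le> norm (q powi (c - - int n) / x)"
      using nome_lt1 by (intro mult_left_le) auto
    finally have "majorant (norm (q powi (c - (- int n - 1)) / x)) \<le> majorant (norm (q powi (c - - int n) / x))"
      by (intro majorant_mono) auto
    then show ?thesis
      unfolding 1 norm_mult[of "q ^ (2 * n + 1) / z"] norm_ratio mult.assoc
      by (intro mult_left_mono) auto
  qed
  have "(\<lambda>n. norm q ^ (2 * n + 1)) \<longlonglongrightarrow> 0"
    by fact
  then have "(\<lambda>n. norm q ^ (2 * n + 1) / norm z) \<longlonglongrightarrow> 0 / norm z"
    by (intro tendsto_intros) (use z in auto)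
  then show "(\<lambda>n. norm q ^ (2 * n + 1) / norm z) \<longlonglongrightarrow> 0" by simp
  show "0 \<le> norm (q powi (i * i) * z powi i) * majorant (norm (q powi (c - i) / x))" for i
    by (intro mult_nonneg_nonneg majorant_nonneg) auto
qed

text \<open>
  The products grow as \<open>i \<rightarrow> \<infinity>\<close>, but uniformly in \<open>K\<close> they are bounded by the \<open>majorant\<close> at \<open>K = 0\<close>,
  and the Gaussian factor \<open>q powi (i * i)\<close> dominates that.
\<close>

lemma damped_square_sum_tendsto:
  assumes z: "z \<noteq> 0"
  shows "(\<lambda>K. \<Sum>\<^sub>\<infinity>i. q powi (i * i) * z powi i * qpoch_inf (q powi (int K + (c - i)) / x) q)
           \<longlonglongrightarrow> (\<Sum>\<^sub>\<infinity>i. q powi (i * i) * z powi i)"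
proof (rule tannery_infsum)
  show "norm (q powi (i * i) * z powi i * qpoch_inf (q powi (int K + (c - i)) / x) q)
      \<le> norm (q powi (i * i) * z powi i) * majorant (norm (q powi (c - i) / x))" for K i
  proof -
    have "norm (q powi (int K + (c - i)) / x) \<le> norm (q powi (c - i) / x)"
      using mult_right_mono[OF norm_powi_nonneg_le_1[of "int K"], of "norm (q powi (c - i) / x)"]
      by (simp add: powi_add norm_mult norm_divide)
    then have "norm (qpoch_inf (q powi (int K + (c - i)) / x) q) \<le> majorant (norm (q powi (c - i) / x))"
      by (intro order_trans[OF norm_qpoch_inf_le] majorant_mono) auto
    then show ?thesis
      unfolding norm_mult[of "_ * _" "qpoch_inf _ _"] by (intro mult_left_mono) auto
  qed
  show "(\<lambda>i. norm (q powi (i * i) * z powi i) * majorant (norm (q powi (c - i) / x))) summable_on UNIV"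
    by (rule damped_square_terms_summable[OF z])
  have "(\<lambda>K. q powi (i * i) * z powi i * qpoch_inf (q powi (int K + (c - i)) / x) q)
           \<longlonglongrightarrow> q powi (i * i) * z powi i * 1" for i
  proof (intro tendsto_intros qpoch_inf_tendsto_1)
    have "(\<lambda>K. q powi (int K + (c - i)) / x) \<longlonglongrightarrow> 0 / x"
      by (intro tendsto_intros powi_tendsto_0) (use arg_nz in auto)
    then show "(\<lambda>K. q powi (int K + (c - i)) / x) \<longlonglongrightarrow> 0" by simp
  qed
  then show "(\<lambda>K. q powi (i * i) * z powi i * qpoch_inf (q powi (int K + (c - i)) / x) q)
           \<longlonglongrightarrow> q powi (i * i) * z powi i" for i
    by simp
qed

text \<open>
  Put \<open>j = i + K\<close> and rewrite the reciprocal by \<open>recip_eq_theta\<close>. The exponents of \<open>q\<close> then add up to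
  \<open>K\<^sup>2 + K + i\<^sup>2\<close>, with no term mixing \<open>i\<close> and \<open>K\<close>.
\<close>

lemma appell_even:
  "appell x (- 2 * int K) = q powi (int K * int K + int K) / theta q x *
     (\<Sum>\<^sub>\<infinity>i. q powi (i * i) * (x\<^sup>2) powi i * qpoch_inf (q powi (int K + (1 - i)) / x) q)"
proof -
  have "appell x (- 2 * int K) = (\<Sum>\<^sub>\<infinity>i. q powi tri (i + int K) * (- q * x) powi (i + int K)
          * recip x (i + int K + - 2 * int K))"
    unfolding appell_def by (rule infsum_int_shift[symmetric])
  also have "\<dots> = (\<Sum>\<^sub>\<infinity>i. q powi (int K * int K + int K) / theta q x *
       (q powi (i * i) * (x\<^sup>2) powi i * qpoch_inf (q powi (int K + (1 - i)) / x) q))"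
  proof (rule infsum_cong)
    fix i
    have 1: "i + int K + - 2 * int K = i - int K" "1 - (i - int K) = int K + (1 - i)" by auto
    have P: "(- q * x) powi (i + int K) * (- x) powi (i - int K) = q powi int K * ((x\<^sup>2) powi i * q powi i)"
      using powi_pair[of "- q * x" "- x" "int K" i] arg_nz nome_nz
      by (simp add: power_int_mult_distrib[symmetric] power2_eq_square mult_ac add.commute)
    have "tri (i + int K) + tri (i - int K) + int K + i = int K * int K + int K + i * i"
      using two_tri[of "i + int K"] two_tri[of "i - int K"] by (simp add: algebra_simps)
    from arg_cong[OF this, of "\<lambda>k. q powi k"]
    have E: "q powi tri (i + int K) * q powi tri (i - int K) * q powi int K * q powi i =
        q powi (int K * int K + int K) * q powi (i * i)"
      by (simp only: powi_add)
    have "q powi tri (i + int K) * ((- q * x) powi (i + int K) * ((- x) powi (i - int K) * q powi tri (i - int K)))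
        = q powi tri (i + int K) * q powi tri (i - int K) * ((- q * x) powi (i + int K) * (- x) powi (i - int K))"
      by (simp only: mult_ac)
    also have "\<dots> = q powi tri (i + int K) * q powi tri (i - int K) * q powi int K * q powi i * (x\<^sup>2) powi i"
      unfolding P by (simp only: mult_ac)
    finally have "q powi tri (i + int K) * ((- q * x) powi (i + int K) * ((- x) powi (i - int K) * q powi tri (i - int K)))
        = q powi (int K * int K + int K) * (q powi (i * i) * (x\<^sup>2) powi i)"
      unfolding E by (simp only: mult.assoc)
    then show "q powi tri (i + int K) * (- q * x) powi (i + int K) * recip x (i + int K + - 2 * int K) =
       q powi (int K * int K + int K) / theta q x *
       (q powi (i * i) * (x\<^sup>2) powi i * qpoch_inf (q powi (int K + (1 - i)) / x) q)"
      unfolding 1 recip_eq_theta using theta_nz by (simp add: field_simps)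
  qed
  finally show ?thesis by (simp only: infsum_cmult_right')
qed

text \<open>
  The same substitution gives the exponent \<open>(K + 1)\<^sup>2 + i\<^sup>2 - i\<close>; the linear term in \<open>i\<close> accounts for the
  base \<open>x\<^sup>2 / q\<close>.
\<close>

lemma appell_odd:
  "appell x (- 2 * int K - 1) = - (q powi ((int K + 1) * (int K + 1))) / (x * theta q x) *
     (\<Sum>\<^sub>\<infinity>i. q powi (i * i) * (x\<^sup>2 / q) powi i * qpoch_inf (q powi (int K + (2 - i)) / x) q)"
proof -
  have "appell x (- 2 * int K - 1) = (\<Sum>\<^sub>\<infinity>i. q powi tri (i + int K) * (- q * x) powi (i + int K)
          * recip x (i + int K + (- 2 * int K - 1)))"
    unfolding appell_def by (rule infsum_int_shift[symmetric])
  also have "\<dots> = (\<Sum>\<^sub>\<infinity>i. - (q powi ((int K + 1) * (int K + 1))) / (x * theta q x) *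
       (q powi (i * i) * (x\<^sup>2 / q) powi i * qpoch_inf (q powi (int K + (2 - i)) / x) q))"
  proof (rule infsum_cong)
    fix i
    have 1: "i + int K + (- 2 * int K - 1) = i - int K - 1" "1 - (i - int K - 1) = int K + (2 - i)" by auto
    have "(- x) powi (i - int K) = - x * (- x) powi (i - int K - 1)"
      using power_int_add[of "- x" 1 "i - int K - 1"] arg_nz by simp
    then have P: "(- q * x) powi (i + int K) * (- x * (- x) powi (i - int K - 1)) =
        q powi int K * ((x\<^sup>2) powi i * q powi i)"
      using powi_pair[of "- q * x" "- x" "int K" i] arg_nz nome_nz
      by (simp add: power_int_mult_distrib[symmetric] power2_eq_square mult_ac add.commute)
    have "tri (i + int K) + tri (i - int K - 1) + int K + i + i = (int K + 1) * (int K + 1) + i * i"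
      using two_tri[of "i + int K"] two_tri[of "i - int K - 1"] by (simp add: algebra_simps)
    from arg_cong[OF this, of "\<lambda>k. q powi k"]
    have E: "q powi tri (i + int K) * q powi tri (i - int K - 1) * q powi int K * q powi i * q powi i =
        q powi ((int K + 1) * (int K + 1)) * q powi (i * i)"
      by (simp only: powi_add)
    have "q powi tri (i + int K) * ((- q * x) powi (i + int K) *
          ((- x) powi (i - int K - 1) * q powi tri (i - int K - 1))) * x * q powi i
        = - (q powi tri (i + int K) * q powi tri (i - int K - 1) * q powi i *
            ((- q * x) powi (i + int K) * (- x * (- x) powi (i - int K - 1))))"
      by (simp only: mult_ac mult_minus_left mult_minus_right minus_minus)
    also have "\<dots> = - (q powi tri (i + int K) * q powi tri (i - int K - 1) * q powi int K * q powi i * q powi i * (x\<^sup>2) powi i)"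
      unfolding P by (simp only: mult_ac)
    finally have "q powi tri (i + int K) * ((- q * x) powi (i + int K) *
          ((- x) powi (i - int K - 1) * q powi tri (i - int K - 1))) * x * q powi i
        = - (q powi ((int K + 1) * (int K + 1)) * (q powi (i * i) * (x\<^sup>2) powi i))"
      unfolding E by (simp only: mult.assoc)
    then have 2: "q powi tri (i + int K) * ((- q * x) powi (i + int K) *
          ((- x) powi (i - int K - 1) * q powi tri (i - int K - 1)))
        = - (q powi ((int K + 1) * (int K + 1)) * (q powi (i * i) * ((x\<^sup>2) powi i / q powi i))) / x"
      using arg_nz powi_nz[of i] by (simp add: field_simps)
    have "q powi tri (i + int K) * (- q * x) powi (i + int K) * recip x (i + int K + (- 2 * int K - 1)) =
        q powi tri (i + int K) * ((- q * x) powi (i + int K) *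
          ((- x) powi (i - int K - 1) * q powi tri (i - int K - 1))) *
          (qpoch_inf (q powi (int K + (2 - i)) / x) q / theta q x)"
      unfolding 1 recip_eq_theta by (simp only: times_divide_eq_right mult.assoc)
    then show "q powi tri (i + int K) * (- q * x) powi (i + int K) * recip x (i + int K + (- 2 * int K - 1)) =
       - (q powi ((int K + 1) * (int K + 1))) / (x * theta q x) *
       (q powi (i * i) * (x\<^sup>2 / q) powi i * qpoch_inf (q powi (int K + (2 - i)) / x) q)"
      unfolding 2 by (simp add: power_int_divide_distrib mult_ac)
  qed
  finally show ?thesis by (simp only: infsum_cmult_right')
qed

lemma appell_even_tendsto:
  "(\<lambda>K. appell x (- 2 * int K) / q powi (int K * int K + int K))
     \<longlonglongrightarrow> (\<Sum>\<^sub>\<infinity>i. q powi (i * i) * (x\<^sup>2) powi i) / theta q x"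
proof -
  have "(\<lambda>K. (\<Sum>\<^sub>\<infinity>i. q powi (i * i) * (x\<^sup>2) powi i * qpoch_inf (q powi (int K + (1 - i)) / x) q) / theta q x)
     \<longlonglongrightarrow> (\<Sum>\<^sub>\<infinity>i. q powi (i * i) * (x\<^sup>2) powi i) / theta q x"
    by (intro tendsto_divide tendsto_const damped_square_sum_tendsto) (use arg_nz theta_nz in auto)
  then show ?thesis
    unfolding appell_even using powi_nz by (simp add: field_simps)
qed

lemma appell_odd_tendsto:
  "(\<lambda>K. appell x (- 2 * int K - 1) / q powi ((int K + 1) * (int K + 1)))
     \<longlonglongrightarrow> - ((\<Sum>\<^sub>\<infinity>i. q powi (i * i) * (x\<^sup>2 / q) powi i) / (x * theta q x))"
proof -
  have "(\<lambda>K. - ((\<Sum>\<^sub>\<infinity>i. q powi (i * i) * (x\<^sup>2 / q) powi i * qpoch_inf (q powi (int K + (2 - i)) / x) q) / (x * theta q x)))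
     \<longlonglongrightarrow> - ((\<Sum>\<^sub>\<infinity>i. q powi (i * i) * (x\<^sup>2 / q) powi i) / (x * theta q x))"
    by (intro tendsto_minus tendsto_divide tendsto_const damped_square_sum_tendsto)
       (use arg_nz nome_nz theta_nz in auto)
  then show ?thesis
    unfolding appell_odd using powi_nz nome_nz by (simp add: field_simps)
qed

end

text \<open>
  By \<open>schur_casoratian_consecutive\<close> the Casoratian at \<open>n = - 2 K - 1\<close> is \<open>- q powi tri n\<close> times the one at
  \<open>0\<close>, and \<open>tri n\<close> is exactly the sum of the exponents by which the even and odd values of the two series are
  normalized. So the constant is the limit, as \<open>K \<rightarrow> \<infinity>\<close>, of an expression in the normalized values.
\<close>

theorem (in nome) appell_casoratian:
  assumes x: "nome_arg q x" and y: "nome_arg q y"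
  shows "appell y 0 * appell x 1 - appell y 1 * appell x 0 =
     theta q (x * y) * theta q (y / x) * (qpoch_inf q q)\<^sup>2 / (y * theta q x * theta q y)"
proof -
  interpret x: nome_arg q x by (rule x)
  interpret y: nome_arg q y by (rule y)
  define A where "A z = (\<Sum>\<^sub>\<infinity>i. q powi (i * i) * (z\<^sup>2) powi i)" for z
  define B where "B z = (\<Sum>\<^sub>\<infinity>i. q powi (i * i) * (z\<^sup>2 / q) powi i)" for z
  define \<alpha> where "\<alpha> z K = appell z (- 2 * int K) / q powi (int K * int K + int K)" for z K
  define \<beta> where "\<beta> z K = appell z (- 2 * int K - 1) / q powi ((int K + 1) * (int K + 1))" for z K
  define W where "W = appell y 0 * appell x 1 - appell y 1 * appell x 0"
  have "\<alpha> y K * \<beta> x K - \<beta> y K * \<alpha> x K = W" for K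
  proof -
    \<comment> \<open>The odd index just below the even index \<open>- 2 K\<close>, so that one Casoratian involves both kinds of values.\<close>
    define n where "n = - 2 * int K - 1"
    have n1: "n + 1 = - 2 * int K" by (simp add: n_def)
    have "odd n" by (simp add: n_def)
    then have sgn: "(- 1) powi n = (- 1 :: complex)" by simp
    have "tri n = (int K * int K + int K) + (int K + 1) * (int K + 1)"
      using two_tri[of n] by (simp add: n_def algebra_simps)
    then have "q powi tri n = q powi (int K * int K + int K) * q powi ((int K + 1) * (int K + 1))"
      by (simp only: powi_add)
    moreover have "appell y n * appell x (n + 1) - appell y (n + 1) * appell x n = - (q powi tri n * W)"
      using schur_casoratian_consecutive[OF nome_nz y.appell_rec x.appell_rec, of n] sgn by (simp add: W_def)
    ultimately have "appell y (n + 1) * appell x n - appell y n * appell x (n + 1) =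
        q powi (int K * int K + int K) * q powi ((int K + 1) * (int K + 1)) * W"
      by (simp add: algebra_simps)
    then show ?thesis
      unfolding \<alpha>_def \<beta>_def n1[symmetric] n_def[symmetric]
      using powi_nz nome_nz by (simp add: field_simps)
  qed
  moreover have "(\<lambda>K. \<alpha> y K * \<beta> x K - \<beta> y K * \<alpha> x K) \<longlonglongrightarrow>
      (A y / theta q y) * (- (B x / (x * theta q x))) - (- (B y / (y * theta q y))) * (A x / theta q x)"
    unfolding \<alpha>_def \<beta>_def A_def B_def
    by (intro tendsto_diff tendsto_mult x.appell_even_tendsto y.appell_even_tendsto
          x.appell_odd_tendsto y.appell_odd_tendsto)
  ultimately have "(\<lambda>K::nat. W) \<longlonglongrightarrow>
      (A y / theta q y) * (- (B x / (x * theta q x))) - (- (B y / (y * theta q y))) * (A x / theta q x)"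
    by simp
  then have "W = (A y / theta q y) * (- (B x / (x * theta q x))) - (- (B y / (y * theta q y))) * (A x / theta q x)"
    by (simp add: LIMSEQ_const_iff)
  also have "\<dots> = (A x * B y - y / x * (B x * A y)) / (y * theta q x * theta q y)"
    using x.theta_nz y.theta_nz x.arg_nz y.arg_nz by (simp add: field_simps)
  also have "A x * B y - y / x * (B x * A y) = theta q (x * y) * theta q (y / x) * (qpoch_inf q q)\<^sup>2"
    unfolding A_def B_def theta_product_parity_split[OF x.arg_nz y.arg_nz] ..
  finally show ?thesis by (simp add: W_def)
qed

section \<open>The pentagonal number theorem and the quintuple product\<close>

context nome
begin

lemma euler_function_trisection:
  "qpoch_inf q q = qpoch_inf q (q ^ 3) * qpoch_inf (q ^ 2) (q ^ 3) * qpoch_inf (q ^ 3) (q ^ 3)"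
proof (rule LIMSEQ_unique)
  interpret cube: nome "q ^ 3" by (rule nome_power) simp
  have "filterlim (\<lambda>n::nat. 3 * n) at_top sequentially"
    by (rule filterlim_subseq) (auto simp: strict_mono_def)
  from filterlim_compose[OF qpoch_inf_limit this]
  show "(\<lambda>n. \<Prod>k<3 * n. 1 - q * q ^ k) \<longlonglongrightarrow> qpoch_inf q q" .
  have "(\<Prod>k<3 * n. 1 - q * q ^ k) = (\<Prod>k<n. 1 - q * (q ^ 3) ^ k) * (\<Prod>k<n. 1 - q ^ 2 * (q ^ 3) ^ k)
           * (\<Prod>k<n. 1 - q ^ 3 * (q ^ 3) ^ k)" for n
  proof (induction n)
    case (Suc n)
    have "(\<Prod>k<3 * Suc n. 1 - q * q ^ k) = (\<Prod>k<3 * n. 1 - q * q ^ k) *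
        ((1 - q * (q ^ 3) ^ n) * (1 - q ^ 2 * (q ^ 3) ^ n) * (1 - q ^ 3 * (q ^ 3) ^ n))"
    proof -
      have "3 * Suc n = Suc (Suc (Suc (3 * n)))" "(q ^ 3) ^ n = q ^ (3 * n)"
        by (simp_all add: power_mult)
      then show ?thesis
        by (simp only: prod.lessThan_Suc power_Suc) (simp add: power2_eq_square power3_eq_cube mult_ac)
    qed
    then show ?case unfolding Suc.IH by (simp only: prod.lessThan_Suc mult_ac)
  qed simp
  then show "(\<lambda>n. \<Prod>k<3 * n. 1 - q * q ^ k)
      \<longlonglongrightarrow> qpoch_inf q (q ^ 3) * qpoch_inf (q ^ 2) (q ^ 3) * qpoch_inf (q ^ 3) (q ^ 3)"
    by (simp only:) (intro tendsto_mult cube.qpoch_inf_limit)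
qed

theorem pentagonal_number_theorem: "qpoch_inf q q = theta_series (q ^ 3) (- (q ^ 2))"
proof -
  interpret cube: nome "q ^ 3" by (rule nome_power) simp
  have "q ^ 3 / q ^ 2 = q"
    using nome_nz by (simp add: power2_eq_square power3_eq_cube)
  then have "theta_series (q ^ 3) (- (q ^ 2)) = qpoch_inf (q ^ 2) (q ^ 3) * qpoch_inf q (q ^ 3) * qpoch_inf (q ^ 3) (q ^ 3)"
    using cube.jacobi_triple_product[of "q ^ 2"] nome_nz by (simp add: theta_def)
  then show ?thesis
    unfolding euler_function_trisection by (simp only: mult_ac)
qed

text \<open>
  This is \<open>\<Sum>n. (- 1)^n q^(n(3n+1)/2) (z^(3n+1) + z^(-3n))\<close>, written as two theta series with nome \<open>q^3\<close>.
\<close>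

definition quintuple_series :: "complex \<Rightarrow> complex" where
  "quintuple_series z = z * theta_series (q ^ 3) (- (q ^ 2 * z ^ 3)) + theta_series (q ^ 3) (- (q ^ 2 / z ^ 3))"

text \<open>
  Replacing \<open>(q; q)\<^sub>\<infinity>\<close> by its pentagonal series makes all three products double series over \<open>\<int> \<times> \<int>\<close>, with
  terms \<open>F0\<close> on the left and \<open>F1\<close>, \<open>F2\<close> on the right. Compare the terms with a fixed power of \<open>z\<close>: the
  left-hand side has even powers only. For odd powers \<open>F1\<close> and \<open>F2\<close> cancel; for even powers they are
  matched with the terms of \<open>F0\<close> of odd and of even index sum. In each case \<open>(k, n)\<close> parametrizes the terms, with
  \<open>2 k\<close> or \<open>2 k + 1\<close> the power of \<open>z\<close>.
\<close>

lemma quintuple_product_series: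
  assumes z: "z \<noteq> 0"
  shows "qpoch_inf q q * theta_series q (- (z ^ 2)) = theta_series q (- z) * quintuple_series z"
proof -
  interpret cube: nome "q ^ 3" by (rule nome_power) simp
  define t where "t Q w n = Q powi tri n * w powi n" for Q w :: complex and n
  have t: "(t q w has_sum theta_series q w) UNIV" if "w \<noteq> 0" for w
    unfolding t_def theta_series_def by (rule has_sum_infsum[OF theta_terms_summable[OF that]])
  have t3: "(t (q ^ 3) w has_sum theta_series (q ^ 3) w) UNIV" if "w \<noteq> 0" for w
    unfolding t_def theta_series_def by (rule has_sum_infsum[OF cube.theta_terms_summable[OF that]])
  define F0 where "F0 = (\<lambda>(k, l). t q (- (z ^ 2)) k * t (q ^ 3) (- (q ^ 2)) l)"
  define F1 where "F1 = (\<lambda>(m, n). t q (- z) m * (z * t (q ^ 3) (- (q ^ 2 * z ^ 3)) n))"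
  define F2 where "F2 = (\<lambda>(m, n). t q (- z) m * t (q ^ 3) (- (q ^ 2 / z ^ 3)) n)"
  \<comment> \<open>Normal form of a term: sign \<open>s\<close> modulo 2, power of \<open>z\<close>, power of \<open>q\<close>.\<close>
  define X where "X s N e = (- 1) powi s * z powi N * q powi e" for s N e
  have F0_sum: "(F0 has_sum theta_series q (- (z ^ 2)) * theta_series (q ^ 3) (- (q ^ 2))) UNIV"
    unfolding F0_def UNIV_Times_UNIV[symmetric]
    by (intro has_sum_times t t3) (use z nome_nz in auto)
  have F1_sum: "(F1 has_sum theta_series q (- z) * (z * theta_series (q ^ 3) (- (q ^ 2 * z ^ 3)))) UNIV"
    unfolding F1_def UNIV_Times_UNIV[symmetric]
    by (intro has_sum_times has_sum_cmult_right t t3) (use z nome_nz in auto)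
  have F2_sum: "(F2 has_sum theta_series q (- z) * theta_series (q ^ 3) (- (q ^ 2 / z ^ 3))) UNIV"
    unfolding F2_def UNIV_Times_UNIV[symmetric]
    by (intro has_sum_times t t3) (use z nome_nz in auto)
  have F0: "F0 (k, l) = X (k + l) (2 * k) (tri k + 3 * tri l + 2 * l)" for k l
  proof -
    have "(- (z ^ 2)) powi k = (- 1) powi k * z powi (2 * k)" "(- (q ^ 2)) powi l = (- 1) powi l * q powi (2 * l)"
      using powi_scaled[of "- 1" z 2 k] powi_scaled[of "- 1" q 2 l] by simp_all
    then show ?thesis
      unfolding F0_def prod.case t_def X_def powi_power using z nome_nz
      by (simp add: power_int_add)
  qed
  have F1: "F1 (m, n) = X (m + n) (m + 3 * n + 1) (tri m + 3 * tri n + 2 * n)" for m n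
  proof -
    have "(- z) powi m = (- 1) powi m * z powi m"
      "(- (q ^ 2 * z ^ 3)) powi n = (- 1) powi n * q powi (2 * n) * z powi (3 * n)"
      using powi_scaled[of "- 1" z 1 m] powi_scaled[of "- (q ^ 2)" z 3 n] powi_scaled[of "- 1" q 2 n] by simp_all
    then show ?thesis
      unfolding F1_def prod.case t_def X_def powi_power using z nome_nz
      by (simp add: power_int_add)
  qed
  have F2: "F2 (m, n) = X (m + n) (m - 3 * n) (tri m + 3 * tri n + 2 * n)" for m n
  proof -
    have "(- z) powi m = (- 1) powi m * z powi m"
      "(- (q ^ 2 / z ^ 3)) powi n = (- 1) powi n * q powi (2 * n) / z powi (3 * n)"
      using powi_scaled[of "- 1" z 1 m] powi_scaled[of "- 1" q 2 n] powi_power[of z 3 n]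
      by (simp_all only: minus_divide_left power_int_divide_distrib) simp_all
    then show ?thesis
      unfolding F2_def prod.case t_def X_def powi_power using z nome_nz
      by (simp add: power_int_add power_int_diff)
  qed
  \<comment> \<open>For each of the three double series the parity of the index sum tells the two kinds of terms apart.\<close>
  define S where "S = {(m :: int, n :: int). even (m + n)}"
  have "(\<Sum>\<^sub>\<infinity>p. F0 p) = (\<Sum>\<^sub>\<infinity>p. F0 (case p of (k, n) \<Rightarrow> (k, - 2 * n - k)))
      + (\<Sum>\<^sub>\<infinity>p. F0 (case p of (k, n) \<Rightarrow> (k, k - 1 - 2 * n)))"
  proof (rule infsum_split_bij[OF has_sum_imp_summable[OF F0_sum]])
    show "bij_betw (\<lambda>p :: int \<times> int. case p of (k, n) \<Rightarrow> (k, - 2 * n - k)) UNIV S"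
      unfolding S_def by (rule bij_betwI[of _ _ _ "\<lambda>(k, l). (k, - ((k + l) div 2))"]) auto
    show "bij_betw (\<lambda>p :: int \<times> int. case p of (k, n) \<Rightarrow> (k, k - 1 - 2 * n)) UNIV (- S)"
      unfolding S_def by (rule bij_betwI[of _ _ _ "\<lambda>(k, l). (k, (k - 1 - l) div 2)"]) (auto, presburger+)
  qed
  moreover have "(\<Sum>\<^sub>\<infinity>p. F1 p) = (\<Sum>\<^sub>\<infinity>p. F1 (case p of (k, n) \<Rightarrow> (- k - 3 * n, n + k)))
      + (\<Sum>\<^sub>\<infinity>p. F1 (case p of (k, n) \<Rightarrow> (2 * k - 1 - 3 * n, n)))"
  proof (rule infsum_split_bij[OF has_sum_imp_summable[OF F1_sum]])
    show "bij_betw (\<lambda>p :: int \<times> int. case p of (k, n) \<Rightarrow> (- k - 3 * n, n + k)) UNIV S"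
      unfolding S_def by (rule bij_betwI[of _ _ _ "\<lambda>(m, l). (l + (m + l) div 2, - ((m + l) div 2))"]) auto
    show "bij_betw (\<lambda>p :: int \<times> int. case p of (k, n) \<Rightarrow> (2 * k - 1 - 3 * n, n)) UNIV (- S)"
      unfolding S_def by (rule bij_betwI[of _ _ _ "\<lambda>(m, n). ((m + 1 + 3 * n) div 2, n)"]) (auto, presburger+)
  qed
  moreover have "(\<Sum>\<^sub>\<infinity>p. F2 p) = (\<Sum>\<^sub>\<infinity>p. F2 (case p of (k, n) \<Rightarrow> (2 * k + 3 * n, n)))
      + (\<Sum>\<^sub>\<infinity>p. F2 (case p of (k, n) \<Rightarrow> (2 * k + 1 + 3 * n, n)))"
  proof (rule infsum_split_bij[OF has_sum_imp_summable[OF F2_sum]])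
    show "bij_betw (\<lambda>p :: int \<times> int. case p of (k, n) \<Rightarrow> (2 * k + 3 * n, n)) UNIV S"
      unfolding S_def by (rule bij_betwI[of _ _ _ "\<lambda>(m, n). ((m - 3 * n) div 2, n)"]) auto
    show "bij_betw (\<lambda>p :: int \<times> int. case p of (k, n) \<Rightarrow> (2 * k + 1 + 3 * n, n)) UNIV (- S)"
      unfolding S_def by (rule bij_betwI[of _ _ _ "\<lambda>(m, n). ((m - 1 - 3 * n) div 2, n)"]) (auto, presburger+)
  qed
  moreover have "F0 (k, - 2 * n - k) = F2 (2 * k + 3 * n, n)" for k n
  proof -
    have "tri k + 3 * tri (- 2 * n - k) + 2 * (- 2 * n - k) = tri (2 * k + 3 * n) + 3 * tri n + 2 * n"
      using two_tri[of k] two_tri[of "- 2 * n - k"] two_tri[of "2 * k + 3 * n"] two_tri[of n]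
      by (simp add: algebra_simps)
    moreover have "(- 1 :: complex) powi (k + (- 2 * n - k)) = (- 1) powi (2 * k + 3 * n + n)"
      by (rule minus_one_powi_cong) simp
    ultimately show ?thesis
      unfolding F0 F2 X_def by (simp only:) simp
  qed
  moreover have "F0 (k, k - 1 - 2 * n) = F1 (2 * k - 1 - 3 * n, n)" for k n
  proof -
    have "tri k + 3 * tri (k - 1 - 2 * n) + 2 * (k - 1 - 2 * n) = tri (2 * k - 1 - 3 * n) + 3 * tri n + 2 * n"
      using two_tri[of k] two_tri[of "k - 1 - 2 * n"] two_tri[of "2 * k - 1 - 3 * n"] two_tri[of n]
      by (simp add: algebra_simps)
    moreover have "(- 1 :: complex) powi (k + (k - 1 - 2 * n)) = (- 1) powi (2 * k - 1 - 3 * n + n)"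
      by (rule minus_one_powi_cong) simp
    ultimately show ?thesis
      unfolding F0 F1 X_def by (simp only:) simp
  qed
  moreover have "F1 (- k - 3 * n, n + k) = - F2 (2 * k + 1 + 3 * n, n)" for k n
  proof -
    have "tri (- k - 3 * n) + 3 * tri (n + k) + 2 * (n + k) = tri (2 * k + 1 + 3 * n) + 3 * tri n + 2 * n"
      using two_tri[of "- k - 3 * n"] two_tri[of "n + k"] two_tri[of "2 * k + 1 + 3 * n"] two_tri[of n]
      by (simp add: algebra_simps)
    moreover have "(- 1 :: complex) powi (- k - 3 * n + (n + k)) = (- 1) powi (2 * k + 3 * n + n)"
      by (rule minus_one_powi_cong) simp
    moreover have "(- 1 :: complex) powi (2 * k + 1 + 3 * n + n) = - ((- 1) powi (2 * k + 3 * n + n))"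
      using power_int_add[of "- 1 :: complex" "2 * k + 3 * n + n" 1] by (simp add: algebra_simps)
    ultimately show ?thesis
      unfolding F1 F2 X_def by (simp only:) (simp add: algebra_simps)
  qed
  ultimately have "(\<Sum>\<^sub>\<infinity>p. F0 p) = (\<Sum>\<^sub>\<infinity>p. F1 p) + (\<Sum>\<^sub>\<infinity>p. F2 p)"
    by (simp add: case_prod_unfold infsum_uminus)
  then have "theta_series q (- (z ^ 2)) * theta_series (q ^ 3) (- (q ^ 2)) =
      theta_series q (- z) * (z * theta_series (q ^ 3) (- (q ^ 2 * z ^ 3))) +
      theta_series q (- z) * theta_series (q ^ 3) (- (q ^ 2 / z ^ 3))"
    unfolding infsumI[OF F0_sum] infsumI[OF F1_sum] infsumI[OF F2_sum] .
  then show ?thesis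
    unfolding quintuple_series_def pentagonal_number_theorem by (simp add: algebra_simps)
qed

theorem quintuple_product_identity:
  assumes z: "z \<noteq> 0"
  shows "qpoch_inf q q * theta q (z ^ 2) = theta q z * quintuple_series z"
proof -
  have z2: "z ^ 2 \<noteq> 0" using z by simp
  have "qpoch_inf q q * (theta q (z ^ 2) * qpoch_inf q q) = theta q z * qpoch_inf q q * quintuple_series z"
    unfolding jacobi_triple_product[OF z] jacobi_triple_product[OF z2]
    by (rule quintuple_product_series[OF z])
  then show ?thesis
    using qpoch_inf_nome_nz by (simp add: mult.commute)
qed

text \<open>
  The exponents \<open>n(3n+1)/2\<close> take only the residues 0, 1 and 2 modulo 5. The class \<open>n = - 1 - 5 m\<close>
  reproduces the pentagonal series with nome \<open>q^25\<close>; the classes of \<open>0\<close> and \<open>- 2\<close> make up the first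
  quintuple product series, those of \<open>1\<close> and \<open>- 3\<close> the second.
\<close>

theorem euler_function_5_dissection:
  "qpoch_inf q q = nome.quintuple_series (q ^ 25) (q ^ 5) - q * qpoch_inf (q ^ 25) (q ^ 25)
     - q ^ 2 * nome.quintuple_series (q ^ 25) (q ^ 10)"
proof -
  interpret cube: nome "q ^ 3" by (rule nome_power) simp
  interpret base25: nome "q ^ 25" by (rule nome_power) simp
  define f where "f n = (q ^ 3) powi tri n * (- (q ^ 2)) powi n" for n
  have f: "f n = (- 1) powi n * q powi (3 * tri n + 2 * n)" for n
    unfolding f_def using powi_scaled[of "- 1" q 2 n] powi_power[of q 3]
    by (simp add: powi_add)
  have term_eq: "f n = s * (q ^ c * ((q ^ 75) powi tri m * (- (q ^ a)) powi m))"
    if "3 * tri n + 2 * n = int c + 75 * tri m + int a * m" "(- 1) powi n = s * (- 1) powi m" for n m c a s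
  proof -
    have "(- (q ^ a)) powi m = (- 1) powi m * q powi (int a * m)"
      using powi_scaled[of "- 1" q a m] by simp
    moreover have "(q ^ 75) powi tri m = q powi (75 * tri m)"
      using powi_power[of q 75] by simp
    ultimately show ?thesis
      unfolding f that by (simp add: powi_add mult_ac)
  qed
  \<comment> \<open>Each residue class contributes one theta series with nome \<open>q ^ 75\<close>, since \<open>3 tri (r - 5 m)\<close> has leading part \<open>75 tri m\<close>.\<close>
  have part: "(\<Sum>\<^sub>\<infinity>m. f (r - 5 * m)) = s * (q ^ c * theta_series (q ^ 75) (- (q ^ a)))"
    if "\<And>m. 3 * tri (r - 5 * m) + 2 * (r - 5 * m) = int c + 75 * tri m + int a * m" "(- 1) powi r = s" for r c a s
  proof -
    have "(- 1) powi (r - 5 * m) = s * (- 1) powi m" for m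
    proof -
      have "(- 1 :: complex) powi (r - 5 * m) = (- 1) powi (r + m)"
        by (rule minus_one_powi_cong) simp
      then show ?thesis using that(2) by (simp add: power_int_add)
    qed
    then have "f (r - 5 * m) = s * (q ^ c * ((q ^ 75) powi tri m * (- (q ^ a)) powi m))" for m
      by (intro term_eq that(1))
    then show ?thesis
      unfolding theta_series_def by (simp only: infsum_cmult_right')
  qed
  have "3 * tri (1 - 5 * m) + 2 * (1 - 5 * m) = int 2 + 75 * tri m + int 20 * m" for m
    using two_tri[of "1 - 5 * m"] two_tri[of m] by (simp add: algebra_simps)
  then have p1: "(\<Sum>\<^sub>\<infinity>m. f (1 - 5 * m)) = - 1 * (q ^ 2 * theta_series (q ^ 75) (- (q ^ 20)))"
    by (rule part) simp
  have "3 * tri (0 - 5 * m) + 2 * (0 - 5 * m) = int 0 + 75 * tri m + int 35 * m" for m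
    using two_tri[of "0 - 5 * m"] two_tri[of m] by (simp add: algebra_simps)
  then have p0: "(\<Sum>\<^sub>\<infinity>m. f (0 - 5 * m)) = 1 * (q ^ 0 * theta_series (q ^ 75) (- (q ^ 35)))"
    by (rule part) simp
  have "3 * tri (- 1 - 5 * m) + 2 * (- 1 - 5 * m) = int 1 + 75 * tri m + int 50 * m" for m
    using two_tri[of "- 1 - 5 * m"] two_tri[of m] by (simp add: algebra_simps)
  then have pm1: "(\<Sum>\<^sub>\<infinity>m. f (- 1 - 5 * m)) = - 1 * (q ^ 1 * theta_series (q ^ 75) (- (q ^ 50)))"
    by (rule part) simp
  have "3 * tri (- 2 - 5 * m) + 2 * (- 2 - 5 * m) = int 5 + 75 * tri m + int 65 * m" for m
    using two_tri[of "- 2 - 5 * m"] two_tri[of m] by (simp add: algebra_simps)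
  then have pm2: "(\<Sum>\<^sub>\<infinity>m. f (- 2 - 5 * m)) = 1 * (q ^ 5 * theta_series (q ^ 75) (- (q ^ 65)))"
    by (rule part) simp
  have "3 * tri (- 3 - 5 * m) + 2 * (- 3 - 5 * m) = int 12 + 75 * tri m + int 80 * m" for m
    using two_tri[of "- 3 - 5 * m"] two_tri[of m] by (simp add: algebra_simps)
  then have pm3: "(\<Sum>\<^sub>\<infinity>m. f (- 3 - 5 * m)) = - 1 * (q ^ 12 * theta_series (q ^ 75) (- (q ^ 80)))"
    by (rule part) simp
  have "qpoch_inf q q = (\<Sum>\<^sub>\<infinity>n. f n)"
    unfolding pentagonal_number_theorem theta_series_def f_def ..
  also have "\<dots> = (\<Sum>j<5. \<Sum>\<^sub>\<infinity>m. f (1 - int j - 5 * m))"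
  proof (rule infsum_int_mod_5)
    show "f summable_on UNIV"
      unfolding f_def using nome_nz by (intro cube.theta_terms_summable) auto
  qed
  also have "\<dots> = (\<Sum>\<^sub>\<infinity>m. f (1 - 5 * m)) + (\<Sum>\<^sub>\<infinity>m. f (0 - 5 * m)) + (\<Sum>\<^sub>\<infinity>m. f (- 1 - 5 * m))
      + (\<Sum>\<^sub>\<infinity>m. f (- 2 - 5 * m)) + (\<Sum>\<^sub>\<infinity>m. f (- 3 - 5 * m))"
    by (simp add: numeral_eq_Suc)
  also have "\<dots> = (q ^ 5 * theta_series (q ^ 75) (- (q ^ 65)) + theta_series (q ^ 75) (- (q ^ 35)))
      - q * theta_series (q ^ 75) (- (q ^ 50))
      - q ^ 2 * (q ^ 10 * theta_series (q ^ 75) (- (q ^ 80)) + theta_series (q ^ 75) (- (q ^ 20)))"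
    unfolding p1 p0 pm1 pm2 pm3 by (simp add: algebra_simps flip: power_add)
  also have "theta_series (q ^ 75) (- (q ^ 50)) = qpoch_inf (q ^ 25) (q ^ 25)"
    unfolding base25.pentagonal_number_theorem by (simp flip: power_mult)
  also have "q ^ 5 * theta_series (q ^ 75) (- (q ^ 65)) + theta_series (q ^ 75) (- (q ^ 35)) =
      nome.quintuple_series (q ^ 25) (q ^ 5)"
  proof -
    have "(q ^ 25) ^ 3 = q ^ 75" "(q ^ 25) ^ 2 * (q ^ 5) ^ 3 = q ^ 65" "(q ^ 25) ^ 2 / (q ^ 5) ^ 3 = q ^ 35"
      using nome_nz by (simp_all add: divide_eq_eq flip: power_mult power_add)
    then show ?thesis unfolding base25.quintuple_series_def by (simp only:)
  qed
  also have "q ^ 10 * theta_series (q ^ 75) (- (q ^ 80)) + theta_series (q ^ 75) (- (q ^ 20)) =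
      nome.quintuple_series (q ^ 25) (q ^ 10)"
  proof -
    have "(q ^ 25) ^ 3 = q ^ 75" "(q ^ 25) ^ 2 * (q ^ 10) ^ 3 = q ^ 80" "(q ^ 25) ^ 2 / (q ^ 10) ^ 3 = q ^ 20"
      using nome_nz by (simp_all add: divide_eq_eq flip: power_mult power_add)
    then show ?thesis unfolding base25.quintuple_series_def by (simp only:)
  qed
  finally show ?thesis .
qed

end

section \<open>The eta quotient\<close>

context nome
begin

lemma theta_root_nz:
  assumes "0 < k" "k < 5"
  shows "theta (q ^ 5) (q ^ k) \<noteq> 0"
proof -
  interpret fifth: nome "q ^ 5" by (rule nome_power) simp
  have "q ^ k \<noteq> (q ^ 5) powi j" for j
  proof
    assume "q ^ k = (q ^ 5) powi j"
    then have "q powi int k = q powi (5 * j)"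
      using powi_power[of q 5 j] by simp
    then have eq: "q powi (int k - 5 * j) = 1"
      using nome_nz by (simp add: power_int_diff)
    have "int k - 5 * j \<noteq> 0"
      using assms by presburger
    then consider "0 < int k - 5 * j" | "0 < 5 * j - int k" by linarith
    then show False
    proof cases
      case 1
      then have "q ^ nat (int k - 5 * j) = 1"
        using eq by (simp add: power_int_def)
      then show False using power_neq_1[of "nat (int k - 5 * j)"] 1 by simp
    next
      case 2
      have "q powi (5 * j - int k) = 1"
        using eq power_int_minus[of q "int k - 5 * j"] by simp
      then have "q ^ nat (5 * j - int k) = 1"
        using 2 by (simp add: power_int_def)
      then show False using power_neq_1[of "nat (5 * j - int k)"] 2 by simp
    qed
  qed
  then show ?thesis
    using fifth.theta_eq_0_iff[of "q ^ k"] nome_nz by auto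
qed

lemma rogers_ramanujan_products:
  "qpoch_inf q q * rr_G q = theta (q ^ 5) (q ^ 2) * qpoch_inf (q ^ 5) (q ^ 5)"
  "qpoch_inf q q * rr_H q = theta (q ^ 5) q * qpoch_inf (q ^ 5) (q ^ 5)"
proof -
  interpret fifth: nome "q ^ 5" by (rule nome_power) simp
  have *: "q ^ 5 / q ^ 2 = q ^ 3" "q ^ 5 / q = q ^ 4"
    using nome_nz by (simp_all add: divide_eq_eq flip: power_add power_Suc2)
  have "theta_series (q ^ 5) (- (q ^ 3)) = theta (q ^ 5) (q ^ 3) * qpoch_inf (q ^ 5) (q ^ 5)"
    using nome_nz by (simp add: fifth.jacobi_triple_product)
  moreover have "theta (q ^ 5) (q ^ 3) = theta (q ^ 5) (q ^ 2)"
    using fifth.theta_reflect[of "q ^ 2"] nome_nz * by simp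
  ultimately show "qpoch_inf q q * rr_G q = theta (q ^ 5) (q ^ 2) * qpoch_inf (q ^ 5) (q ^ 5)"
    unfolding rogers_ramanujan_G by simp
  have "theta_series (q ^ 5) (- (q ^ 4)) = theta (q ^ 5) (q ^ 4) * qpoch_inf (q ^ 5) (q ^ 5)"
    using nome_nz by (simp add: fifth.jacobi_triple_product)
  moreover have "theta (q ^ 5) (q ^ 4) = theta (q ^ 5) q"
    using fifth.theta_reflect[of q] nome_nz * by simp
  ultimately show "qpoch_inf q q * rr_H q = theta (q ^ 5) q * qpoch_inf (q ^ 5) (q ^ 5)"
    unfolding rogers_ramanujan_H by simp
qed

lemma rr_nz: "rr_G q \<noteq> 0" "rr_H q \<noteq> 0"
proof -
  interpret fifth: nome "q ^ 5" by (rule nome_power) simp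
  show "rr_G q \<noteq> 0" "rr_H q \<noteq> 0"
    using rogers_ramanujan_products theta_root_nz[of 2] theta_root_nz[of 1]
      fifth.qpoch_inf_nome_nz by auto
qed

text \<open>
  With nome \<open>q^5\<close> the quintuple product identity gives, up to the factor \<open>(q^5; q^5)\<^sub>\<infinity>\<close>, the quotient
  \<open>\<theta>(q\<^sup>2) / \<theta>(q)\<close> at \<open>z = q\<close> and the quotient \<open>\<theta>(q\<^sup>4) / \<theta>(q\<^sup>2)\<close> with \<open>\<theta>(q\<^sup>4) = \<theta>(q)\<close> at \<open>z = q\<^sup>2\<close>.
\<close>

lemma quintuple_series_rr:
  "nome.quintuple_series (q ^ 5) q = qpoch_inf (q ^ 5) (q ^ 5) * (rr_G q / rr_H q)"
  "nome.quintuple_series (q ^ 5) (q ^ 2) = qpoch_inf (q ^ 5) (q ^ 5) * (rr_H q / rr_G q)"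
proof -
  interpret fifth: nome "q ^ 5" by (rule nome_power) simp
  define E where "E = qpoch_inf (q ^ 5) (q ^ 5)"
  define a where "a = theta (q ^ 5) q"
  define b where "b = theta (q ^ 5) (q ^ 2)"
  have nz: "a \<noteq> 0" "b \<noteq> 0" "E \<noteq> 0"
    using theta_root_nz[of 2] theta_root_nz[of 1] fifth.qpoch_inf_nome_nz
    by (auto simp: a_def b_def E_def)
  have G: "rr_G q = b * E / qpoch_inf q q" and H: "rr_H q = a * E / qpoch_inf q q"
    using rogers_ramanujan_products qpoch_inf_nome_nz
    unfolding a_def b_def E_def by (simp_all add: field_simps)
  have "E * b = a * fifth.quintuple_series q"
    unfolding E_def a_def b_def by (rule fifth.quintuple_product_identity[OF nome_nz])
  then show "fifth.quintuple_series q = qpoch_inf (q ^ 5) (q ^ 5) * (rr_G q / rr_H q)"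
    unfolding G H E_def[symmetric] using nz qpoch_inf_nome_nz by (simp add: field_simps)
  have "q ^ 5 / q = q ^ 4"
    using nome_nz by (simp add: divide_eq_eq flip: power_Suc2)
  then have "theta (q ^ 5) ((q ^ 2) ^ 2) = a"
    using fifth.theta_reflect[of q] nome_nz by (simp add: a_def flip: power_mult)
  then have "E * a = b * fifth.quintuple_series (q ^ 2)"
    using fifth.quintuple_product_identity[of "q ^ 2"] nome_nz by (simp add: E_def b_def)
  then show "fifth.quintuple_series (q ^ 2) = qpoch_inf (q ^ 5) (q ^ 5) * (rr_H q / rr_G q)"
    unfolding G H E_def[symmetric] using nz qpoch_inf_nome_nz by (simp add: field_simps)
qed

theorem euler_function_rogers_ramanujan:
  "qpoch_inf q q = qpoch_inf (q ^ 25) (q ^ 25) *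
     (rr_G (q ^ 5) / rr_H (q ^ 5) - q - q ^ 2 * (rr_H (q ^ 5) / rr_G (q ^ 5)))"
proof -
  interpret fifth: nome "q ^ 5" by (rule nome_power) simp
  have pw: "(q ^ 5) ^ 5 = q ^ 25" "(q ^ 5) ^ 2 = q ^ 10"
    by (simp_all flip: power_mult)
  show ?thesis
    unfolding euler_function_5_dissection
      fifth.quintuple_series_rr(1)[unfolded pw] fifth.quintuple_series_rr(2)[unfolded pw]
    by (simp add: algebra_simps)
qed

end

lemma nome_qpow: "nome (qpow \<tau> s)" if "Im \<tau> > 0" "s > 0"
proof
  show "qpow \<tau> s \<noteq> 0" by (simp add: qpow_def)
  show "norm (qpow \<tau> s) < 1"
    using that by (simp add: qpow_def)
qed

lemma qpow_power: "qpow \<tau> s ^ n = qpow \<tau> (real n * s)"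
  unfolding qpow_def exp_of_nat_mult[symmetric] by (simp add: mult_ac)

lemma qpow_scale: "qpow (of_real c * \<tau>) s = qpow \<tau> (c * s)"
  by (simp add: qpow_def mult_ac)

lemma qpow_add: "qpow \<tau> (s + t) = qpow \<tau> s * qpow \<tau> t"
  by (simp add: qpow_def ring_distribs exp_add)

text \<open>
  With \<open>p = q^(1/5)\<close> and \<open>c = G/H\<close> one has \<open>R = p / c\<close>, and the prefactors \<open>q^(1/24)\<close> of the two eta functions
  contribute \<open>q^(5/24 - 1/120) = p\<close>. This turns the claim into \<open>euler_function_rogers_ramanujan\<close> for \<open>p\<close>.
\<close>

lemma eta_quotient_rogers_ramanujan:
  assumes \<tau>: "Im \<tau> > 0"
  shows "dedekind_eta (5 * \<tau>) / dedekind_eta (\<tau> / 5) * (1 / rr_R \<tau> - 1 - rr_R \<tau>) = 1"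
proof -
  define p where "p = qpow \<tau> (1 / 5)"
  interpret p: nome p unfolding p_def by (rule nome_qpow[OF \<tau>]) simp
  interpret q: nome "p ^ 5" by (rule p.nome_power) simp
  have q: "qpow \<tau> 1 = p ^ 5"
    unfolding p_def qpow_power by simp
  define c where "c = rr_G (p ^ 5) / rr_H (p ^ 5)"
  have c: "c \<noteq> 0" using q.rr_nz by (simp add: c_def)
  have R: "rr_R \<tau> = p / c"
    unfolding rr_R_def q p_def[symmetric] c_def by simp
  have euler: "qpoch_inf p p = qpoch_inf (p ^ 25) (p ^ 25) * (c - p - p ^ 2 / c)"
    using p.euler_function_rogers_ramanujan by (simp add: c_def)
  have "qpow (5 * \<tau>) s = qpow \<tau> (5 * s)" "qpow (\<tau> / 5) s = qpow \<tau> (s / 5)" for s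
    using qpow_scale[of 5 \<tau> s] qpow_scale[of "1 / 5" \<tau> s] by simp_all
  moreover have "qpow \<tau> (5 * 1) = p ^ 25"
    unfolding p_def qpow_power by simp
  ultimately have "dedekind_eta (5 * \<tau>) = qpow \<tau> (5 / 24) * qpoch_inf (p ^ 25) (p ^ 25)"
    "dedekind_eta (\<tau> / 5) = qpow \<tau> (1 / 120) * qpoch_inf p p"
    by (simp_all add: dedekind_eta_def p_def)
  moreover have "qpow \<tau> (5 / 24) = qpow \<tau> (1 / 120) * p"
    unfolding p_def qpow_add[symmetric] by simp
  moreover have "qpow \<tau> (1 / 120) \<noteq> 0"
    by (simp add: qpow_def)
  ultimately have "dedekind_eta (5 * \<tau>) / dedekind_eta (\<tau> / 5) =
      p * qpoch_inf (p ^ 25) (p ^ 25) / qpoch_inf p p"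
    by simp
  also have "\<dots> * (1 / rr_R \<tau> - 1 - rr_R \<tau>) = qpoch_inf (p ^ 25) (p ^ 25) * (c - p - p ^ 2 / c) / qpoch_inf p p"
  proof -
    have "1 / rr_R \<tau> - 1 - rr_R \<tau> = (c - p - p ^ 2 / c) / p"
      unfolding R using p.nome_nz c by (simp add: field_simps power2_eq_square)
    then show ?thesis using p.nome_nz by simp
  qed
  also have "\<dots> = 1"
    using p.qpoch_inf_nome_nz by (simp flip: euler)
  finally show ?thesis .
qed

section \<open>The functions M\<close>

text \<open>
  Shifting the summation index by \<open>n\<close> moves the \<open>n\<close>-dependence from the argument of the series into the
  Pochhammer symbol; the factor that comes out is the quasi-periodicity factor of \<open>\<theta>(q^n / x)\<close>, which therefore
  cancels in \<open>M_eq_appell\<close>.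
\<close>

lemma (in nome_arg) psi12_eq_appell:
  "psi12 q x (x * q powi (1 - n)) = qpoch_inf x q * ((- x) powi n / q powi tri n) * appell x n"
proof -
  have "psi12 q x (x * q powi (1 - n)) =
      (\<Sum>\<^sub>\<infinity>k. qpoch x q (k + n) * (- 1) powi (k + n) * q powi tri (k + n) * (x * q powi (1 - n)) powi (k + n))"
    unfolding psi12_def tri_def by (rule infsum_int_shift[symmetric])
  also have "\<dots> = (\<Sum>\<^sub>\<infinity>j. qpoch_inf x q * ((- x) powi n / q powi tri n) *
      (q powi tri j * (- q * x) powi j * recip x (j + n)))"
  proof (rule infsum_cong)
    fix j
    have "tri (j + n) + (1 - n) * (j + n) = tri j + j - tri n"
      using two_tri[of "j + n"] two_tri[of j] two_tri[of n] by (simp add: algebra_simps)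
    from arg_cong[OF this, of "\<lambda>k. q powi k"]
    have e1: "q powi tri (j + n) * q powi ((1 - n) * (j + n)) = q powi tri j * q powi j / q powi tri n"
      using nome_nz by (simp add: powi_add power_int_diff)
    have e2: "(- 1) powi (j + n) * x powi (j + n) = (- 1) powi j * x powi j * (- x) powi n"
      unfolding power_int_mult_distrib[symmetric] using arg_nz by (simp add: power_int_add)
    have e3: "(x * q powi (1 - n)) powi (j + n) = x powi (j + n) * q powi ((1 - n) * (j + n))"
      by (simp only: power_int_mult_distrib power_int_mult)
    have e4: "(- q * x) powi j = q powi j * ((- 1) powi j * x powi j)"
      unfolding power_int_mult_distrib[symmetric] by simp
    have "qpoch x q (j + n) * (- 1) powi (j + n) * q powi tri (j + n) * (x * q powi (1 - n)) powi (j + n)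
        = qpoch x q (j + n) * ((- 1) powi (j + n) * x powi (j + n)) * (q powi tri (j + n) * q powi ((1 - n) * (j + n)))"
      unfolding e3 by (simp only: mult_ac)
    also have "\<dots> = qpoch_inf x q * ((- x) powi n / q powi tri n) * (q powi tri j * (- q * x) powi j * recip x (j + n))"
      unfolding e1 e2 e4 qpoch_def recip_def by (simp add: mult_ac)
    finally show "qpoch x q (j + n) * (- 1) powi (j + n) * q powi tri (j + n) * (x * q powi (1 - n)) powi (j + n)
        = qpoch_inf x q * ((- x) powi n / q powi tri n) * (q powi tri j * (- q * x) powi j * recip x (j + n))" .
  qed
  also have "\<dots> = qpoch_inf x q * ((- x) powi n / q powi tri n) * appell x n"
    unfolding appell_def by (rule infsum_cmult_right')
  finally show ?thesis .
qed

lemma (in nome_arg) M_eq_appell: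
  assumes q: "q = qpow \<tau> 1"
  shows "M \<tau> n x = appell x n / (qpoch_inf q q * theta q (1 / x))"
proof -
  have "theta q (1 / x * q powi n) * ((- (1 / x)) powi n * q powi tri n) = theta q (1 / x)"
    using arg_nz by (intro theta_quasi_period) auto
  moreover have "(- (1 / x)) powi n = 1 / (- x) powi n"
  proof -
    have "- (1 / x) = 1 / (- x)" by simp
    then show ?thesis by (simp only: power_int_divide_distrib power_int_1_left)
  qed
  ultimately have "theta q (q powi n / x) * q powi tri n = theta q (1 / x) * (- x) powi n"
    using arg_nz by (simp add: field_simps)
  then have th: "theta q (q powi n / x) = theta q (1 / x) * ((- x) powi n / q powi tri n)"
    using powi_nz by (simp add: field_simps)
  have "(- x) powi n / q powi tri n \<noteq> 0"
    using arg_nz nome_nz by simp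
  moreover have "qpoch_inf x q \<noteq> 0"
    using qpoch_inf_arg_nz[of 0] by simp
  ultimately show ?thesis
    unfolding M_eq_psi12[OF q arg_nz] psi12_eq_appell th using arg_nz by simp
qed

lemma (in nome_arg) M_schur_rec:
  assumes "q = qpow \<tau> 1"
  shows "schur_rec q (\<lambda>n. M \<tau> n x)"
  unfolding schur_rec_def M_eq_appell[OF assms]
proof
  fix n
  have "appell x n = appell x (n - 1) + q powi (n - 2) * appell x (n - 2)"
    using appell_rec unfolding schur_rec_def by blast
  then show "appell x n / (qpoch_inf q q * theta q (1 / x)) =
      appell x (n - 1) / (qpoch_inf q q * theta q (1 / x)) +
      q powi (n - 2) * (appell x (n - 2) / (qpoch_inf q q * theta q (1 / x)))"
    by (simp add: add_divide_distrib)
qed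

lemma (in nome_arg) M_tendsto_1:
  assumes "q = qpow \<tau> 1"
  shows "(\<lambda>N. M \<tau> (int N) x) \<longlonglongrightarrow> 1"
proof -
  have nz: "qpoch_inf q q * theta q (1 / x) \<noteq> 0"
    using qpoch_inf_nome_nz theta_inverse[OF arg_nz] theta_nz arg_nz by simp
  have "(\<lambda>N. appell x (int N) / (qpoch_inf q q * theta q (1 / x)))
      \<longlonglongrightarrow> qpoch_inf q q * theta q (1 / x) / (qpoch_inf q q * theta q (1 / x))"
    by (intro tendsto_divide appell_tendsto tendsto_const nz)
  then show ?thesis using nz by (simp add: M_eq_appell[OF assms])
qed

lemma (in nome_arg) phi01_M_pairing:
  assumes "q = qpow \<tau> 1"
  shows "phi01 q (q powi (n + 1)) * M \<tau> (n + 1) x + q powi n * phi01 q (q powi (n + 2)) * M \<tau> n x = 1"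
  by (rule phi01_pairing_eq_limit[OF M_schur_rec M_tendsto_1]) (fact assms)+

lemma (in nome_arg) rr_M_pairing:
  assumes "q = qpow \<tau> 1"
  shows "rr_G q * M \<tau> 1 x + rr_H q * M \<tau> 0 x = 1"
  using phi01_M_pairing[OF assms, of 0] by (simp add: rr_G_eq_phi01 rr_H_eq_phi01)

lemma (in nome) M_casoratian_initial:
  assumes q: "q = qpow \<tau> 1" and x: "nome_arg q x" and y: "nome_arg q y"
  shows "M \<tau> 0 y * M \<tau> 1 x - M \<tau> 1 y * M \<tau> 0 x =
    x * (theta q (x * y) * theta q (y / x) / ((theta q x)\<^sup>2 * (theta q y)\<^sup>2))"
proof -
  interpret x: nome_arg q x by (rule x)
  interpret y: nome_arg q y by (rule y)
  define E where "E = qpoch_inf q q"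
  have E: "E \<noteq> 0" using qpoch_inf_nome_nz by (simp add: E_def)
  have "M \<tau> 0 y * M \<tau> 1 x - M \<tau> 1 y * M \<tau> 0 x =
      (appell y 0 * appell x 1 - appell y 1 * appell x 0) / ((E * theta q (1 / x)) * (E * theta q (1 / y)))"
    unfolding x.M_eq_appell[OF q] y.M_eq_appell[OF q] E_def[symmetric] by (simp add: diff_divide_distrib mult_ac)
  also have "\<dots> = theta q (x * y) * theta q (y / x) * E\<^sup>2 / (y * theta q x * theta q y) /
      ((E * (- theta q x / x)) * (E * (- theta q y / y)))"
    unfolding appell_casoratian[OF x y] theta_inverse[OF x.arg_nz] theta_inverse[OF y.arg_nz] E_def ..
  also have "\<dots> = x * (theta q (x * y) * theta q (y / x) / ((theta q x)\<^sup>2 * (theta q y)\<^sup>2))"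
    using E x.arg_nz y.arg_nz x.theta_nz y.theta_nz by (simp add: divide_simps power2_eq_square)
  finally show ?thesis .
qed

theorem corollary1:
  fixes \<tau> q x y :: complex
  assumes "Im \<tau> > 0"
    and "q = qpow \<tau> 1"
    and "x \<noteq> 0" and "y \<noteq> 0"
    and "x \<notin> range (\<lambda>k :: int. q powi k)"
    and "y \<notin> range (\<lambda>k :: int. q powi k)"
  shows
    "(\<forall>m n :: int.
        M \<tau> n y * M \<tau> m x - M \<tau> m y * M \<tau> n x =
        x * (theta q (x * y) * theta q (y / x) / ((theta q x)\<^sup>2 * (theta q y)\<^sup>2)) *
          (schur_S q m * schur_T q (n - 1) - schur_S q n * schur_T q (m - 1)))
   \<and> (\<forall>m n :: int.
        (-1) powi n * q powi (n * (n - 1) div 2) * phi01 q (q powi (n + 1)) * M \<tau> m x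
        - (-1) powi m * q powi (m * (m - 1) div 2) * phi01 q (q powi (m + 1)) * M \<tau> n x =
        schur_S q m * schur_T q (n - 1) - schur_S q n * schur_T q (m - 1))
   \<and> (\<forall>n :: int.
        M \<tau> n y * M \<tau> (n + 1) x - M \<tau> (n + 1) y * M \<tau> n x =
        (-1) powi n * x * q powi (n * (n - 1) div 2) *
          (theta q (x * y) * theta q (y / x) / ((theta q x)\<^sup>2 * (theta q y)\<^sup>2)))
   \<and> (\<forall>n :: int.
        phi01 q (q powi (n + 1)) * M \<tau> (n + 1) x
        + q powi n * phi01 q (q powi (n + 2)) * M \<tau> n x = 1)
   \<and> M \<tau> 0 y * M \<tau> 1 x - M \<tau> 1 y * M \<tau> 0 x =
        x * (theta q (x * y) * theta q (y / x) / ((theta q x)\<^sup>2 * (theta q y)\<^sup>2))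
   \<and> rr_G q * M \<tau> 1 x + rr_H q * M \<tau> 0 x =
        rr_G q * M \<tau> 1 (qpow \<tau> (1 / 5)) + rr_H q * M \<tau> 0 (qpow \<tau> (1 / 5))
   \<and> rr_G q * M \<tau> 1 (qpow \<tau> (1 / 5)) + rr_H q * M \<tau> 0 (qpow \<tau> (1 / 5)) =
        dedekind_eta (5 * \<tau>) / dedekind_eta (\<tau> / 5) * (1 / rr_R \<tau> - 1 - rr_R \<tau>)
   \<and> dedekind_eta (5 * \<tau>) / dedekind_eta (\<tau> / 5) * (1 / rr_R \<tau> - 1 - rr_R \<tau>) = 1"
proof -
  note q = \<open>q = qpow \<tau> 1\<close>
  interpret nome q
    unfolding q by (rule nome_qpow[OF assms(1)]) simp
  interpret x: nome_arg q x by unfold_locales (fact assms)+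
  interpret y: nome_arg q y by unfold_locales (fact assms)+
  define p where "p = qpow \<tau> (1 / 5)"
  interpret p: nome p
    unfolding p_def by (rule nome_qpow[OF assms(1)]) simp
  have p5: "p ^ 5 = q"
    unfolding q p_def qpow_power by simp
  \<comment> \<open>\<open>p\<close> is no integral power of \<open>q = p ^ 5\<close>, because the theta function with nome \<open>p ^ 5\<close> does not vanish there.\<close>
  interpret p': nome_arg q p
  proof
    show "p \<noteq> 0" by (rule p.nome_nz)
    show "p \<notin> range (\<lambda>k. q powi k)"
      using p.theta_root_nz[of 1] theta_eq_0_iff[OF p.nome_nz] by (simp add: p5)
  qed
  define C where "C = x * (theta q (x * y) * theta q (y / x) / ((theta q x)\<^sup>2 * (theta q y)\<^sup>2))"
  have initial: "M \<tau> 0 y * M \<tau> 1 x - M \<tau> 1 y * M \<tau> 0 x = C"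
    unfolding C_def by (rule M_casoratian_initial[OF q x.nome_arg_axioms y.nome_arg_axioms])
  note Mx = x.M_schur_rec[OF q] and My = y.M_schur_rec[OF q]
  have 1: "M \<tau> n y * M \<tau> m x - M \<tau> m y * M \<tau> n x =
      C * (schur_S q m * schur_T q (n - 1) - schur_S q n * schur_T q (m - 1))" for m n
    using schur_casoratian[OF nome_nz My Mx, of n m] unfolding initial .
  have 3: "M \<tau> n y * M \<tau> (n + 1) x - M \<tau> (n + 1) y * M \<tau> n x = (- 1) powi n * x * q powi tri n *
      (theta q (x * y) * theta q (y / x) / ((theta q x)\<^sup>2 * (theta q y)\<^sup>2))" for n
    using schur_casoratian_consecutive[OF nome_nz My Mx, of n] unfolding initial C_def by (simp add: mult_ac)
  have 2: "(- 1) powi n * q powi tri n * phi01 q (q powi (n + 1)) * M \<tau> m x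
      - (- 1) powi m * q powi tri m * phi01 q (q powi (m + 1)) * M \<tau> n x =
      schur_S q m * schur_T q (n - 1) - schur_S q n * schur_T q (m - 1)" for m n
    using schur_casoratian[OF nome_nz phi01_schur_rec Mx, of n m] x.phi01_M_pairing[OF q, of 0]
    by (simp add: tri_def)
  have 6: "rr_G q * M \<tau> 1 p + rr_H q * M \<tau> 0 p = 1"
    by (rule p'.rr_M_pairing[OF q])
  show ?thesis
    unfolding p_def[symmetric] tri_def[symmetric] eta_quotient_rogers_ramanujan[OF assms(1)]
      6 x.rr_M_pairing[OF q]
    by (intro conjI allI 1[unfolded C_def] 2 3 x.phi01_M_pairing[OF q] initial[unfolded C_def] refl)
qed

end
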